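(* In the two-period screening model with a cost of early payments described in the context, for any $\gamma>0$, the committed spend contract with minimum spend $$B(\theta)=t^*(\theta,\underline v(\theta))$$ (that is, the contract in which no payment is made in period 0 and type $\theta$ pays in period 1 according to the schedule $p_\theta(q^*(\theta,v))=t^*(\theta,v)$) is optimal. Furthermore, it is the only optimal contract where (on-path) transfers are always positive.
   Context: Model. A seller produces a quantity $q\ge 0$ at constant marginal cost $c\ge 0$. In period 0 the buyer privately observes a signal $\theta\in[\underline\theta,\overline\theta]\subset\mathbb{R}_+$, with distribution $F$ and density $f$. In period 1 the buyer privately observes the value $v$, which ranges over $[\underline v,\overline v]$. Its distribution conditional on $\theta$ is $G(\cdot\mid\theta)$, with density $g(\cdot\mid\theta)$. Let $\underline v(\theta):=\inf\{v\mid g(v\mid\theta)>0\}$. The dynamic virtual value is $\varphi(\theta,v)=v+\frac{1-F(\theta)}{f(\theta)}\cdot\frac{\partial G(v\mid\theta)/\partial\theta}{g(v\mid\theta)}$. Standing assumptions. (1) $G(\cdot\mid\theta)$ is ordered in first order stochastic dominance by $\theta$, in the sense that $G(v\mid\theta)<G(v\mid\theta')$ for all $v$ and all $\theta'<\theta$. (2) $\varphi(\theta,v)$ is weakly increasing in both $\theta$ and $v$. Payoffs with commitment cost. A contract specifies a quantity $q(\theta,v)\ge0$, a payment $t_0(\theta)$ made in period 0 and a payment $t_1(\theta,v)$ made in period 1. The timing of transfers matters to the buyer but not to the seller. With $\alpha\in(0,1)$, the buyer's utility is $vq^{\alpha}-(1+\gamma\,\mathbb{I}_{[t_0\ge0]})t_0-t_1$,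 $\gamma\ge0$, so the buyer incurs a linear penalty $\gamma$ on payments made in the early period. The seller's profit is $t_0+t_1-cq$. A contract is optimal if it maximizes the seller's expected profit subject to: truthful reporting of $\theta$ in period 0 (in expected utility over $v\sim G(\cdot\mid\theta)$, for all $\theta,\theta'$); truthful reporting of $v$ in period 1 (for all $\theta,v,v'$); and nonnegative expected buyer utility conditional on each $\theta$ in period 0. The functions $q^*,t^*$ are the optimal mechanism when there is no commitment cost, so that only the total transfer $t=t_0+t_1$ matters. They are $q^*(\theta,v)=\left(\frac{\alpha}{c}\varphi(\theta,v)\mathbb{I}_{[\varphi(\theta,v)\ge0]}\right)^{1/(1-\alpha)}$ and $t^*(\theta,v)=v\,q^*(\theta,v)^{\alpha}-u(\theta,v)$. Here $u$ is determined by $u(\theta,v)=u(\theta,\underline v)+\int_{\underline v}^{v}q^*(\theta,x)^{\alpha}dx$ and $\mathrm{E}_v[u(\theta,v)\mid\theta]=-\int_{\underline\theta}^{\theta}\int_{\underline v}^{\overline v}q^*(x,v)^{\alpha}\frac{\partial G(v\mid x)}{\partial x}dv\,dx$. Contracts. A pricing schedule is a function $p:\mathbb{R}_+\to\mathbb{R}_+$ specifying a set of possible quantities and a price for each. A committed spend contract is a collection of pricing schedules $\{p_\theta\}$, with payment in period 1 only, such that each type has a minimum spend $B(\theta):=\min_{q\in\mathbb{R}_+}[p_\theta(q)]$ which is strictly positive for all $\theta>\underline\theta$. The committed spend contract implementing $(q^*,t^* )$ is characterized by $p_\theta(q^*(\theta,v))=t^*(\theta,v)$. It is regarded as unique up to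 the values $p_\theta(q)$ at quantities never chosen in equilibrium, and the largest possible minimum spend in it is $t^*(\theta,\underline v(\theta))$. "Positive" transfers means transfers in $\mathbb{R}_+$, i.e. no payments from the seller to the buyer.
   Formalization: "Only optimal contract" holds up to null sets of (θ,v), since pointwise it fails; B(θ)>0 is claimed only for types buying a positive quantity at an on-path value v with G(v|lowest type)<1, as excluded types have B=0. Also c>0 and each conditional support is an interval. *)

theory Defs
  imports "HOL-Probability.Probability"
begin

record screening_model =
  alpha :: real
  cost :: real
  th_lo :: real
  th_hi :: real
  v_lo :: real
  v_hi :: real
  dens_f :: "real \<Rightarrow> real"
  dens_g :: "real \<Rightarrow> real \<Rightarrow> real"
  \<comment> \<open>\<open>dens_g M \<theta> v\<close> is the conditional density \<open>g(v | \<theta>)\<close>\<close>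

definition Types :: "screening_model \<Rightarrow> real set" where
  "Types M = {th_lo M..th_hi M}"

definition Vals :: "screening_model \<Rightarrow> real set" where
  "Vals M = {v_lo M..v_hi M}"

definition type_law :: "screening_model \<Rightarrow> real measure" where
  "type_law M = density lborel (\<lambda>\<theta>. ennreal (dens_f M \<theta>))"

definition value_law :: "screening_model \<Rightarrow> real \<Rightarrow> real measure" where
  "value_law M \<theta> = density lborel (\<lambda>v. ennreal (dens_g M \<theta> v))"

definition joint_law :: "screening_model \<Rightarrow> (real \<times> real) measure" where
  "joint_law M = density (lborel \<Otimes>\<^sub>M lborel)
     (\<lambda>(\<theta>, v). ennreal (dens_f M \<theta> * dens_g M \<theta> v))"

definition F :: "screening_model \<Rightarrow> real \<Rightarrow> real" where
  "F M \<theta> = cdf (type_law M) \<theta>"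

definition G :: "screening_model \<Rightarrow> real \<Rightarrow> real \<Rightarrow> real" where
  "G M \<theta> v = cdf (value_law M \<theta>) v"

text \<open>The partial derivative of \<open>G(v | \<theta>)\<close> in \<open>\<theta>\<close>, one-sided at the two ends of the type interval.\<close>

definition dG :: "screening_model \<Rightarrow> real \<Rightarrow> real \<Rightarrow> real" where
  "dG M \<theta> v = vector_derivative (\<lambda>x. G M x v) (at \<theta> within Types M)"

definition v_inf :: "screening_model \<Rightarrow> real \<Rightarrow> real" where
  "v_inf M \<theta> = Inf {v. dens_g M \<theta> v > 0}"

text \<open>The support of \<open>g(\<cdot> | \<theta>)\<close> may move with \<open>\<theta>\<close>, but it is an interval. Where
  \<open>g(v | \<theta>) > 0\<close> the partial derivative in the virtual value exists; elsewhere only continuity of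
  \<open>G(v | \<theta>)\<close> in \<open>\<theta>\<close> is required, since \<open>G\<close> has a kink in \<open>\<theta>\<close> where the support moves past \<open>v\<close>.\<close>

definition screening :: "screening_model \<Rightarrow> bool" where
  "screening M \<longleftrightarrow>
     0 < alpha M \<and> alpha M < 1 \<and> 0 < cost M \<and> 0 \<le> th_lo M \<and>
     dens_f M \<in> borel_measurable borel \<and>
     (\<forall>\<theta>\<in>Types M. 0 < dens_f M \<theta>) \<and> (\<forall>\<theta>. \<theta> \<notin> Types M \<longrightarrow> dens_f M \<theta> = 0) \<and>
     prob_space (type_law M) \<and>
     (\<lambda>(\<theta>, v). dens_g M \<theta> v) \<in> borel_measurable (borel \<Otimes>\<^sub>M borel) \<and>
     (\<forall>\<theta>\<in>Types M.
        (\<forall>v. 0 \<le> dens_g M \<theta> v) \<and> (\<forall>v. v \<notin> Vals M \<longrightarrow> dens_g M \<theta> v = 0) \<and>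
        prob_space (value_law M \<theta>) \<and> convex {v. dens_g M \<theta> v > 0}) \<and>
     (\<forall>v\<in>Vals M. continuous_on (Types M) (\<lambda>\<theta>. G M \<theta> v)) \<and>
     (\<forall>\<theta>\<in>Types M. \<forall>v. dens_g M \<theta> v > 0 \<longrightarrow>
        (\<lambda>x. G M x v) differentiable (at \<theta> within Types M))"

text \<open>Strict first order stochastic dominance. The strict inequality cannot hold at values where
  both distribution functions are 0 or both are 1 (in particular at the ends of the value
  interval); only these are exempted.\<close>

definition fosd_ordered :: "screening_model \<Rightarrow> bool" where
  "fosd_ordered M \<longleftrightarrow>
     (\<forall>\<theta>'\<in>Types M. \<forall>\<theta>\<in>Types M. \<forall>v\<in>Vals M. \<theta>' < \<theta> \<longrightarrow>
        G M \<theta> v < G M \<theta>' v \<or> (G M \<theta> v = G M \<theta>' v \<and> G M \<theta> v \<in> {0, 1}))"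

text \<open>The formula for the virtual value only makes sense where \<open>g(v | \<theta>) > 0\<close>. At the remaining
  points of the rectangle, \<open>\<phi>\<close> may be any extension that is compatible with
  monotonicity; the results hold for every such extension.\<close>

definition dynamic_virtual_value :: "screening_model \<Rightarrow> (real \<Rightarrow> real \<Rightarrow> real) \<Rightarrow> bool" where
  "dynamic_virtual_value M \<phi> \<longleftrightarrow>
     (\<lambda>(\<theta>, v). \<phi> \<theta> v) \<in> borel_measurable (restrict_space borel (Types M \<times> Vals M)) \<and>
     (\<forall>\<theta>\<in>Types M. \<forall>v\<in>Vals M. dens_g M \<theta> v > 0 \<longrightarrow>
        \<phi> \<theta> v = v + (1 - F M \<theta>) / dens_f M \<theta> * (dG M \<theta> v / dens_g M \<theta> v))"

definition weakly_increasing2 :: "screening_model \<Rightarrow> (real \<Rightarrow> real \<Rightarrow> real) \<Rightarrow> bool" where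
  "weakly_increasing2 M \<phi> \<longleftrightarrow>
     (\<forall>\<theta>\<in>Types M. mono_on (Vals M) (\<lambda>v. \<phi> \<theta> v)) \<and>
     (\<forall>v\<in>Vals M. mono_on (Types M) (\<lambda>\<theta>. \<phi> \<theta> v))"

definition qstar :: "screening_model \<Rightarrow> (real \<Rightarrow> real \<Rightarrow> real) \<Rightarrow> real \<Rightarrow> real \<Rightarrow> real" where
  "qstar M \<phi> \<theta> v =
     (alpha M / cost M * \<phi> \<theta> v * of_bool (0 \<le> \<phi> \<theta> v)) powr (1 / (1 - alpha M))"

definition ex_post_utility ::
  "screening_model \<Rightarrow> (real \<Rightarrow> real \<Rightarrow> real) \<Rightarrow> (real \<Rightarrow> real \<Rightarrow> real) \<Rightarrow> bool" where
  "ex_post_utility M \<phi> u \<longleftrightarrow> (\<forall>\<theta>\<in>Types M.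
     (\<forall>v\<in>Vals M.
        u \<theta> v = u \<theta> (v_lo M) + (LINT x:{v_lo M..v}|lborel. qstar M \<phi> \<theta> x powr alpha M)) \<and>
     (LINT v:Vals M|value_law M \<theta>. u \<theta> v) =
       - (LINT x:{th_lo M..\<theta>}|lborel.
            LINT v:Vals M|lborel. qstar M \<phi> x v powr alpha M * dG M x v))"

definition tstar ::
  "screening_model \<Rightarrow> (real \<Rightarrow> real \<Rightarrow> real) \<Rightarrow> (real \<Rightarrow> real \<Rightarrow> real) \<Rightarrow> real \<Rightarrow> real \<Rightarrow> real" where
  "tstar M \<phi> u \<theta> v = v * qstar M \<phi> \<theta> v powr alpha M - u \<theta> v"

text \<open>A contract is a triple \<open>q\<close>, \<open>t0\<close>, \<open>t1\<close> of functions on the type and value intervals.\<close>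

definition buyer_utility :: "screening_model \<Rightarrow> real \<Rightarrow> real \<Rightarrow> real \<Rightarrow> real \<Rightarrow> real \<Rightarrow> real" where
  "buyer_utility M \<gamma> v x p0 p1 =
     v * x powr alpha M - (1 + \<gamma> * of_bool (0 \<le> p0)) * p0 - p1"

text \<open>Expected utility of type \<open>\<theta>\<close> who reports \<open>r\<close> in period 0 and then reports the value truthfully.\<close>

definition interim_utility ::
  "screening_model \<Rightarrow> real \<Rightarrow> (real \<Rightarrow> real \<Rightarrow> real) \<Rightarrow> (real \<Rightarrow> real) \<Rightarrow> (real \<Rightarrow> real \<Rightarrow> real) \<Rightarrow>
     real \<Rightarrow> real \<Rightarrow> real" where
  "interim_utility M \<gamma> q t0 t1 \<theta> r =
     (LINT v:Vals M|value_law M \<theta>. buyer_utility M \<gamma> v (q r v) (t0 r) (t1 r v))"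

definition ic_period1 ::
  "screening_model \<Rightarrow> real \<Rightarrow> (real \<Rightarrow> real \<Rightarrow> real) \<Rightarrow> (real \<Rightarrow> real) \<Rightarrow> (real \<Rightarrow> real \<Rightarrow> real) \<Rightarrow> bool" where
  "ic_period1 M \<gamma> q t0 t1 \<longleftrightarrow>
     (\<forall>\<theta>\<in>Types M. \<forall>v\<in>Vals M. \<forall>v'\<in>Vals M.
        buyer_utility M \<gamma> v (q \<theta> v) (t0 \<theta>) (t1 \<theta> v) \<ge>
        buyer_utility M \<gamma> v (q \<theta> v') (t0 \<theta>) (t1 \<theta> v'))"

definition ic_period0 ::
  "screening_model \<Rightarrow> real \<Rightarrow> (real \<Rightarrow> real \<Rightarrow> real) \<Rightarrow> (real \<Rightarrow> real) \<Rightarrow> (real \<Rightarrow> real \<Rightarrow> real) \<Rightarrow> bool" where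
  "ic_period0 M \<gamma> q t0 t1 \<longleftrightarrow>
     (\<forall>\<theta>\<in>Types M. \<forall>\<theta>'\<in>Types M.
        interim_utility M \<gamma> q t0 t1 \<theta> \<theta> \<ge> interim_utility M \<gamma> q t0 t1 \<theta> \<theta>')"

definition ind_rational ::
  "screening_model \<Rightarrow> real \<Rightarrow> (real \<Rightarrow> real \<Rightarrow> real) \<Rightarrow> (real \<Rightarrow> real) \<Rightarrow> (real \<Rightarrow> real \<Rightarrow> real) \<Rightarrow> bool" where
  "ind_rational M \<gamma> q t0 t1 \<longleftrightarrow> (\<forall>\<theta>\<in>Types M. 0 \<le> interim_utility M \<gamma> q t0 t1 \<theta> \<theta>)"

definition expected_profit ::
  "screening_model \<Rightarrow> (real \<Rightarrow> real \<Rightarrow> real) \<Rightarrow> (real \<Rightarrow> real) \<Rightarrow> (real \<Rightarrow> real \<Rightarrow> real) \<Rightarrow> real" where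
  "expected_profit M q t0 t1 =
     set_lebesgue_integral (joint_law M) (Types M \<times> Vals M)
       (\<lambda>(\<theta>, v). t0 \<theta> + t1 \<theta> v - cost M * q \<theta> v)"

text \<open>Measurability, and integrability of the profit, make the expected profit meaningful. The
  expectations in the incentive constraints need no such clause: truthful reporting in period 1
  makes the ex post utility a bounded measurable function of \<open>v\<close>.\<close>

definition feasible ::
  "screening_model \<Rightarrow> real \<Rightarrow> (real \<Rightarrow> real \<Rightarrow> real) \<Rightarrow> (real \<Rightarrow> real) \<Rightarrow> (real \<Rightarrow> real \<Rightarrow> real) \<Rightarrow> bool" where
  "feasible M \<gamma> q t0 t1 \<longleftrightarrow>
     (\<lambda>(\<theta>, v). q \<theta> v) \<in> borel_measurable (restrict_space borel (Types M \<times> Vals M)) \<and>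
     t0 \<in> borel_measurable (restrict_space borel (Types M)) \<and>
     (\<lambda>(\<theta>, v). t1 \<theta> v) \<in> borel_measurable (restrict_space borel (Types M \<times> Vals M)) \<and>
     set_integrable (joint_law M) (Types M \<times> Vals M)
       (\<lambda>(\<theta>, v). t0 \<theta> + t1 \<theta> v - cost M * q \<theta> v) \<and>
     (\<forall>\<theta>\<in>Types M. \<forall>v\<in>Vals M. 0 \<le> q \<theta> v) \<and>
     ic_period0 M \<gamma> q t0 t1 \<and> ic_period1 M \<gamma> q t0 t1 \<and> ind_rational M \<gamma> q t0 t1"

definition optimal ::
  "screening_model \<Rightarrow> real \<Rightarrow> (real \<Rightarrow> real \<Rightarrow> real) \<Rightarrow> (real \<Rightarrow> real) \<Rightarrow> (real \<Rightarrow> real \<Rightarrow> real) \<Rightarrow> bool" where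
  "optimal M \<gamma> q t0 t1 \<longleftrightarrow>
     feasible M \<gamma> q t0 t1 \<and>
     (\<forall>q' t0' t1'. feasible M \<gamma> q' t0' t1' \<longrightarrow>
        expected_profit M q' t0' t1' \<le> expected_profit M q t0 t1)"

definition on_path :: "screening_model \<Rightarrow> (real \<times> real) set" where
  "on_path M = {(\<theta>, v). \<theta> \<in> Types M \<and> dens_g M \<theta> v > 0}"

definition positive_transfers ::
  "screening_model \<Rightarrow> (real \<Rightarrow> real) \<Rightarrow> (real \<Rightarrow> real \<Rightarrow> real) \<Rightarrow> bool" where
  "positive_transfers M t0 t1 \<longleftrightarrow>
     (\<forall>\<theta>\<in>Types M. 0 \<le> t0 \<theta>) \<and> (\<forall>(\<theta>, v)\<in>on_path M. 0 \<le> t1 \<theta> v)"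

text \<open>Pricing schedules are functions on the nonnegative reals; a quantity that is not offered is
  represented by a price at which nobody chooses it.\<close>

definition pricing_schedule :: "(real \<Rightarrow> real) \<Rightarrow> bool" where
  "pricing_schedule p \<longleftrightarrow> (\<forall>x\<ge>0. 0 \<le> p x)"

definition minimum_spend :: "(real \<Rightarrow> real) \<Rightarrow> real \<Rightarrow> bool" where
  "minimum_spend p b \<longleftrightarrow> (\<exists>x\<ge>0. p x = b) \<and> (\<forall>x\<ge>0. b \<le> p x)"

definition committed_spend :: "screening_model \<Rightarrow> (real \<Rightarrow> real \<Rightarrow> real) \<Rightarrow> bool" where
  "committed_spend M p \<longleftrightarrow>
     (\<forall>\<theta>\<in>Types M. pricing_schedule (p \<theta>) \<and>
        (\<exists>b. minimum_spend (p \<theta>) b \<and> (th_lo M < \<theta> \<longrightarrow> 0 < b)))"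

text \<open>Quantities and period-1 payments that result when a buyer who reported \<open>\<theta>\<close> and has value
  \<open>v\<close> picks a best quantity from the schedule \<open>p \<theta>\<close>.\<close>

definition chosen_from ::
  "screening_model \<Rightarrow> (real \<Rightarrow> real \<Rightarrow> real) \<Rightarrow> (real \<Rightarrow> real \<Rightarrow> real) \<Rightarrow> (real \<Rightarrow> real \<Rightarrow> real) \<Rightarrow> bool" where
  "chosen_from M p q t1 \<longleftrightarrow>
     (\<forall>\<theta>\<in>Types M. \<forall>v\<in>Vals M. 0 \<le> q \<theta> v \<and> t1 \<theta> v = p \<theta> (q \<theta> v) \<and>
        (\<forall>x\<ge>0. v * x powr alpha M - p \<theta> x \<le> v * q \<theta> v powr alpha M - p \<theta> (q \<theta> v)))"

text \<open>Type \<open>\<theta>\<close> buys a positive quantity at some value that is not above the whole support of the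
  lowest type.\<close>

definition served :: "screening_model \<Rightarrow> (real \<Rightarrow> real \<Rightarrow> real) \<Rightarrow> real \<Rightarrow> bool" where
  "served M \<phi> \<theta> \<longleftrightarrow> (\<exists>v. dens_g M \<theta> v > 0 \<and> G M (th_lo M) v < 1 \<and> 0 < qstar M \<phi> \<theta> v)"

end

theory Submission
  imports Defs
begin

text \<open>Truthful reporting in period 1 makes the ex post utility the integral of \<open>q\<^sup>\<alpha>\<close>, and truthful
  reporting in period 0 bounds the expected utility of type \<open>\<theta>\<close> from below by the information rent
  \<open>\<integral>\<integral> q(x, v)\<^sup>\<alpha> (- \<partial>G(v | x)/\<partial>x) dv dx\<close> over the types \<open>x\<close> below \<open>\<theta>\<close>. Exchanging the order of integration,
  the profit of any feasible contract is the expected virtual surplus \<open>\<phi> q\<^sup>\<alpha> - c q\<close> minus a nonnegative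
  slack: utility in excess of the rent, plus \<open>\<gamma>\<close> times the positive part of the early payment. The
  contract \<open>(q\<^sup>*, 0, t\<^sup>*)\<close> maximizes the virtual surplus pointwise and has no slack. Conversely, an
  optimal contract has no slack either and maximizes the virtual surplus almost everywhere, which
  pins down \<open>q\<close>, then \<open>t0\<close>, and through the envelope formula \<open>t1\<close>.

  Minimum spends are nonnegative because freezing the quantities at those of type \<open>\<theta>\<close> overestimates
  the rents of the lower types. Since only on-path values of \<open>\<phi>\<close> matter, the pricing schedule is the
  menu of the optimal mechanism for an extension of \<open>\<phi>\<close> that never makes an off-path value buy more
  cheaply than the bottom of the support.\<close>

section \<open>Envelopes, monotone functions and power functions\<close>

text \<open>The envelope over types is only an inequality: the utility of an arbitrary feasible
  contract is known to be monotone in \<theta>, not absolutely continuous, and no joint bound on its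
  quantities is available. The inequality suffices, because it bounds profit from above, while the
  candidate attains its rent by the normalization of \<open>u\<close>. Rents are kept in
  \<open>ennreal\<close>, where Tonelli and Fatou apply before finiteness is known. Moving supports
  give \<open>G\<close> kinks in \<theta>. For fixed v there are at most two, and \<open>G\<close>
  is continuous across them, so the fundamental theorem of calculus survives; monotonicity of the
  kinks in v keeps the exceptional types countable. Incentive constraints run over all values, while
  off-path quantities depend on the chosen extension of \<phi>. On-path payments are shielded from
  them because \<open>D\<close> vanishes off the support, and so does the kernel
  \<open>G - indicator {v<..}\<close> for on-path v, once ex post utility is anchored at its mean
  instead of at \<open>v_lo\<close>.\<close>

lemma subgradient_mono_on:
  fixes U P :: "real \<Rightarrow> real"
  assumes sg: "\<And>x y. x \<in> S \<Longrightarrow> y \<in> S \<Longrightarrow> U y + (x - y) * P y \<le> U x"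
  shows "mono_on S P"
proof (rule mono_onI)
  fix x y assume xy: "x \<in> S" "y \<in> S" "x \<le> y"
  \<comment> \<open>Adding the two subgradient inequalities cancels \<open>U\<close>.\<close>
  have "(y - x) * P x \<le> (y - x) * P y"
    using sg[OF xy(1,2)] sg[OF xy(2,1)] by (simp add: algebra_simps)
  then show "P x \<le> P y"
    using xy(3) by (cases "x = y") auto
qed

lemma mono_on_set_integrable:
  fixes P :: "real \<Rightarrow> real"
  assumes "mono_on {a..b} P"
  shows "set_integrable lborel {a..b} P"
proof (cases "a \<le> b")
  case True
  have [measurable]: "P \<in> borel_measurable (restrict_space borel {a..b})"
    using assms by (rule borel_measurable_mono_on_fnc)
  then have m: "set_borel_measurable lborel {a..b} P"
    by (subst (asm) borel_measurable_restrict_space_iff)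
       (auto simp: set_borel_measurable_def cong: measurable_cong_sets)
  show ?thesis
    unfolding set_integrable_def
  proof (rule Bochner_Integration.integrable_bound)
    show "integrable lborel (\<lambda>x. indicator {a..b} x * (\<bar>P a\<bar> + \<bar>P b\<bar>))"
      by (intro integrable_mult_left integrable_real_indicator) (auto simp: emeasure_lborel_Icc_eq)
    show "AE x in lborel. norm (indicator {a..b} x *\<^sub>R P x)
        \<le> norm (indicator {a..b} x * (\<bar>P a\<bar> + \<bar>P b\<bar>))"
    proof (intro AE_I2)
      fix x
      show "norm (indicator {a..b} x *\<^sub>R P x) \<le> norm (indicator {a..b} x * (\<bar>P a\<bar> + \<bar>P b\<bar>))"
        using mono_onD[OF assms, of a x] mono_onD[OF assms, of x b] True
        by (auto simp: indicator_def)
    qed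
  qed (use m in \<open>simp add: set_borel_measurable_def\<close>)
qed (simp add: set_integrable_def)

lemma set_lebesgue_integral_combine:
  fixes P :: "real \<Rightarrow> real"
  assumes "set_integrable lborel {a..c} P" "a \<le> b" "b \<le> c"
  shows "(LINT x:{a..c}|lborel. P x) = (LINT x:{a..b}|lborel. P x) + (LINT x:{b..c}|lborel. P x)"
proof -
  have "set_integrable lborel {a..b} P" "set_integrable lborel {b..c} P"
    using assms by (auto intro: set_integrable_subset[OF assms(1)])
  then show ?thesis
    using Henstock_Kurzweil_Integration.integral_combine[OF assms(2,3), of P] assms(1)
    by (simp add: set_borel_integral_eq_integral)
qed

lemma mono_on_integral_bounds:
  fixes P :: "real \<Rightarrow> real"
  assumes "mono_on {a..b} P" "a \<le> b"
  shows "(b - a) * P a \<le> (LINT x:{a..b}|lborel. P x)" "(LINT x:{a..b}|lborel. P x) \<le> (b - a) * P b"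
proof -
  note i = mono_on_set_integrable[OF assms(1)]
  have c: "set_integrable lborel {a..b} (\<lambda>_. k)" "(LINT x:{a..b}|lborel. k) = (b - a) * k" for k :: real
    using assms(2) by (auto simp: set_integrable_def set_lebesgue_integral_def)
  show "(b - a) * P a \<le> (LINT x:{a..b}|lborel. P x)"
    unfolding c(2)[symmetric]
    using i c(1) assms(2) by (intro set_integral_mono) (auto intro: mono_onD[OF assms(1)])
  show "(LINT x:{a..b}|lborel. P x) \<le> (b - a) * P b"
    unfolding c(2)[symmetric]
    using i c(1) assms(2) by (intro set_integral_mono) (auto intro: mono_onD[OF assms(1)])
qed

text \<open>On a uniform partition each increment of \<open>d\<close> is at most the mesh times an
  increment of \<open>P\<close>, and the latter telescope. The resulting bound
  \<open>(b - a) / Suc n * (P b - P a)\<close> tends to 0.\<close>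

lemma dominated_increments_const:
  fixes d P :: "real \<Rightarrow> real"
  assumes "\<And>x y. a \<le> x \<Longrightarrow> x \<le> y \<Longrightarrow> y \<le> b \<Longrightarrow> \<bar>d y - d x\<bar> \<le> (y - x) * (P y - P x)" and "a \<le> b"
  shows "d a = d b"
proof (rule ccontr)
  assume "d a \<noteq> d b"
  have bound: "\<bar>d b - d a\<bar> \<le> (b - a) / Suc n * (P b - P a)" for n
  proof -
    define h where "h = (b - a) / Suc n"
    have h0: "0 \<le> h" and hn: "h * Suc n = b - a"
      using assms(2) by (auto simp: h_def)
    have "k \<le> Suc n \<Longrightarrow> \<bar>d (a + h * k) - d a\<bar> \<le> h * (P (a + h * k) - P a)" for k
    proof (induction k)
      case (Suc k)
      have "h * Suc k \<le> h * Suc n"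
        using Suc.prems h0 by (intro mult_left_mono) auto
      then have "\<bar>d (a + h * Suc k) - d (a + h * k)\<bar> \<le>
          (a + h * Suc k - (a + h * k)) * (P (a + h * Suc k) - P (a + h * k))"
        using h0 hn by (intro assms(1)) (auto intro: mult_left_mono)
      moreover have "a + h * Suc k - (a + h * k) = h"
        by (simp add: algebra_simps)
      ultimately have "\<bar>d (a + h * Suc k) - d (a + h * k)\<bar> \<le> h * (P (a + h * Suc k) - P (a + h * k))"
        by simp
      then show ?case
        using Suc.IH Suc.prems unfolding right_diff_distrib by linarith
    qed simp
    from this[of "Suc n"] show ?thesis
      unfolding hn by (simp add: h_def)
  qed
  have "(\<lambda>n. (b - a) / Suc n * (P b - P a)) \<longlonglongrightarrow> 0 * (P b - P a)"
    by (intro tendsto_mult tendsto_const LIMSEQ_Suc[OF lim_const_over_n])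
  then have "\<bar>d b - d a\<bar> \<le> 0 * (P b - P a)"
    by (rule LIMSEQ_le_const) (use bound in auto)
  then show False
    using \<open>d a \<noteq> d b\<close> by simp
qed

text \<open>The increments of \<open>U\<close> and of the integral of \<open>P\<close> both lie
  between \<open>(y - x) * P x\<close> and \<open>(y - x) * P y\<close>, so the difference of the
  two functions has dominated increments. This is the envelope theorem in the value, with
  \<open>P\<close> as the slope.\<close>

lemma subgradient_integral:
  fixes U P :: "real \<Rightarrow> real"
  assumes sg: "\<And>x y. x \<in> {a..b} \<Longrightarrow> y \<in> {a..b} \<Longrightarrow> U y + (x - y) * P y \<le> U x"
    and v: "a \<le> v" "v \<le> b"
  shows "U v = U a + (LINT x:{a..v}|lborel. P x)"
proof -
  have mono: "mono_on {a..b} P"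
    using sg by (rule subgradient_mono_on)
  define d where "d x = U x - (LINT y:{a..x}|lborel. P y)" for x
  have "d a = d v"
  proof (rule dominated_increments_const[OF _ v(1), where P=P])
    fix x y assume xy: "a \<le> x" "x \<le> y" "y \<le> v"
    then have "(LINT z:{a..y}|lborel. P z) = (LINT z:{a..x}|lborel. P z) + (LINT z:{x..y}|lborel. P z)"
      using v by (intro set_lebesgue_integral_combine mono_on_set_integrable mono_on_subset[OF mono]) auto
    moreover have "(y - x) * P x \<le> (LINT z:{x..y}|lborel. P z)" "(LINT z:{x..y}|lborel. P z) \<le> (y - x) * P y"
      using xy v by (intro mono_on_integral_bounds mono_on_subset[OF mono]; auto)+
    moreover have "U x + (y - x) * P x \<le> U y" "U y + (x - y) * P y \<le> U x"
      using xy v by (auto intro: sg)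
    ultimately show "\<bar>d y - d x\<bar> \<le> (y - x) * (P y - P x)"
      unfolding d_def by (simp add: algebra_simps abs_le_iff)
  qed
  moreover have "(LINT y:{a..a}|lborel. P y) = 0"
    using mono_on_integral_bounds[of a a P] by (simp add: mono_on_def)
  ultimately show ?thesis
    by (simp add: d_def)
qed

text \<open>Converse of the envelope formula: monotonicity of the slope turns it back into incentive
  compatibility, since it compares the integral between \<open>x\<close> and \<open>y\<close> with
  the slope at \<open>y\<close>.\<close>

lemma integral_subgradient:
  fixes U P :: "real \<Rightarrow> real"
  assumes mono: "mono_on {a..b} P"
    and U: "\<And>v. v \<in> {a..b} \<Longrightarrow> U v = U a + (LINT x:{a..v}|lborel. P x)"
    and x: "x \<in> {a..b}" and y: "y \<in> {a..b}"
  shows "U y + (x - y) * P y \<le> U x"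
proof (cases "y \<le> x")
  case True
  then have "U x = U y + (LINT z:{y..x}|lborel. P z)"
    using x y U[OF x] U[OF y] set_lebesgue_integral_combine[OF mono_on_set_integrable[OF mono_on_subset[OF mono]], of a x y]
    by auto
  then show ?thesis
    using x y True mono_on_integral_bounds(1)[OF mono_on_subset[OF mono], of y x] by auto
next
  case False
  then have "U y = U x + (LINT z:{x..y}|lborel. P z)"
    using x y U[OF x] U[OF y] set_lebesgue_integral_combine[OF mono_on_set_integrable[OF mono_on_subset[OF mono]], of a y x]
    by auto
  then show ?thesis
    using x y False mono_on_integral_bounds(2)[OF mono_on_subset[OF mono], of x y] by (auto simp: algebra_simps)
qed

text \<open>Translating the integral leaves two end pieces of length \<open>e\<close>. The right one
  is at most \<open>e * U t\<close> because \<open>U\<close> is flat beyond \<open>t\<close>, the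
  left one is at least \<open>e * U a\<close>.\<close>

lemma nn_integral_difference_quotient_le:
  fixes U :: "real \<Rightarrow> real"
  assumes mono: "mono U" and top: "\<And>x. t \<le> x \<Longrightarrow> U x = U t" and "a \<le> t" and e: "0 < e"
  shows "(\<integral>\<^sup>+x\<in>{a..t}. ennreal ((U (x + e) - U x) / e) \<partial>lborel) \<le> ennreal (U t - U a)"
proof -
  have mon: "mono_on A U" for A
    using mono by (auto intro: mono_onI dest: monoD)
  have si: "set_integrable lborel {c..d} U" for c d
    by (intro mono_on_set_integrable mon)
  have si': "set_integrable lborel {c..d} (\<lambda>x. U (x + e))" for c d
    by (intro mono_on_set_integrable mono_onI monoD[OF mono]) simp
  have shift: "(LINT x:{a..t}|lborel. U (x + e)) = (LINT x:{a+e..t+e}|lborel. U x)"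
  proof -
    have "indicat_real {a+e..t+e} (e + x) = indicat_real {a..t} x" for x
      by (simp add: indicator_def)
    then show ?thesis
      using lborel_integral_real_affine[of 1 "\<lambda>x. indicat_real {a+e..t+e} x *\<^sub>R U x" e]
      by (simp add: set_lebesgue_integral_def add.commute[of _ e])
  qed
  have "(LINT x:{a..t+e}|lborel. U x) = (LINT x:{a..t}|lborel. U x) + (LINT x:{t..t+e}|lborel. U x)"
    "(LINT x:{a..t+e}|lborel. U x) = (LINT x:{a..a+e}|lborel. U x) + (LINT x:{a+e..t+e}|lborel. U x)"
    using assms(3,4) by (intro set_lebesgue_integral_combine si; simp)+
  moreover have "(LINT x:{t..t+e}|lborel. U x) \<le> e * U (t + e)" "e * U a \<le> (LINT x:{a..a+e}|lborel. U x)"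
    using mono_on_integral_bounds[OF mon, of t "t+e"] mono_on_integral_bounds[OF mon, of a "a+e"] e by auto
  ultimately have "(LINT x:{a..t}|lborel. U (x + e)) - (LINT x:{a..t}|lborel. U x) \<le> e * (U t - U a)"
    using top[of "t + e"] e by (simp add: shift algebra_simps)
  then have le: "(LINT x:{a..t}|lborel. U (x + e) - U x) / e \<le> U t - U a"
    using e by (subst set_integral_diff[OF si' si]) (simp add: field_simps)
  have nonneg: "0 \<le> (U (x + e) - U x) / e" for x
    using e monoD[OF mono, of x "x + e"] by auto
  have int: "set_integrable lborel {a..t} (\<lambda>x. (U (x + e) - U x) / e)"
    using si si' by (intro set_integrable_divide set_integral_diff) auto
  have "(\<integral>\<^sup>+x\<in>{a..t}. ennreal ((U (x + e) - U x) / e) \<partial>lborel)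
      = (\<integral>\<^sup>+x. ennreal (indicator {a..t} x *\<^sub>R ((U (x + e) - U x) / e)) \<partial>lborel)"
    by (intro nn_integral_cong) (auto simp: indicator_def)
  also have "\<dots> = ennreal (LINT x:{a..t}|lborel. (U (x + e) - U x) / e)"
    unfolding set_lebesgue_integral_def
    using int nonneg by (intro nn_integral_eq_integral) (auto simp: set_integrable_def indicator_def)
  also have "\<dots> \<le> ennreal (U t - U a)"
    using le by (intro ennreal_leI) simp
  finally show ?thesis .
qed

text \<open>Fatou's lemma replaces Lebesgue's theorem on the almost everywhere differentiability of
  monotone functions.\<close>

lemma nn_integral_lower_derivative_le:
  fixes U :: "real \<Rightarrow> real" and h :: "real \<Rightarrow> ennreal"
  assumes mono: "mono_on {a..t} U" and "a \<le> t"
    and h: "AE x in lborel. a < x \<longrightarrow> x < t \<longrightarrow>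
      h x \<le> liminf (\<lambda>n. ennreal ((U (x + 1 / Suc n) - U x) / (1 / Suc n)))"
  shows "(\<integral>\<^sup>+x\<in>{a..t}. h x \<partial>lborel) \<le> ennreal (U t - U a)"
proof -
  \<comment> \<open>Clamping the argument makes the function monotone, hence Borel, on the whole
    line and flat beyond \<open>t\<close>, as the bound on difference quotients requires.\<close>
  define W where "W x = U (max a (min x t))" for x
  have W: "mono W"
    unfolding W_def using \<open>a \<le> t\<close> by (intro monoI mono_onD[OF mono]) auto
  have [measurable]: "W \<in> borel_measurable borel"
    using W by (rule borel_measurable_mono)
  have Wt: "W x = W t" if "t \<le> x" for x
    using that by (simp add: W_def)
  define k where "k n x = ennreal ((W (x + 1 / Suc n) - W x) / (1 / Suc n)) * indicator {a..t} x" for n x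
  have "AE x in lborel. x \<noteq> a" "AE x in lborel. x \<noteq> t"
    by (rule AE_lborel_singleton)+
  with h have "AE x in lborel. h x * indicator {a..t} x \<le> liminf (\<lambda>n. k n x)"
  proof eventually_elim
    case (elim x)
    show ?case
    proof (cases "a < x \<and> x < t")
      case True
      \<comment> \<open>To the left of \<open>t\<close> the step eventually stays inside the
        interval, where the quotients of \<open>U\<close> and \<open>W\<close> agree.\<close>
      have "\<forall>\<^sub>F n in sequentially. 1 / Suc n < t - x"
        using True by (intro order_tendstoD(2)[OF LIMSEQ_Suc[OF lim_const_over_n]]) auto
      then have "\<forall>\<^sub>F n in sequentially. ennreal ((U (x + 1 / Suc n) - U x) / (1 / Suc n)) = k n x"
        by eventually_elim (use True in \<open>auto simp: k_def W_def max_def min_def add_increasing2\<close>)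
      then have "liminf (\<lambda>n. ennreal ((U (x + 1 / Suc n) - U x) / (1 / Suc n))) = liminf (\<lambda>n. k n x)"
        by (rule Liminf_eq)
      with elim True show ?thesis
        by auto
    qed (use elim in \<open>auto simp: indicator_def\<close>)
  qed
  then have "(\<integral>\<^sup>+x\<in>{a..t}. h x \<partial>lborel) \<le> (\<integral>\<^sup>+x. liminf (\<lambda>n. k n x) \<partial>lborel)"
    by (rule nn_integral_mono_AE)
  also have "\<dots> \<le> liminf (\<lambda>n. \<integral>\<^sup>+x. k n x \<partial>lborel)"
    by (rule nn_integral_liminf) (simp add: k_def)
  also have "\<dots> \<le> liminf (\<lambda>n::nat. ennreal (W t - W a))"
    unfolding k_def
    by (intro Liminf_mono always_eventually allI nn_integral_difference_quotient_le W Wt) (use \<open>a \<le> t\<close> in auto)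
  also have "\<dots> = ennreal (U t - U a)"
    using \<open>a \<le> t\<close> by (simp add: Liminf_const W_def)
  finally show ?thesis .
qed

text \<open>Strict concavity as a weighted AM-GM inequality: with
  \<open>z = t powr \<alpha>\<close>, the numbers \<open>t / z\<close> and \<open>1 / z\<close> with
  weights \<alpha> and 1 - \<alpha> have geometric mean 1, and their arithmetic mean is the tangent
  value divided by \<open>z\<close>. Strictness comes from \<open>z \<noteq> 1\<close>.\<close>

lemma powr_lt_tangent:
  fixes t :: real
  assumes \<alpha>: "0 < \<alpha>" "\<alpha> < 1" and t: "0 \<le> t" "t \<noteq> 1"
  shows "t powr \<alpha> < 1 + \<alpha> * (t - 1)"
proof (cases "t = 0")
  case False
  then have t0: "0 < t" using t by simp
  define z where "z = t powr \<alpha>"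
  have z: "0 < z" "ln z = \<alpha> * ln t"
    using t0 by (auto simp: z_def ln_powr)
  have zt: "z \<noteq> 1"
    using t0 t \<alpha> z by (metis ln_one ln_eq_zero_iff mult_eq_0_iff less_irrefl)
  have "ln (t / z) \<le> t / z - 1" "ln (1 / z) < 1 / z - 1"
    using z t0 ln_le_minus_one[of "t / z"] ln_le_minus_one[of "1 / z"] ln_eq_minus_one[of "1 / z"] zt
    by (force simp: less_le)+
  then have "\<alpha> * ln (t / z) + (1 - \<alpha>) * ln (1 / z) < \<alpha> * (t / z - 1) + (1 - \<alpha>) * (1 / z - 1)"
    using \<alpha> by (intro add_le_less_mono mult_left_mono mult_strict_left_mono) auto
  moreover have "\<alpha> * ln (t / z) + (1 - \<alpha>) * ln (1 / z) = 0"
    using z t0 by (simp add: ln_div algebra_simps)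
  moreover have "\<alpha> * (t / z - 1) + (1 - \<alpha>) * (1 / z - 1) = (1 + \<alpha> * (t - 1)) / z - 1"
    using z by (simp add: field_simps)
  ultimately have "1 < (1 + \<alpha> * (t - 1)) / z"
    by simp
  then show ?thesis
    using z by (simp add: z_def field_simps)
qed (use \<alpha> in auto)

text \<open>For positive \<open>r\<close>, \<open>y\<close> solves the first order condition, and
  the strict tangent inequality at \<open>x / y\<close> makes it the only maximizer, which later
  gives uniqueness of quantities. For \<open>r \<le> 0\<close> the formula yields
  \<open>y = 0\<close>, and a positive quantity only adds cost.\<close>

lemma virtual_surplus_maximizer:
  fixes \<alpha> c r x :: real
  assumes \<alpha>: "0 < \<alpha>" "\<alpha> < 1" and c: "0 < c" and x: "0 \<le> x"
  defines "y \<equiv> (\<alpha> / c * r * of_bool (0 \<le> r)) powr (1 / (1 - \<alpha>))"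
  shows "r * x powr \<alpha> - c * x \<le> r * y powr \<alpha> - c * y"
    and "r * x powr \<alpha> - c * x = r * y powr \<alpha> - c * y \<Longrightarrow> x = y"
proof -
  have *: "r * x powr \<alpha> - c * x < r * y powr \<alpha> - c * y" if "x \<noteq> y"
  proof (cases "0 < r")
    case True
    have y0: "0 < y"
      unfolding y_def using True \<alpha> c by simp
    have "y powr (1 - \<alpha>) = \<alpha> / c * r"
      unfolding y_def using True \<alpha> c by (simp add: powr_powr)
    moreover have "y = y powr (1 - \<alpha>) * y powr \<alpha>"
      using y0 by (simp flip: powr_add)
    \<comment> \<open>The first order condition multiplied by \<open>y\<close>, so that no negative
      power appears.\<close>
    ultimately have foc: "\<alpha> * r * y powr \<alpha> = c * y"
      using c by (metis (no_types, opaque_lifting) mult.assoc mult.commute nonzero_mult_div_cancel_left times_divide_eq_left less_irrefl)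
    have "(x / y) powr \<alpha> < 1 + \<alpha> * (x / y - 1)"
      using that x y0 by (intro powr_lt_tangent \<alpha>) auto
    then have "r * y powr \<alpha> * (x / y) powr \<alpha> < r * y powr \<alpha> * (1 + \<alpha> * (x / y - 1))"
      using True y0 by simp
    moreover have "y powr \<alpha> * (x / y) powr \<alpha> = x powr \<alpha>"
      using x y0 by (simp add: powr_divide)
    moreover have "r * y powr \<alpha> * (1 + \<alpha> * (x / y - 1)) = r * y powr \<alpha> + \<alpha> * r * y powr \<alpha> * (x / y - 1)"
      by (simp add: algebra_simps)
    moreover have "\<alpha> * r * y powr \<alpha> * (x / y - 1) = c * x - c * y"
      unfolding foc using y0 by (simp add: field_simps)
    ultimately show ?thesis
      by (simp add: mult.assoc)
  next
    case False
    then have "y = 0"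
      by (auto simp: y_def)
    then have "0 < c * x" "r * x powr \<alpha> \<le> 0"
      using that x c False by (auto simp: mult_le_0_iff)
    with \<open>y = 0\<close> show ?thesis by simp
  qed
  show "r * x powr \<alpha> - c * x \<le> r * y powr \<alpha> - c * y"
    using * by (cases "x = y") auto
  show "r * x powr \<alpha> - c * x = r * y powr \<alpha> - c * y \<Longrightarrow> x = y"
    using * by force
qed

section \<open>Distributions and the virtual value\<close>

lemma AE_lborel_countable: "countable C \<Longrightarrow> AE x in lborel. x \<notin> (C :: real set)"
  using countable_imp_null_set_lborel by (rule AE_not_in)

locale screening_environment =
  fixes M :: screening_model and \<phi> :: "real \<Rightarrow> real \<Rightarrow> real"
  assumes screening: "screening M"
    and fosd: "fosd_ordered M"
    and virtual_value: "dynamic_virtual_value M \<phi>"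
    and increasing: "weakly_increasing2 M \<phi>"
begin

abbreviation "lo \<equiv> th_lo M"
abbreviation "hi \<equiv> th_hi M"
abbreviation "vlo \<equiv> v_lo M"
abbreviation "vhi \<equiv> v_hi M"
abbreviation "f \<equiv> dens_f M"
abbreviation "g \<equiv> dens_g M"
abbreviation "\<alpha> \<equiv> alpha M"
abbreviation "c \<equiv> cost M"
abbreviation "T \<equiv> Types M"
abbreviation "V \<equiv> Vals M"

lemma T_iff: "\<theta> \<in> T \<longleftrightarrow> lo \<le> \<theta> \<and> \<theta> \<le> hi"
  by (simp add: Types_def)

lemma V_iff: "v \<in> V \<longleftrightarrow> vlo \<le> v \<and> v \<le> vhi"
  by (simp add: Vals_def)

lemma params: "0 < \<alpha>" "\<alpha> < 1" "0 < c"
  using screening by (auto simp: screening_def)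

lemma sets_T_V [measurable]: "T \<in> sets borel" "V \<in> sets borel"
  by (auto simp: Types_def Vals_def)

lemma f_measurable [measurable]: "f \<in> borel_measurable borel"
  using screening by (auto simp: screening_def)

lemma g_measurable [measurable]: "case_prod g \<in> borel_measurable (borel \<Otimes>\<^sub>M borel)"
  using screening by (auto simp: screening_def)

lemma f_pos: "\<theta> \<in> T \<Longrightarrow> 0 < f \<theta>" and f_zero: "\<theta> \<notin> T \<Longrightarrow> f \<theta> = 0"
  using screening by (auto simp: screening_def)

lemma f_nonneg: "0 \<le> f \<theta>"
  using f_pos[of \<theta>] f_zero[of \<theta>] by force

lemma g_nonneg: "\<theta> \<in> T \<Longrightarrow> 0 \<le> g \<theta> v"
  and g_pos_V: "\<theta> \<in> T \<Longrightarrow> 0 < g \<theta> v \<Longrightarrow> v \<in> V"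
  and g_zero: "\<theta> \<in> T \<Longrightarrow> v \<notin> V \<Longrightarrow> g \<theta> v = 0"
  and convex_support: "\<theta> \<in> T \<Longrightarrow> convex {v. 0 < g \<theta> v}"
  and prob_value_law: "\<theta> \<in> T \<Longrightarrow> prob_space (value_law M \<theta>)"
proof -
  assume "\<theta> \<in> T"
  with screening have *: "(\<forall>v. 0 \<le> g \<theta> v) \<and> (\<forall>v. v \<notin> V \<longrightarrow> g \<theta> v = 0) \<and>
      prob_space (value_law M \<theta>) \<and> convex {v. 0 < g \<theta> v}"
    by (simp add: screening_def)
  then show "0 \<le> g \<theta> v" "convex {v. 0 < g \<theta> v}" "prob_space (value_law M \<theta>)" by blast+
  show "0 < g \<theta> v \<Longrightarrow> v \<in> V" using * by (metis less_irrefl)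
  show "v \<notin> V \<Longrightarrow> g \<theta> v = 0" using * by blast
qed

lemma prob_type_law: "prob_space (type_law M)"
  using screening by (auto simp: screening_def)

lemma nn_integral_f: "(\<integral>\<^sup>+x. ennreal (f x) \<partial>lborel) = 1"
  using prob_space.emeasure_space_1[OF prob_type_law]
  by (simp add: type_law_def emeasure_density)

lemma nn_integral_g: "\<theta> \<in> T \<Longrightarrow> (\<integral>\<^sup>+v. ennreal (g \<theta> v) \<partial>lborel) = 1"
  using prob_space.emeasure_space_1[OF prob_value_law, of \<theta>]
  by (simp add: value_law_def emeasure_density)

text \<open>A degenerate interval is Lebesgue null and cannot carry the unit mass of a density. That
  the interval is nondegenerate makes limits within \<open>T\<close> meaningful at each
  type.\<close>

lemma lo_less_hi: "lo < hi"
proof (rule ccontr)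
  assume "\<not> lo < hi"
  have "AE x in lborel. x \<noteq> lo"
    by (rule AE_lborel_singleton)
  then have "AE x in lborel. ennreal (f x) = 0"
  proof eventually_elim
    case (elim x)
    then have "x \<notin> T" using \<open>\<not> lo < hi\<close> by (auto simp: T_iff)
    then show ?case by (simp add: f_zero)
  qed
  then have "(\<integral>\<^sup>+x. ennreal (f x) \<partial>lborel) = 0"
    by (subst nn_integral_cong_AE[where v="\<lambda>_. 0"]) auto
  then show False
    by (simp add: nn_integral_f)
qed

lemma lo_T [simp]: "lo \<in> T" and hi_T [simp]: "hi \<in> T"
  using lo_less_hi by (auto simp: T_iff)

lemma vlo_less_vhi: "vlo < vhi"
proof (rule ccontr)
  assume "\<not> vlo < vhi"
  have "AE x in lborel. x \<noteq> vlo"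
    by (rule AE_lborel_singleton)
  then have "AE x in lborel. ennreal (g lo x) = 0"
  proof eventually_elim
    case (elim x)
    then have "x \<notin> V" using \<open>\<not> vlo < vhi\<close> by (auto simp: V_iff)
    then show ?case by (simp add: g_zero)
  qed
  then have "(\<integral>\<^sup>+x. ennreal (g lo x) \<partial>lborel) = 0"
    by (subst nn_integral_cong_AE[where v="\<lambda>_. 0"]) auto
  then show False
    by (simp add: nn_integral_g)
qed

lemma vlo_V [simp]: "vlo \<in> V" and vhi_V [simp]: "vhi \<in> V"
  using vlo_less_vhi by (auto simp: V_iff)

section \<open>Distribution functions, supports and dominance\<close>

lemma G_eq: "G M \<theta> v = enn2real (\<integral>\<^sup>+s. ennreal (g \<theta> s) * indicator {..v} s \<partial>lborel)"
  by (simp add: G_def cdf_def measure_def value_law_def emeasure_density)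

lemma G_measurable [measurable]: "case_prod (G M) \<in> borel_measurable (borel \<Otimes>\<^sub>M borel)"
proof -
  \<comment> \<open>Joint measurability in the type and the value needs the cut
    \<open>s \<le> v\<close> as one measurable set of triples.\<close>
  have "{p \<in> space ((borel \<Otimes>\<^sub>M borel) \<Otimes>\<^sub>M lborel). snd p \<le> snd (fst p)}
      \<in> sets ((borel \<Otimes>\<^sub>M borel) \<Otimes>\<^sub>M (lborel :: real measure))"
    by measurable
  then have [measurable]: "{p :: (real \<times> real) \<times> real. snd p \<le> snd (fst p)}
      \<in> sets ((borel \<Otimes>\<^sub>M borel) \<Otimes>\<^sub>M lborel)"
    by (simp add: space_pair_measure)
  have "(\<lambda>p. enn2real (\<integral>\<^sup>+s. ennreal (g (fst p) s) * indicator {p. snd p \<le> snd (fst p)} (p, s) \<partial>lborel))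
      \<in> borel_measurable (borel \<Otimes>\<^sub>M borel)"
    by measurable
  then show ?thesis
    by (rule back_subst[of "\<lambda>k. k \<in> borel_measurable _"]) (auto simp: G_eq indicator_def fun_eq_iff intro!: arg_cong[where f=enn2real] nn_integral_cong)
qed

lemma emeasure_value_law: "A \<in> sets borel \<Longrightarrow> emeasure (value_law M \<theta>) A = (\<integral>\<^sup>+s. ennreal (g \<theta> s) * indicator A s \<partial>lborel)"
  by (simp add: value_law_def emeasure_density)

lemma real_distribution_value_law: "\<theta> \<in> T \<Longrightarrow> real_distribution (value_law M \<theta>)"
  using prob_value_law by (auto simp: real_distribution_def real_distribution_axioms_def value_law_def)

lemma real_distribution_type_law: "real_distribution (type_law M)"
  using prob_type_law by (auto simp: real_distribution_def real_distribution_axioms_def type_law_def)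

lemma G_bounds: "\<theta> \<in> T \<Longrightarrow> 0 \<le> G M \<theta> v" "\<theta> \<in> T \<Longrightarrow> G M \<theta> v \<le> 1"
  unfolding G_def using real_distribution.cdf_bounded_prob[OF real_distribution_value_law, of \<theta> v]
  by (auto simp: cdf_def)

lemma G_mono: "\<theta> \<in> T \<Longrightarrow> x \<le> y \<Longrightarrow> G M \<theta> x \<le> G M \<theta> y"
  unfolding G_def
  by (intro finite_borel_measure.cdf_nondecreasing real_distribution.finite_borel_measure_M real_distribution_value_law)

lemma G_tail: assumes "\<theta> \<in> T" shows "ennreal (1 - G M \<theta> s) = (\<integral>\<^sup>+v. ennreal (g \<theta> v) * indicator {s..} v \<partial>lborel)"
proof -
  interpret prob_space "value_law M \<theta>" by (rule prob_value_law) fact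
  have *: "AE v in lborel. v \<noteq> s" by (rule AE_lborel_singleton)
  have compl: "space (value_law M \<theta>) - {..s} = {s<..}"
    by (auto simp: value_law_def)
  have "1 - G M \<theta> s = prob (space (value_law M \<theta>) - {..s})"
    unfolding G_def cdf_def by (subst prob_compl) (auto simp: value_law_def)
  also have "ennreal \<dots> = emeasure (value_law M \<theta>) {s<..}"
    unfolding compl by (simp add: emeasure_eq_measure)
  also have "\<dots> = (\<integral>\<^sup>+v. ennreal (g \<theta> v) * indicator {s<..} v \<partial>lborel)"
    by (rule emeasure_value_law) simp
  also have "\<dots> = (\<integral>\<^sup>+v. ennreal (g \<theta> v) * indicator {s..} v \<partial>lborel)"
    using * by (intro nn_integral_cong_AE) (auto elim!: eventually_mono simp: indicator_def)
  finally show ?thesis .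
qed

lemma G_zero: assumes "\<theta> \<in> T" "\<And>v. v < s \<Longrightarrow> \<not> 0 < g \<theta> v" shows "G M \<theta> s = 0"
proof -
  have "AE v in lborel. v \<noteq> s" by (rule AE_lborel_singleton)
  then have "(\<integral>\<^sup>+v. ennreal (g \<theta> v) * indicator {..s} v \<partial>lborel) = (\<integral>\<^sup>+(v::real). 0 \<partial>lborel)"
    by (intro nn_integral_cong_AE, eventually_elim)
       (use assms(2) in \<open>auto simp: indicator_def ennreal_neg not_less\<close>)
  then show ?thesis by (simp add: G_eq)
qed

lemma G_one: assumes "\<theta> \<in> T" "\<And>v. s < v \<Longrightarrow> \<not> 0 < g \<theta> v" shows "G M \<theta> s = 1"
proof -
  have "AE v in lborel. v \<noteq> s" by (rule AE_lborel_singleton)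
  then have "(\<integral>\<^sup>+v. ennreal (g \<theta> v) * indicator {s..} v \<partial>lborel) = (\<integral>\<^sup>+(v::real). 0 \<partial>lborel)"
    by (intro nn_integral_cong_AE, eventually_elim)
       (use assms(2) in \<open>auto simp: indicator_def ennreal_neg not_less\<close>)
  then show ?thesis using G_tail[OF assms(1), of s] G_bounds[OF assms(1), of s] by simp
qed

lemma G_vlo: "\<theta> \<in> T \<Longrightarrow> v \<le> vlo \<Longrightarrow> G M \<theta> v = 0"
  by (intro G_zero) (auto simp: V_iff dest!: g_pos_V)

lemma G_vhi: "\<theta> \<in> T \<Longrightarrow> vhi \<le> v \<Longrightarrow> G M \<theta> v = 1"
  by (intro G_one) (auto simp: V_iff dest!: g_pos_V)

lemma support_interval:
  "\<theta> \<in> T \<Longrightarrow> 0 < g \<theta> x \<Longrightarrow> 0 < g \<theta> y \<Longrightarrow> x \<le> s \<Longrightarrow> s \<le> y \<Longrightarrow> 0 < g \<theta> s"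
  using convex_support[of \<theta>] unfolding is_interval_convex_1[symmetric] is_interval_1 by blast

text \<open>Convexity leaves a point outside the support only two positions, wholly below or wholly
  above it. Arguments about off-path values rest on this dichotomy.\<close>

lemma support_gap:
  assumes "\<theta> \<in> T" "\<not> 0 < g \<theta> s"
  obtains "\<And>v. 0 < g \<theta> v \<Longrightarrow> s < v" "G M \<theta> s = 0" | "\<And>v. 0 < g \<theta> v \<Longrightarrow> v < s" "G M \<theta> s = 1"
proof (cases "\<forall>v. 0 < g \<theta> v \<longrightarrow> s < v")
  case True
  then show ?thesis using assms by (intro that(1) G_zero) auto
next
  case False
  then obtain x where x: "0 < g \<theta> x" "x < s"
    using assms(2) by (metis linorder_neqE_linordered_idom)
  have "v < s" if v: "0 < g \<theta> v" for v
  proof (rule ccontr)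
    assume "\<not> v < s"
    then show False
      using support_interval[OF assms(1) x(1) v, of s] x assms(2) by simp
  qed
  then show ?thesis
    using assms(1) by (intro that(2) G_one) (auto dest: less_asym)
qed

lemma support_nonempty: assumes "\<theta> \<in> T" obtains v where "0 < g \<theta> v"
proof (rule ccontr)
  assume "\<not> thesis"
  then have neg: "g \<theta> v \<le> 0" for v using that by (auto simp: not_less[symmetric])
  have "(\<integral>\<^sup>+v. ennreal (g \<theta> v) \<partial>lborel) = (\<integral>\<^sup>+(v::real). 0 \<partial>lborel)"
    by (intro nn_integral_cong) (simp add: neg ennreal_neg)
  then show False using nn_integral_g[OF assms] by simp
qed

lemma v_inf_le: assumes "\<theta> \<in> T" "0 < g \<theta> v" shows "v_inf M \<theta> \<le> v"
proof -
  have "bdd_below {v. 0 < g \<theta> v}"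
  proof (rule bdd_belowI)
    fix x assume "x \<in> {v. 0 < g \<theta> v}"
    then show "vlo \<le> x" using g_pos_V[OF assms(1), of x] by (simp add: V_iff)
  qed
  then show ?thesis
    unfolding v_inf_def using assms(2) by (intro cInf_lower) simp_all
qed

lemma v_inf_ge: assumes "\<theta> \<in> T" "\<And>v. 0 < g \<theta> v \<Longrightarrow> x \<le> v" shows "x \<le> v_inf M \<theta>"
proof -
  obtain v where "0 < g \<theta> v" using support_nonempty[OF assms(1)] .
  then have "{v. 0 < g \<theta> v} \<noteq> {}" by auto
  then show ?thesis
    unfolding v_inf_def using assms(2) by (intro cInf_greatest) simp_all
qed

lemma v_inf_V: assumes "\<theta> \<in> T" shows "v_inf M \<theta> \<in> V"
proof -
  obtain v where "0 < g \<theta> v" using support_nonempty assms .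
  then show ?thesis
    using v_inf_le[OF assms] v_inf_ge[OF assms, of vlo] g_pos_V[OF assms] by (force simp: V_iff)
qed

lemma G_antimono: assumes "\<theta>' \<in> T" "\<theta> \<in> T" "\<theta>' \<le> \<theta>" shows "G M \<theta> v \<le> G M \<theta>' v"
proof (cases "v \<in> V \<and> \<theta>' < \<theta>")
  case True
  then show ?thesis using fosd assms unfolding fosd_ordered_def by (metis less_eq_real_def)
next
  case False
  then show ?thesis
    using assms G_vlo[of _ v] G_vhi[of _ v] by (cases "\<theta>' = \<theta>") (auto simp: V_iff)
qed

text \<open>By dominance \<open>G M \<theta> s = 0\<close> for \<open>s\<close> below the support of
  the lower type. A support point \<open>v < s\<close> of the higher type contradicts this: either
  the segment from \<open>v\<close> to \<open>s\<close> lies in its support and has positive mass,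
  or \<open>s\<close> lies above that support and \<open>G M \<theta> s = 1\<close>.\<close>

lemma v_inf_mono: assumes "\<theta>' \<in> T" "\<theta> \<in> T" "\<theta>' \<le> \<theta>" shows "v_inf M \<theta>' \<le> v_inf M \<theta>"
proof (rule v_inf_ge)
  fix v assume v: "0 < g \<theta> v"
  show "v_inf M \<theta>' \<le> v"
  proof (rule ccontr)
    assume "\<not> ?thesis"
    then have v': "v < v_inf M \<theta>'" by simp
    define s where "s = (v + v_inf M \<theta>') / 2"
    have s: "v < s" "s < v_inf M \<theta>'" using v' by (auto simp: s_def)
    have "G M \<theta>' s = 0"
      using v_inf_le[OF assms(1)] s by (intro G_zero assms) force
    then have G0: "G M \<theta> s = 0"
      using G_antimono[OF assms, of s] G_bounds(1)[OF assms(2), of s] by simp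
    show False
    proof (cases "0 < g \<theta> s")
      case True
      have sub: "{v..s} \<subseteq> {v. 0 < g \<theta> v}"
        using support_interval[OF assms(2) v True] by auto
      have "(\<integral>\<^sup>+x. ennreal (g \<theta> x) * indicator {..s} x \<partial>lborel) = emeasure (value_law M \<theta>) {..s}"
        by (simp add: emeasure_value_law)
      also have "\<dots> = 0"
        using G0 real_distribution_value_law[OF assms(2)] finite_measure.emeasure_eq_measure[of "value_law M \<theta>" "{..s}"]
        by (simp add: G_def cdf_def real_distribution_def prob_space_def)
      finally have "AE x in lborel. ennreal (g \<theta> x) * indicator {..s} x = 0"
        by (subst (asm) nn_integral_0_iff_AE) auto
      then have "AE x in lborel. x \<notin> {v..s}"
        by eventually_elim (use sub in \<open>force simp: indicator_def\<close>)
      then have "emeasure lborel {v..s} = 0"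
        by (subst (asm) AE_iff_null_sets[symmetric]) auto
      then show False using s by simp
    next
      case False
      then show False
        using support_gap[OF assms(2) False] v s G0 by (metis less_asym zero_neq_one)
    qed
  qed
qed fact

text \<open>Positivity of \<open>f\<close> gives the tail above \<theta> positive mass. This
  licenses the division by \<open>1 - F\<close> when \<open>D\<close> is read off from the virtual
  value.\<close>

lemma F_less_1: assumes "\<theta> \<in> T" "\<theta> < hi" shows "F M \<theta> < 1"
proof (rule ccontr)
  interpret prob_space "type_law M" by (rule prob_type_law)
  assume "\<not> F M \<theta> < 1"
  then have "prob {..\<theta>} = 1"
    using prob_le_1[of "{..\<theta>}"] by (simp add: F_def cdf_def)
  then have "prob (space (type_law M) - {..\<theta>}) = 0"
    by (subst prob_compl) (auto simp: type_law_def)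
  moreover have "space (type_law M) - {..\<theta>} = {\<theta><..}"
    by (auto simp: type_law_def)
  ultimately have "emeasure (type_law M) {\<theta><..} = 0"
    by (simp add: emeasure_eq_measure)
  then have "AE x in lborel. ennreal (f x) * indicator {\<theta><..} x = 0"
    by (simp add: type_law_def emeasure_density nn_integral_0_iff_AE)
  then have "AE x in lborel. x \<notin> {\<theta><..hi}"
  proof eventually_elim
    case (elim x)
    then show ?case using f_pos[of x] assms(1) by (auto simp: indicator_def T_iff)
  qed
  then have "emeasure lborel {\<theta><..hi} = 0"
    by (subst (asm) AE_iff_null_sets[symmetric]) auto
  then show False using assms by simp
qed

lemma F_le_1: "F M \<theta> \<le> 1"
  unfolding F_def using real_distribution.cdf_bounded_prob[OF real_distribution_type_law] .

lemma F_measurable [measurable]: "F M \<in> borel_measurable borel"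
  unfolding F_def
  by (intro borel_measurable_mono monoI finite_borel_measure.cdf_nondecreasing
      real_distribution.finite_borel_measure_M real_distribution_type_law)

lemma F_tail: "ennreal (1 - F M x) = (\<integral>\<^sup>+\<theta>. ennreal (f \<theta>) * indicator {x..} \<theta> \<partial>lborel)"
proof -
  interpret prob_space "type_law M" by (rule prob_type_law)
  have *: "AE v in lborel. v \<noteq> x" by (rule AE_lborel_singleton)
  have compl: "space (type_law M) - {..x} = {x<..}"
    by (auto simp: type_law_def)
  have "1 - F M x = prob (space (type_law M) - {..x})"
    unfolding F_def cdf_def by (subst prob_compl) (auto simp: type_law_def)
  also have "ennreal \<dots> = emeasure (type_law M) {x<..}"
    unfolding compl by (simp add: emeasure_eq_measure)
  also have "\<dots> = (\<integral>\<^sup>+v. ennreal (f v) * indicator {x<..} v \<partial>lborel)"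
    by (simp add: type_law_def emeasure_density)
  also have "\<dots> = (\<integral>\<^sup>+v. ennreal (f v) * indicator {x..} v \<partial>lborel)"
    using * by (intro nn_integral_cong_AE) (auto elim!: eventually_mono simp: indicator_def)
  finally show ?thesis .
qed

section \<open>The derivative of the conditional distribution in the type\<close>

lemma G_deriv_support:
  assumes "\<theta> \<in> T" "0 < g \<theta> v"
  shows "((\<lambda>x. G M x v) has_vector_derivative dG M \<theta> v) (at \<theta> within T)"
proof -
  have "(\<lambda>x. G M x v) differentiable (at \<theta> within T)"
    using assms screening by (simp add: screening_def)
  then show ?thesis
    unfolding dG_def by (rule vector_derivative_works[THEN iffD1])
qed

lemma dG_nonpos: assumes "\<theta> \<in> T" "0 < g \<theta> v" shows "dG M \<theta> v \<le> 0"
proof -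
  have "((\<lambda>y. (G M y v - G M \<theta> v) / (y - \<theta>)) \<longlongrightarrow> dG M \<theta> v) (at \<theta> within T)"
    using G_deriv_support[OF assms]
    by (simp add: has_real_derivative_iff_has_vector_derivative[symmetric] has_field_derivative_iff)
  moreover have "\<forall>\<^sub>F y in at \<theta> within T. (G M y v - G M \<theta> v) / (y - \<theta>) \<le> 0"
    unfolding eventually_at_topological
    using assms(1) G_antimono[of _ \<theta> v] G_antimono[of \<theta> _ v]
    by (intro exI[of _ UNIV]) (auto simp: divide_le_0_iff linorder_neq_iff)
  moreover have "at \<theta> within T \<noteq> bot"
    using assms(1) lo_less_hi by (auto simp: Types_def trivial_limit_within islimpt_Icc)
  ultimately show ?thesis
    by (rule tendsto_upperbound)
qed

lemma \<phi>_eq: "\<theta> \<in> T \<Longrightarrow> 0 < g \<theta> v \<Longrightarrow> \<phi> \<theta> v = v + (1 - F M \<theta>) / f \<theta> * (dG M \<theta> v / g \<theta> v)"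
  using virtual_value g_pos_V[of \<theta> v] by (simp add: dynamic_virtual_value_def)

lemma \<phi>_le: assumes "\<theta> \<in> T" "0 < g \<theta> v" shows "\<phi> \<theta> v \<le> v"
proof -
  have "(1 - F M \<theta>) / f \<theta> * (dG M \<theta> v / g \<theta> v) \<le> 0"
    using dG_nonpos[OF assms] F_le_1[of \<theta>] f_pos[OF assms(1)] assms(2)
    by (intro mult_nonneg_nonpos) (auto simp: divide_nonpos_pos)
  then show ?thesis by (simp add: \<phi>_eq[OF assms])
qed

lemma \<phi>_mono_v: "\<theta> \<in> T \<Longrightarrow> x \<in> V \<Longrightarrow> y \<in> V \<Longrightarrow> x \<le> y \<Longrightarrow> \<phi> \<theta> x \<le> \<phi> \<theta> y"
  and \<phi>_mono_\<theta>: "v \<in> V \<Longrightarrow> \<theta>' \<in> T \<Longrightarrow> \<theta> \<in> T \<Longrightarrow> \<theta>' \<le> \<theta> \<Longrightarrow> \<phi> \<theta>' v \<le> \<phi> \<theta> v"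
  using increasing by (auto simp: weakly_increasing2_def mono_on_def)

lemma restrict_measurable_TV:
  fixes k :: "real \<Rightarrow> real \<Rightarrow> real"
  shows "case_prod k \<in> borel_measurable (restrict_space borel (T \<times> V)) \<longleftrightarrow>
    (\<lambda>(x, v). indicator (T \<times> V) (x, v) * k x v) \<in> borel_measurable (borel \<Otimes>\<^sub>M borel)"
proof -
  have "T \<times> V \<in> sets (borel \<Otimes>\<^sub>M borel)" by simp
  then show ?thesis
    by (subst borel_measurable_restrict_space_iff)
       (auto simp: borel_prod[symmetric] case_prod_beta' cong: measurable_cong_sets)
qed

text \<open>\<open>D\<close> is the density of \<open>- G(v | \<cdot>)\<close> in the type. At the kinks of \<open>G\<close> and off the support, where
  the value of \<open>dG\<close> is arbitrary or 0, it is set to 0. The type \<open>hi\<close> is left out because only there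
  \<open>F = 1\<close>, so that \<open>dG\<close> cannot be recovered from the virtual value.\<close>

definition D :: "real \<Rightarrow> real \<Rightarrow> real" where
  "D x v = (if x \<in> {lo..<hi} \<and> 0 < g x v then - dG M x v else 0)"

lemma D_nonneg: "0 \<le> D x v"
  unfolding D_def using dG_nonpos by (auto simp: T_iff)

text \<open>The virtual value formula cleared of denominators: weighted by the joint density, the
  gap between value and virtual value is a rent density weighted by the mass \<open>1 - F\<close> of
  higher types.\<close>

lemma D_virtual_value:
  assumes "x \<in> T" "x < hi" "0 < g x v" shows "(1 - F M x) * D x v = f x * g x v * (v - \<phi> x v)"
proof -
  have "D x v = - dG M x v" using assms by (simp add: D_def T_iff)
  moreover have "v - \<phi> x v = - ((1 - F M x) / f x * (dG M x v / g x v))"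
    by (simp add: \<phi>_eq[OF assms(1,3)])
  ultimately show ?thesis using assms(3) f_pos[OF assms(1)] by simp
qed

text \<open>\<open>dG\<close> is a pointwise derivative about which no measurability is assumed.
  \<open>D\<close> inherits measurability from the virtual value, by solving the preceding identity
  for \<open>D\<close>.\<close>

lemma D_measurable [measurable]: "case_prod D \<in> borel_measurable (borel \<Otimes>\<^sub>M borel)"
proof -
  have *: "(\<lambda>(x, v). indicator (T \<times> V) (x, v) * \<phi> x v) \<in> borel_measurable (borel \<Otimes>\<^sub>M borel)"
    using virtual_value restrict_measurable_TV[of \<phi>] by (simp add: dynamic_virtual_value_def)
  define k where "k = (\<lambda>p. indicator (T \<times> V) p * case_prod \<phi> p)"
  have [measurable]: "k \<in> borel_measurable (borel \<Otimes>\<^sub>M borel)"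
    unfolding k_def using * by (simp add: case_prod_beta')
  have "D x v = (if lo \<le> x \<and> x < hi \<and> 0 < g x v then f x * g x v * (v - k (x, v)) / (1 - F M x) else 0)" for x v
    using D_virtual_value[of x v] F_less_1[of x] g_pos_V[of x v]
    by (auto simp: T_iff D_def k_def field_simps)
  then have "case_prod D = (\<lambda>p. if lo \<le> fst p \<and> fst p < hi \<and> 0 < g (fst p) (snd p)
      then f (fst p) * g (fst p) (snd p) * (snd p - k p) / (1 - F M (fst p)) else 0)"
    by (auto simp: fun_eq_iff)
  then show ?thesis
    by simp
qed

text \<open>By dominance the types with \<open>G M x v = 0\<close> form an upper set and those with
  \<open>G M x v = 1\<close> a lower set of \<open>T\<close>. \<open>kink0\<close> and
  \<open>kink1\<close> are the inner ends of these sets, the only interior types where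
  \<open>G\<close> can have a kink. The inserted \<open>hi\<close> and \<open>lo\<close> are the
  values for empty sets.\<close>

definition kink0 :: "real \<Rightarrow> real" where "kink0 v = Inf (insert hi {x \<in> T. G M x v = 0})"
definition kink1 :: "real \<Rightarrow> real" where "kink1 v = Sup (insert lo {x \<in> T. G M x v = 1})"

lemma kink_bdd: "bdd_below (insert hi {x \<in> T. P x})" "bdd_above (insert lo {x \<in> T. P x})"
proof -
  show "bdd_below (insert hi {x \<in> T. P x})"
    by (rule bdd_belowI[where m=lo]) (use lo_less_hi in \<open>auto simp: T_iff\<close>)
  show "bdd_above (insert lo {x \<in> T. P x})"
    by (rule bdd_aboveI[where M=hi]) (use lo_less_hi in \<open>auto simp: T_iff\<close>)
qed

text \<open>Raising the value shrinks the set of types with \<open>G = 0\<close> and enlarges the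
  set with \<open>G = 1\<close>. Monotonicity is what allows the kinks at a given type to be
  counted.\<close>

lemma kink_mono: "mono kink0" "mono kink1"
proof -
  show "mono kink0"
  proof (rule monoI)
    fix x y :: real assume "x \<le> y"
    then have "insert hi {u \<in> T. G M u y = 0} \<subseteq> insert hi {u \<in> T. G M u x = 0}"
      using G_mono[of _ x y] G_bounds(1)[of _ x] by (force intro: antisym)
    then show "kink0 x \<le> kink0 y"
      unfolding kink0_def by (intro cInf_superset_mono kink_bdd) auto
  qed
  show "mono kink1"
  proof (rule monoI)
    fix x y :: real assume "x \<le> y"
    then have "insert lo {u \<in> T. G M u x = 1} \<subseteq> insert lo {u \<in> T. G M u y = 1}"
      using G_mono[of _ x y] G_bounds(2)[of _ y] by (force intro: antisym)
    then show "kink1 x \<le> kink1 y"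
      unfolding kink1_def by (intro cSup_subset_mono kink_bdd) auto
  qed
qed

text \<open>On the support this is the assumed differentiability. Off it, a type that is not a kink
  lies strictly inside the region where \<open>G\<close> is 0, or where it is 1, so \<open>G\<close>
  is locally constant and \<open>D\<close> is 0.\<close>

lemma G_deriv:
  assumes x: "lo < x" "x < hi" and kink: "x \<noteq> kink0 v" "x \<noteq> kink1 v"
  shows "((\<lambda>x. G M x v) has_vector_derivative - D x v) (at x)"
proof (cases "0 < g x v")
  case True
  have "((\<lambda>x. G M x v) has_vector_derivative dG M x v) (at x within {lo<..<hi})"
    using x by (intro has_vector_derivative_within_subset[OF G_deriv_support[OF _ True]]) (auto simp: T_iff)
  then show ?thesis
    using x True by (simp add: D_def at_within_open[of x "{lo<..<hi}"])
next
  case False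
  have xT: "x \<in> T" using x by (simp add: T_iff)
  have const: "((\<lambda>x. G M x v) has_vector_derivative 0) (at x)"
    if "open S" "x \<in> S" "\<And>y. y \<in> S \<Longrightarrow> G M y v = k" for S k
    using that by (intro has_vector_derivative_transform_within_open[OF has_vector_derivative_const, of S]) auto
  have D0: "D x v = 0" using False by (simp add: D_def)
  from support_gap[OF xT False] show ?thesis
  proof cases
    case 1
    then have "kink0 v \<le> x"
      unfolding kink0_def using xT by (intro cInf_lower kink_bdd) auto
    then have "kink0 v < x" using kink by simp
    then obtain y where y: "y \<in> insert hi {x \<in> T. G M x v = 0}" "y < x"
      unfolding kink0_def using cInf_lessD[of "insert hi {x \<in> T. G M x v = 0}" x] by auto
    then have yG: "y \<in> T" "G M y v = 0" using x by auto
    have "((\<lambda>x. G M x v) has_vector_derivative 0) (at x)"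
    proof (rule const[of "{y<..<hi}" 0])
      fix z assume "z \<in> {y<..<hi}"
      then have "z \<in> T" "y \<le> z" using yG by (auto simp: T_iff)
      then show "G M z v = 0"
        using G_antimono[OF yG(1), of z v] G_bounds(1)[of z v] yG(2) by simp
    qed (use x y in auto)
    then show ?thesis by (simp add: D0)
  next
    case 2
    then have "x \<le> kink1 v"
      unfolding kink1_def using xT by (intro cSup_upper kink_bdd) auto
    then have "x < kink1 v" using kink by simp
    then obtain y where y: "y \<in> insert lo {x \<in> T. G M x v = 1}" "x < y"
      unfolding kink1_def using less_cSupD[of "insert lo {x \<in> T. G M x v = 1}" x] by auto
    then have yG: "y \<in> T" "G M y v = 1" using x by auto
    have "((\<lambda>x. G M x v) has_vector_derivative 0) (at x)"
    proof (rule const[of "{lo<..<y}" 1])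
      fix z assume "z \<in> {lo<..<y}"
      then have "z \<in> T" "z \<le> y" using yG by (auto simp: T_iff)
      then show "G M z v = 1"
        using G_antimono[of z y v] G_bounds(2)[of z v] yG by simp
    qed (use x y in auto)
    then show ?thesis by (simp add: D0)
  qed
qed

lemma G_continuous: "continuous_on T (\<lambda>x. G M x v)"
proof (cases "v \<in> V")
  case True
  then show ?thesis using screening by (auto simp: screening_def)
next
  case False
  then have "(\<forall>x\<in>T. G M x v = 0) \<or> (\<forall>x\<in>T. G M x v = 1)"
    using G_vlo[of _ v] G_vhi[of _ v] by (auto simp: V_iff)
  then show ?thesis by (auto cong: continuous_on_cong)
qed

text \<open>For a fixed value only the two kinks are exceptional among interior types, and
  continuity of \<open>G\<close> in the type carries the fundamental theorem of calculus across
  them. Nonnegativity of \<open>D\<close> turns the gauge integral into a Lebesgue integral.\<close>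

lemma D_nn_integral:
  assumes "\<theta>' \<in> T" "\<theta> \<in> T" "\<theta>' \<le> \<theta>"
  shows "(\<integral>\<^sup>+x. ennreal (D x v) * indicator {\<theta>'..\<theta>} x \<partial>lborel) = ennreal (G M \<theta>' v - G M \<theta> v)"
proof -
  have sub: "{\<theta>'..\<theta>} \<subseteq> T" using assms by (auto simp: T_iff)
  have "((\<lambda>x. - D x v) has_integral (G M \<theta> v - G M \<theta>' v)) {\<theta>'..\<theta>}"
    using assms
    by (intro fundamental_theorem_of_calculus_interior_strong[where S="{kink0 v, kink1 v}"] G_deriv
        continuous_on_subset[OF G_continuous sub]) (auto simp: T_iff)
  from has_integral_neg[OF this] have "((\<lambda>x. D x v) has_integral (G M \<theta>' v - G M \<theta> v)) {\<theta>'..\<theta>}"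
    by simp
  then have "((\<lambda>x. if x \<in> {\<theta>'..\<theta>} then D x v else 0) has_integral (G M \<theta>' v - G M \<theta> v)) UNIV"
    by (subst has_integral_restrict_UNIV)
  then have "(\<integral>\<^sup>+x. ennreal (if x \<in> {\<theta>'..\<theta>} then D x v else 0) \<partial>lborel) = ennreal (G M \<theta>' v - G M \<theta> v)"
    by (intro nn_integral_has_integral_lborel) (auto simp: D_nonneg)
  then show ?thesis
    by (subst (asm) nn_integral_cong[where v="\<lambda>x. ennreal (D x v) * indicator {\<theta>'..\<theta>} x"]) (auto simp: indicator_def)
qed

text \<open>A monotone function that attains a level twice is constant in between and attains it at
  a rational. Outside the images of the rationals each level is therefore attained at most
  once.\<close>

lemma finite_kinks:
  assumes "x \<notin> kink0 ` \<rat> \<union> kink1 ` \<rat>"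
  shows "finite {v. x = kink0 v \<or> x = kink1 v}"
proof -
  have "finite (k -` {x})" if k: "mono k" "x \<notin> k ` \<rat>" for k :: "real \<Rightarrow> real"
  proof (cases "\<exists>y. k y = x")
    case True
    then obtain y where y: "k y = x" by blast
    have "z = y" if z: "k z = x" for z
    proof (rule ccontr)
      assume "z \<noteq> y"
      then have "min y z < max y z" by auto
      from Rats_dense_in_real[OF this] obtain r where r: "r \<in> \<rat>" "min y z < r" "r < max y z"
        by blast
      then have "k (min y z) \<le> k r" "k r \<le> k (max y z)"
        by (auto intro!: monoD[OF k(1)])
      then have "k r = x" using y z by (auto simp: min_def max_def split: if_splits)
      then show False using k(2) r(1) by blast
    qed
    then have "k -` {x} \<subseteq> {y}" by auto
    then show ?thesis by (rule finite_subset) simp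
  next
    case False
    then have "k -` {x} = {}" by auto
    then show ?thesis by simp
  qed
  from this[OF kink_mono(1)] this[OF kink_mono(2)] assms
  have "finite (kink0 -` {x} \<union> kink1 -` {x})" by simp
  then show ?thesis
    by (rule finite_subset[rotated]) auto
qed

text \<open>The exceptional set is countable, not just null, so that \<open>dG\<close> inherits measurability from \<open>D\<close>.\<close>

lemma dG_eq:
  obtains C where "countable C"
    and "\<And>x. x \<in> T \<Longrightarrow> x \<notin> C \<Longrightarrow> finite {v. \<not> ((\<lambda>x. G M x v) has_vector_derivative - D x v) (at x)}"
    and "\<And>x. x \<in> T \<Longrightarrow> x \<notin> C \<Longrightarrow> finite {v. dG M x v \<noteq> - D x v}"
proof (rule that[of "{lo, hi} \<union> kink0 ` \<rat> \<union> kink1 ` \<rat>"])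
  show "countable ({lo, hi} \<union> kink0 ` \<rat> \<union> kink1 ` \<rat>)"
    by (intro countable_Un countable_image countable_rat) simp
  fix x assume "x \<in> T" and C: "x \<notin> {lo, hi} \<union> kink0 ` \<rat> \<union> kink1 ` \<rat>"
  then have x: "lo < x" "x < hi" by (auto simp: T_iff)
  have fin: "finite {v. x = kink0 v \<or> x = kink1 v}"
    using C by (intro finite_kinks) simp
  then show deriv: "finite {v. \<not> ((\<lambda>x. G M x v) has_vector_derivative - D x v) (at x)}"
    by (rule finite_subset[rotated]) (use G_deriv[OF x] in blast)
  have "dG M x v = - D x v" if "((\<lambda>x. G M x v) has_vector_derivative - D x v) (at x)" for v
  proof -
    have "((\<lambda>x. G M x v) has_vector_derivative - D x v) (at x within {lo..hi})"
      using that by (rule has_vector_derivative_at_within)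
    moreover have "x \<in> {lo..hi}" using x by simp
    ultimately show "dG M x v = - D x v"
      unfolding dG_def Types_def by (intro vector_derivative_within_closed_interval[OF lo_less_hi])
  qed
  then show "finite {v. dG M x v \<noteq> - D x v}"
    by (intro finite_subset[OF _ deriv]) blast
qed

lemma AE_G_deriv:
  "AE x in lborel. lo < x \<longrightarrow> x < hi \<longrightarrow> (AE v in lborel. ((\<lambda>x. G M x v) has_vector_derivative - D x v) (at x))"
proof (rule dG_eq)
  fix C assume "countable C"
    and fin: "\<And>x. x \<in> T \<Longrightarrow> x \<notin> C \<Longrightarrow> finite {v. \<not> ((\<lambda>x. G M x v) has_vector_derivative - D x v) (at x)}"
  show ?thesis
  proof (rule eventually_mono[OF AE_lborel_countable[OF \<open>countable C\<close>]], intro impI)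
    fix x assume "x \<notin> C" "lo < x" "x < hi"
    then have "countable {v. \<not> ((\<lambda>x. G M x v) has_vector_derivative - D x v) (at x)}"
      by (intro countable_finite fin) (auto simp: T_iff)
    from AE_lborel_countable[OF this]
    show "AE v in lborel. ((\<lambda>x. G M x v) has_vector_derivative - D x v) (at x)"
      by simp
  qed
qed

end

section \<open>Envelope formula and information rents\<close>

lemma set_lebesgue_integral_nonneg:
  fixes k :: "'a \<Rightarrow> real"
  assumes "\<And>x. x \<in> A \<Longrightarrow> 0 \<le> k x"
  shows "0 \<le> (LINT x:A|N. k x)"
  unfolding set_lebesgue_integral_def
  using assms by (intro integral_nonneg_AE) (auto simp: indicator_def)

context screening_environment begin

lemma value_law_integrable_iff:
  assumes "\<theta> \<in> T" and [measurable]: "set_borel_measurable borel V W"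
  shows "set_integrable (value_law M \<theta>) V W \<longleftrightarrow> integrable lborel (\<lambda>v. g \<theta> v * (indicator V v * W v))"
    and "(LINT v:V|value_law M \<theta>. W v) = (LINT v|lborel. g \<theta> v * (indicator V v * W v))"
proof -
  have [measurable]: "(\<lambda>v. indicator V v * W v) \<in> borel_measurable borel"
    using assms(2) by (simp add: set_borel_measurable_def)
  have nn: "AE v in lborel. 0 \<le> g \<theta> v" using g_nonneg[OF assms(1)] by simp
  show "set_integrable (value_law M \<theta>) V W \<longleftrightarrow> integrable lborel (\<lambda>v. g \<theta> v * (indicator V v * W v))"
    unfolding set_integrable_def value_law_def by (subst integrable_density[OF _ _ nn]) auto
  show "(LINT v:V|value_law M \<theta>. W v) = (LINT v|lborel. g \<theta> v * (indicator V v * W v))"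
    unfolding set_lebesgue_integral_def value_law_def by (subst integral_density[OF _ _ nn]) auto
qed

lemma mono_on_set_borel_measurable:
  fixes P :: "real \<Rightarrow> real"
  assumes "mono_on V P"
  shows "set_borel_measurable borel V P"
  using borel_measurable_integrable[OF mono_on_set_integrable[of vlo vhi P, unfolded set_integrable_def]] assms
  by (simp add: set_borel_measurable_def Vals_def)

lemma G_measurable2 [measurable]: "G M \<theta> \<in> borel_measurable borel"
  using G_measurable by measurable

lemma set_integrable_weighted:
  fixes P k :: "real \<Rightarrow> real"
  assumes P: "mono_on V P" and k: "k \<in> borel_measurable borel" "\<And>s. s \<in> V \<Longrightarrow> \<bar>k s\<bar> \<le> 1"
  shows "set_integrable lborel V (\<lambda>s. P s * k s)"
proof -
  have i: "set_integrable lborel V P"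
    using mono_on_set_integrable[of vlo vhi P] P by (simp add: Vals_def)
  show ?thesis
  proof (rule set_integrable_bound[OF i])
    have "(\<lambda>s. (indicator V s * P s) * k s) \<in> borel_measurable borel"
      using mono_on_set_borel_measurable[OF P] k by (auto simp: set_borel_measurable_def)
    then show "set_borel_measurable lborel V (\<lambda>s. P s * k s)"
      by (simp add: set_borel_measurable_def mult.assoc)
    show "AE s in lborel. s \<in> V \<longrightarrow> norm (P s * k s) \<le> norm (P s)"
      using k(2) by (auto simp: abs_mult intro!: mult_left_le)
  qed
qed

text \<open>Integration by parts: the rent \<open>P s\<close> accrues to all values above \<open>s\<close>, which have probability
  \<open>1 - G(s | \<theta>)\<close>.\<close>

lemma expected_envelope:
  fixes P W :: "real \<Rightarrow> real"
  assumes \<theta>: "\<theta> \<in> T" and P: "mono_on V P" "\<And>v. v \<in> V \<Longrightarrow> 0 \<le> P v"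
    and W: "\<And>v. v \<in> V \<Longrightarrow> W v = W vlo + (LINT s:{vlo..v}|lborel. P s)"
  shows "set_borel_measurable borel V W"
    and "set_integrable (value_law M \<theta>) V W"
    and "(LINT v:V|value_law M \<theta>. W v) = W vlo + (LINT s:V|lborel. P s * (1 - G M \<theta> s))"
proof -
  define R where "R v = (LINT s:{vlo..v}|lborel. P s)" for v
  define P' where "P' s = indicator V s * P s" for s
  have P'0: "0 \<le> P' s" for s using P(2) by (auto simp: P'_def indicator_def)
  have [measurable]: "P' \<in> borel_measurable borel"
    using mono_on_set_borel_measurable[OF P(1)] by (simp add: P'_def[abs_def] set_borel_measurable_def)
  have Pint: "set_integrable lborel {vlo..v} P" if "v \<in> V" for v
    using that by (intro mono_on_set_integrable mono_on_subset[OF P(1)]) (auto simp: Vals_def)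
  have R0: "0 \<le> R v" if "v \<in> V" for v
    unfolding R_def using that P(2) by (intro set_lebesgue_integral_nonneg) (auto simp: V_iff)
  have Rnn: "ennreal (R v) = (\<integral>\<^sup>+s. ennreal (P' s) * indicator {..v} s \<partial>lborel)" if v: "v \<in> V" for v
  proof -
    have eq: "indicator {vlo..v} s * P s = P' s * indicator {..v} s" for s
      using v by (auto simp: P'_def indicator_def V_iff)
    have "(\<integral>\<^sup>+s. ennreal (indicator {vlo..v} s * P s) \<partial>lborel) = ennreal (R v)"
      unfolding R_def set_lebesgue_integral_def real_scaleR_def
      using Pint[OF v] P'0 by (intro nn_integral_eq_integral) (auto simp: set_integrable_def eq)
    then show ?thesis
      unfolding eq nn_integral_set_ennreal by simp
  qed
  have Wm: "mono_on V W"
  proof (rule mono_onI)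
    fix x y assume xy: "x \<in> V" "y \<in> V" "x \<le> y"
    have "(LINT s:{vlo..y}|lborel. P s) = (LINT s:{vlo..x}|lborel. P s) + (LINT s:{x..y}|lborel. P s)"
      using xy by (intro set_lebesgue_integral_combine Pint) (auto simp: V_iff)
    moreover have "0 \<le> (LINT s:{x..y}|lborel. P s)"
      using xy P(2) by (intro set_lebesgue_integral_nonneg) (auto simp: V_iff)
    ultimately show "W x \<le> W y" using W[OF xy(1)] W[OF xy(2)] by simp
  qed
  show Wmeas: "set_borel_measurable borel V W"
    by (rule mono_on_set_borel_measurable[OF Wm])
  have [measurable]: "(\<lambda>v. indicator V v * W v) \<in> borel_measurable borel"
    using Wmeas by (simp add: set_borel_measurable_def)
  have "indicator V v * W v - indicator V v * W vlo = indicator V v * R v" for v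
    using W[of v] by (cases "v \<in> V") (auto simp: R_def)
  moreover have "(\<lambda>v. indicator V v * W v - indicator V v * W vlo) \<in> borel_measurable borel"
    by measurable
  ultimately have Rm [measurable]: "(\<lambda>v. indicator V v * R v) \<in> borel_measurable borel"
    by simp
  have gint: "integrable lborel (g \<theta>)" "(LINT v|lborel. g \<theta> v) = 1"
    using nn_integral_g[OF \<theta>] g_nonneg[OF \<theta>]
    by (auto intro!: integrableI_nonneg simp: integral_eq_nn_integral)
  \<comment> \<open>Computed in \<open>ennreal\<close>, where Tonelli needs no integrability. The
    finite right-hand side then yields integrability of \<open>R\<close> under the value
    law.\<close>
  have E: "(\<integral>\<^sup>+v. ennreal (g \<theta> v * (indicator V v * R v)) \<partial>lborel) =
      ennreal (LINT s:V|lborel. P s * (1 - G M \<theta> s))"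
  proof -
    have "(\<integral>\<^sup>+v. ennreal (g \<theta> v * (indicator V v * R v)) \<partial>lborel) =
        (\<integral>\<^sup>+v. \<integral>\<^sup>+s. ennreal (g \<theta> v) * (ennreal (P' s) * indicator {..v} s) \<partial>lborel \<partial>lborel)"
    proof (rule nn_integral_cong)
      fix v
      have "ennreal (g \<theta> v * (indicator V v * R v)) = ennreal (g \<theta> v) * (\<integral>\<^sup>+s. ennreal (P' s) * indicator {..v} s \<partial>lborel)"
        using g_zero[OF \<theta>, of v] g_nonneg[OF \<theta>, of v] R0[of v] Rnn[of v]
        by (cases "v \<in> V") (auto simp: ennreal_mult)
      then show "ennreal (g \<theta> v * (indicator V v * R v)) =
          (\<integral>\<^sup>+s. ennreal (g \<theta> v) * (ennreal (P' s) * indicator {..v} s) \<partial>lborel)"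
        by (simp add: nn_integral_cmult)
    qed
    also have "\<dots> = (\<integral>\<^sup>+s. \<integral>\<^sup>+v. ennreal (g \<theta> v) * (ennreal (P' s) * indicator {..v} s) \<partial>lborel \<partial>lborel)"
    proof (rule lborel_pair.Fubini')
      have "(\<lambda>p. ennreal (g \<theta> (snd p)) * (ennreal (P' (fst p)) * (if fst p \<le> snd p then 1 else 0)))
          \<in> borel_measurable (lborel \<Otimes>\<^sub>M lborel)"
        by measurable
      then show "(\<lambda>(s, v). ennreal (g \<theta> v) * (ennreal (P' s) * indicator {..v} s)) \<in> borel_measurable (lborel \<Otimes>\<^sub>M lborel)"
        by (simp add: case_prod_beta' indicator_def)
    qed
    also have "\<dots> = (\<integral>\<^sup>+s. ennreal (indicator V s * (P s * (1 - G M \<theta> s))) \<partial>lborel)"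
    proof (rule nn_integral_cong)
      fix s
      have "(\<integral>\<^sup>+v. ennreal (g \<theta> v) * (ennreal (P' s) * indicator {..v} s) \<partial>lborel) =
          (\<integral>\<^sup>+v. ennreal (P' s) * (ennreal (g \<theta> v) * indicator {s..} v) \<partial>lborel)"
        by (intro nn_integral_cong) (auto simp: indicator_def mult_ac)
      also have "\<dots> = ennreal (P' s) * ennreal (1 - G M \<theta> s)"
        by (simp add: nn_integral_cmult G_tail[OF \<theta>])
      also have "\<dots> = ennreal (P' s * (1 - G M \<theta> s))"
        using P'0[of s] G_bounds(2)[OF \<theta>, of s] by (simp add: ennreal_mult)
      finally show "(\<integral>\<^sup>+v. ennreal (g \<theta> v) * (ennreal (P' s) * indicator {..v} s) \<partial>lborel) =
          ennreal (indicator V s * (P s * (1 - G M \<theta> s)))"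
        by (simp add: P'_def mult.assoc)
    qed
    also have "\<dots> = ennreal (LINT s:V|lborel. P s * (1 - G M \<theta> s))"
      unfolding set_lebesgue_integral_def real_scaleR_def
    proof (rule nn_integral_eq_integral)
      show "integrable lborel (\<lambda>s. indicator V s * (P s * (1 - G M \<theta> s)))"
        using set_integrable_weighted[OF P(1), of "\<lambda>s. 1 - G M \<theta> s"] G_bounds[OF \<theta>]
        by (simp add: set_integrable_def)
      show "AE s in lborel. 0 \<le> indicator V s * (P s * (1 - G M \<theta> s))"
        using P(2) G_bounds(2)[OF \<theta>] by (auto simp: indicator_def)
    qed
    finally show ?thesis .
  qed
  have E0: "0 \<le> (LINT s:V|lborel. P s * (1 - G M \<theta> s))"
    using P(2) G_bounds(2)[OF \<theta>] by (intro set_lebesgue_integral_nonneg) auto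
  have gR0: "0 \<le> g \<theta> v * (indicator V v * R v)" for v
    using g_nonneg[OF \<theta>, of v] R0[of v] by (auto simp: indicator_def)
  have Rint: "integrable lborel (\<lambda>v. g \<theta> v * (indicator V v * R v))"
    using E gR0 by (intro integrableI_nonneg) auto
  have RL: "(LINT v|lborel. g \<theta> v * (indicator V v * R v)) = (LINT s:V|lborel. P s * (1 - G M \<theta> s))"
    using gR0 E E0 by (subst integral_eq_nn_integral) auto
  have eq: "g \<theta> v * (indicator V v * W v) = g \<theta> v * W vlo + g \<theta> v * (indicator V v * R v)" for v
    using g_zero[OF \<theta>, of v] W[of v] by (cases "v \<in> V") (auto simp: R_def algebra_simps)
  show "set_integrable (value_law M \<theta>) V W"
    unfolding value_law_integrable_iff(1)[OF \<theta> Wmeas] eq using gint Rint by auto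
  show "(LINT v:V|value_law M \<theta>. W v) = W vlo + (LINT s:V|lborel. P s * (1 - G M \<theta> s))"
    unfolding value_law_integrable_iff(2)[OF \<theta> Wmeas] eq using gint Rint RL by simp
qed

text \<open>\<open>1 - indicator {v<..} s\<close> tells whether \<open>s \<le> v\<close>, so the
  kernel is this indicator minus its mean \<open>1 - G M \<theta> s\<close>. Anchoring ex post
  utility at its mean, rather than at the possibly off-path value \<open>v_lo\<close>, is what lets
  it depend on on-path slopes alone.\<close>

lemma envelope_kernel:
  fixes P W :: "real \<Rightarrow> real"
  assumes \<theta>: "\<theta> \<in> T" and P: "mono_on V P" "\<And>v. v \<in> V \<Longrightarrow> 0 \<le> P v"
    and W: "\<And>v. v \<in> V \<Longrightarrow> W v = W vlo + (LINT s:{vlo..v}|lborel. P s)" and v: "v \<in> V"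
  shows "W v = (LINT v:V|value_law M \<theta>. W v) + (LINT s:V|lborel. P s * (G M \<theta> s - indicator {v<..} s))"
proof -
  have i1: "set_integrable lborel V (\<lambda>s. P s * (1 - G M \<theta> s))"
    and i2: "set_integrable lborel V (\<lambda>s. P s * (G M \<theta> s - indicator {v<..} s))"
    using G_bounds[OF \<theta>] by (intro set_integrable_weighted P(1); auto simp: indicator_def)+
  have "(LINT s:V|lborel. P s * (1 - G M \<theta> s)) + (LINT s:V|lborel. P s * (G M \<theta> s - indicator {v<..} s)) =
      (LINT s:V|lborel. P s * (1 - G M \<theta> s) + P s * (G M \<theta> s - indicator {v<..} s))"
    by (rule set_integral_add(2)[OF i1 i2, symmetric])
  also have "\<dots> = (LINT s:{vlo..v}|lborel. P s)"
    unfolding set_lebesgue_integral_def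
    using v by (intro Bochner_Integration.integral_cong) (auto simp: indicator_def V_iff algebra_simps)
  finally show ?thesis
    using expected_envelope(3)[OF \<theta> P W] W[OF v] by simp
qed

lemma kernel_off_support:
  assumes \<theta>: "\<theta> \<in> T" and s: "\<not> 0 < g \<theta> s" and v: "0 < g \<theta> v \<or> v = v_inf M \<theta>"
  shows "G M \<theta> s - indicator {v<..} s = 0"
  using support_gap[OF \<theta> s]
proof cases
  case 1
  then have "s \<le> v_inf M \<theta>" by (intro v_inf_ge[OF \<theta>]) (auto intro: less_imp_le)
  then have "s \<le> v" using v v_inf_le[OF \<theta>, of v] by auto
  with 1 show ?thesis by simp
next
  case 2
  obtain x where "0 < g \<theta> x" using support_nonempty[OF \<theta>] .
  then have "v_inf M \<theta> < s" using 2(1) v_inf_le[OF \<theta>, of x] by fastforce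
  then have "v < s" using v 2(1) by auto
  with 2 show ?thesis by simp
qed

text \<open>The slope profile is the same under both types and only the distribution changes, as
  when one type imitates another. The second form, in \<open>ennreal\<close>, can be compared with
  rents by Tonelli and Fatou.\<close>

lemma expected_envelope_diff:
  fixes P W :: "real \<Rightarrow> real"
  assumes \<theta>: "\<theta> \<in> T" "\<theta>' \<in> T" and P: "mono_on V P" "\<And>v. v \<in> V \<Longrightarrow> 0 \<le> P v"
    and W: "\<And>v. v \<in> V \<Longrightarrow> W v = W vlo + (LINT s:{vlo..v}|lborel. P s)"
  shows "(LINT v:V|value_law M \<theta>. W v) - (LINT v:V|value_law M \<theta>'. W v) = (LINT s:V|lborel. P s * (G M \<theta>' s - G M \<theta> s))"
    and "\<theta>' \<le> \<theta> \<Longrightarrow> ennreal ((LINT v:V|value_law M \<theta>. W v) - (LINT v:V|value_law M \<theta>'. W v)) =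
      (\<integral>\<^sup>+s. ennreal (indicator V s * P s) * ennreal (G M \<theta>' s - G M \<theta> s) \<partial>lborel)"
proof -
  have i: "set_integrable lborel V (\<lambda>s. P s * (1 - G M \<theta> s))" "set_integrable lborel V (\<lambda>s. P s * (1 - G M \<theta>' s))"
    using G_bounds[OF \<theta>(1)] G_bounds[OF \<theta>(2)] by (intro set_integrable_weighted P(1); auto)+
  show eq: "(LINT v:V|value_law M \<theta>. W v) - (LINT v:V|value_law M \<theta>'. W v) = (LINT s:V|lborel. P s * (G M \<theta>' s - G M \<theta> s))"
    using set_integral_diff(2)[OF i]
      expected_envelope(3)[where P=P and W=W, OF \<theta>(1) P W] expected_envelope(3)[where P=P and W=W, OF \<theta>(2) P W]
    by (simp add: algebra_simps)
  assume le: "\<theta>' \<le> \<theta>"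
  have "set_integrable lborel V (\<lambda>s. P s * (G M \<theta>' s - G M \<theta> s))"
    using set_integral_diff(1)[OF i] by (simp add: algebra_simps)
  then have "(\<integral>\<^sup>+s. ennreal (indicator V s *\<^sub>R (P s * (G M \<theta>' s - G M \<theta> s))) \<partial>lborel) =
      ennreal (LINT s:V|lborel. P s * (G M \<theta>' s - G M \<theta> s))"
    unfolding set_lebesgue_integral_def
    using P(2) G_antimono[OF \<theta>(2,1) le]
    by (intro nn_integral_eq_integral) (auto simp: set_integrable_def indicator_def)
  then show "ennreal ((LINT v:V|value_law M \<theta>. W v) - (LINT v:V|value_law M \<theta>'. W v)) =
      (\<integral>\<^sup>+s. ennreal (indicator V s * P s) * ennreal (G M \<theta>' s - G M \<theta> s) \<partial>lborel)"
    unfolding eq using P(2) G_antimono[OF \<theta>(2,1) le]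
    by (subst (asm) nn_integral_cong[where v="\<lambda>s. ennreal (indicator V s * P s) * ennreal (G M \<theta>' s - G M \<theta> s)"])
       (auto simp: indicator_def ennreal_mult)
qed

text \<open>The growth of expected utility that local incentive constraints demand at type
  \<open>x\<close>. It takes values in \<open>ennreal\<close> because it may be infinite a
  priori.\<close>

definition rent_rate :: "(real \<Rightarrow> real \<Rightarrow> real) \<Rightarrow> real \<Rightarrow> ennreal" where
  "rent_rate P x = (\<integral>\<^sup>+s. ennreal (P x s) * ennreal (D x s) \<partial>lborel)"

definition rent :: "(real \<Rightarrow> real \<Rightarrow> real) \<Rightarrow> real \<Rightarrow> ennreal" where
  "rent P \<theta> = (\<integral>\<^sup>+x. rent_rate P x * indicator {lo..\<theta>} x \<partial>lborel)"

lemma rent_rate_measurable [measurable]: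
  "case_prod P \<in> borel_measurable (borel \<Otimes>\<^sub>M borel) \<Longrightarrow> rent_rate P \<in> borel_measurable borel"
proof -
  assume [measurable]: "case_prod P \<in> borel_measurable (borel \<Otimes>\<^sub>M borel)"
  have "(\<lambda>(x, s). ennreal (P x s) * ennreal (D x s)) \<in> borel_measurable (borel \<Otimes>\<^sub>M lborel)"
    by measurable
  then show ?thesis
    unfolding rent_rate_def by measurable
qed

text \<open>By imitating \<open>x\<close>, a slightly higher type secures a gain computed with the
  quantities of \<open>x\<close>, so the difference quotients of \<open>U\<close> dominate those of
  \<open>- G\<close> integrated against \<open>P x\<close>. Fatou in \<open>s\<close> passes to the
  limit \<open>D\<close>, and the bound on lower derivatives of monotone functions integrates over
  types.\<close>

lemma rent_le:
  fixes P W :: "real \<Rightarrow> real \<Rightarrow> real"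
  assumes Pm [measurable]: "case_prod P \<in> borel_measurable (borel \<Otimes>\<^sub>M borel)"
    and P0: "\<And>x s. 0 \<le> P x s" and Pz: "\<And>x s. s \<notin> V \<Longrightarrow> P x s = 0"
    and P: "\<And>x. x \<in> T \<Longrightarrow> mono_on V (P x)"
    and W: "\<And>x v. x \<in> T \<Longrightarrow> v \<in> V \<Longrightarrow> W x v = W x vlo + (LINT s:{vlo..v}|lborel. P x s)"
    and ic: "\<And>x y. x \<in> T \<Longrightarrow> y \<in> T \<Longrightarrow> (LINT v:V|value_law M y. W x v) \<le> (LINT v:V|value_law M y. W y v)"
    and \<theta>: "\<theta> \<in> T"
  defines "U \<equiv> \<lambda>x. (LINT v:V|value_law M x. W x v)"
  shows "mono_on T U" and "rent P \<theta> \<le> ennreal (U \<theta> - U lo)"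
proof -
  have incr: "(\<integral>\<^sup>+s. ennreal (P x s) * ennreal (G M x s - G M y s) \<partial>lborel) \<le> ennreal (U y - U x)"
    if xy: "x \<in> T" "y \<in> T" "x \<le> y" for x y
  proof -
    have "(\<integral>\<^sup>+s. ennreal (P x s) * ennreal (G M x s - G M y s) \<partial>lborel) =
        (\<integral>\<^sup>+s. ennreal (indicator V s * P x s) * ennreal (G M x s - G M y s) \<partial>lborel)"
      by (intro nn_integral_cong) (auto simp: indicator_def Pz)
    also have "\<dots> = ennreal ((LINT v:V|value_law M y. W x v) - (LINT v:V|value_law M x. W x v))"
      using xy by (intro expected_envelope_diff(2)[symmetric] P P0 W) auto
    also have "\<dots> \<le> ennreal (U y - U x)"
      unfolding U_def using ic[OF xy(1,2)] by (intro ennreal_leI) simp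
    finally show ?thesis .
  qed
  show mono: "mono_on T U"
  proof (rule mono_onI)
    fix x y assume xy: "x \<in> T" "y \<in> T" "x \<le> y"
    have "0 \<le> (LINT s:V|lborel. P x s * (G M x s - G M y s))"
      using G_antimono[OF xy] P0 by (intro set_lebesgue_integral_nonneg) auto
    also have "\<dots> = (LINT v:V|value_law M y. W x v) - (LINT v:V|value_law M x. W x v)"
      using xy by (intro expected_envelope_diff(1)[symmetric] P P0 W) auto
    finally show "U x \<le> U y"
      unfolding U_def using ic[OF xy(1,2)] by simp
  qed
  show "rent P \<theta> \<le> ennreal (U \<theta> - U lo)"
    unfolding rent_def
  proof (rule nn_integral_lower_derivative_le)
    show "mono_on {lo..\<theta>} U"
      using \<theta> by (intro mono_on_subset[OF mono]) (auto simp: T_iff)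
    show "lo \<le> \<theta>" using \<theta> by (simp add: T_iff)
    show "AE x in lborel. lo < x \<longrightarrow> x < \<theta> \<longrightarrow>
      rent_rate P x \<le> liminf (\<lambda>n. ennreal ((U (x + 1 / Suc n) - U x) / (1 / Suc n)))"
    proof (rule eventually_mono[OF AE_G_deriv], intro impI)
      fix x assume "lo < x \<longrightarrow> x < hi \<longrightarrow> (AE v in lborel. ((\<lambda>x. G M x v) has_vector_derivative - D x v) (at x))"
        and x: "lo < x" "x < \<theta>"
      then have ae: "AE v in lborel. ((\<lambda>x. G M x v) has_vector_derivative - D x v) (at x)" and xT: "x \<in> T"
        using \<theta> by (auto simp: T_iff)
      define e where "e n = 1 / real (Suc n)" for n
      have e0: "0 < e n" for n by (simp add: e_def)
      have elim: "e \<longlonglongrightarrow> 0" unfolding e_def by (rule LIMSEQ_Suc[OF lim_const_over_n])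
      \<comment> \<open>Quotients from the right need \<open>x + e n\<close> to be a type, which
        holds for large \<open>n\<close>.\<close>
      have ev: "\<forall>\<^sub>F n in sequentially. x + e n \<in> T"
      proof (rule eventually_mono)
        show "\<forall>\<^sub>F n in sequentially. e n < \<theta> - x"
          using x by (intro order_tendstoD(2)[OF elim]) simp
        fix n assume "e n < \<theta> - x"
        then show "x + e n \<in> T" using x e0[of n] \<theta> by (auto simp: T_iff)
      qed
      \<comment> \<open>The report stays at \<open>x\<close>; only the true type moves to
        \<open>x + e n\<close>.\<close>
      let ?k = "\<lambda>n s. ennreal (P x s) * ennreal ((G M x s - G M (x + e n) s) / e n)"
      have "rent_rate P x \<le> (\<integral>\<^sup>+s. liminf (\<lambda>n. ?k n s) \<partial>lborel)"
        unfolding rent_rate_def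
      proof (rule nn_integral_mono_AE, rule eventually_mono[OF ae])
        fix s assume "((\<lambda>x. G M x s) has_vector_derivative - D x s) (at x)"
        then have "(\<lambda>h. (G M (x + h) s - G M x s) / h) \<midarrow>0\<rightarrow> - D x s"
          by (simp add: has_real_derivative_iff_has_vector_derivative[symmetric] DERIV_def)
        then have "(\<lambda>n. (G M (x + e n) s - G M x s) / e n) \<longlonglongrightarrow> - D x s"
          by (rule filterlim_compose) (use elim e0 in \<open>auto simp: filterlim_at less_imp_neq[symmetric]\<close>)
        from tendsto_minus[OF this] have "(\<lambda>n. (G M x s - G M (x + e n) s) / e n) \<longlonglongrightarrow> D x s"
          by (simp add: minus_divide_left)
        then have "(\<lambda>n. ?k n s) \<longlonglongrightarrow> ennreal (P x s) * ennreal (D x s)"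
          by (intro ennreal_tendsto_cmult tendsto_ennrealI) auto
        then show "ennreal (P x s) * ennreal (D x s) \<le> liminf (\<lambda>n. ?k n s)"
          by (simp add: lim_imp_Liminf)
      qed
      also have "\<dots> \<le> liminf (\<lambda>n. \<integral>\<^sup>+s. ?k n s \<partial>lborel)"
        by (rule nn_integral_liminf) measurable
      also have "\<dots> \<le> liminf (\<lambda>n. ennreal ((U (x + e n) - U x) / e n))"
      proof (rule Liminf_mono, rule eventually_mono[OF ev])
        fix n assume xe: "x + e n \<in> T"
        have "(\<integral>\<^sup>+s. ?k n s \<partial>lborel) = (\<integral>\<^sup>+s. ennreal (1 / e n) * (ennreal (P x s) * ennreal (G M x s - G M (x + e n) s)) \<partial>lborel)"
        proof (intro nn_integral_cong)
          fix s
          show "?k n s = ennreal (1 / e n) * (ennreal (P x s) * ennreal (G M x s - G M (x + e n) s))"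
            using G_antimono[OF xT xe, of s] e0[of n] P0[of x s] by (simp flip: ennreal_mult)
        qed
        also have "\<dots> = ennreal (1 / e n) * (\<integral>\<^sup>+s. ennreal (P x s) * ennreal (G M x s - G M (x + e n) s) \<partial>lborel)"
          by (rule nn_integral_cmult) measurable
        also have "\<dots> \<le> ennreal (1 / e n) * ennreal (U (x + e n) - U x)"
          using e0[of n] by (intro mult_left_mono incr xT xe) auto
        also have "\<dots> = ennreal ((U (x + e n) - U x) / e n)"
          using e0[of n] mono_onD[OF mono xT xe] by (simp flip: ennreal_mult)
        finally show "(\<integral>\<^sup>+s. ?k n s \<partial>lborel) \<le> ennreal ((U (x + e n) - U x) / e n)" .
      qed
      finally show "rent_rate P x \<le> liminf (\<lambda>n. ennreal ((U (x + 1 / Suc n) - U x) / (1 / Suc n)))"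
        by (simp add: e_def)
    qed
  qed
qed

end

section \<open>Profit as virtual surplus minus slack\<close>

text \<open>\<open>B - N\<close> is nonnegative, and its section integrals are at most those of
  \<open>B\<close> because the sections of \<open>N\<close> integrate to nonnegative numbers. This
  fits the buyer's utility, which individual rationality bounds from below only in expectation given
  the type.\<close>

lemma (in pair_sigma_finite) integrable_dominated_sections:
  fixes B N :: "'a \<times> 'b \<Rightarrow> real"
  assumes B: "integrable (M1 \<Otimes>\<^sub>M M2) B" and [measurable]: "N \<in> borel_measurable (M1 \<Otimes>\<^sub>M M2)"
    and le: "\<And>p. N p \<le> B p"
    and sec: "\<And>x. integrable M2 (\<lambda>y. N (x, y))" "\<And>x. 0 \<le> (LINT y|M2. N (x, y))"
  shows "integrable (M1 \<Otimes>\<^sub>M M2) N"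
proof -
  have [measurable]: "B \<in> borel_measurable (M1 \<Otimes>\<^sub>M M2)" using B by auto
  have "(\<integral>\<^sup>+p. ennreal (B p - N p) \<partial>(M1 \<Otimes>\<^sub>M M2)) = (\<integral>\<^sup>+x. \<integral>\<^sup>+y. ennreal (B (x, y) - N (x, y)) \<partial>M2 \<partial>M1)"
    by (rule M2.nn_integral_fst[symmetric]) measurable
  also have "\<dots> \<le> (\<integral>\<^sup>+x. ennreal (LINT y|M2. B (x, y)) \<partial>M1)"
  proof (rule nn_integral_mono_AE, rule eventually_mono[OF AE_integrable_fst'[OF B]])
    fix x assume i: "integrable M2 (\<lambda>y. B (x, y))"
    have "(\<integral>\<^sup>+y. ennreal (B (x, y) - N (x, y)) \<partial>M2) = ennreal (LINT y|M2. B (x, y) - N (x, y))"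
      using i sec(1)[of x] le by (intro nn_integral_eq_integral) auto
    also have "\<dots> \<le> ennreal (LINT y|M2. B (x, y))"
      using i sec[of x] by (intro ennreal_leI) simp
    finally show "(\<integral>\<^sup>+y. ennreal (B (x, y) - N (x, y)) \<partial>M2) \<le> ennreal (LINT y|M2. B (x, y))" .
  qed
  also have "\<dots> < \<infinity>"
    using integrable_fst'[OF B] by (simp add: real_integrable_def less_top)
  finally have "integrable (M1 \<Otimes>\<^sub>M M2) (\<lambda>p. B p - N p)"
    using le by (intro integrableI_nonneg) auto
  from Bochner_Integration.integrable_diff[OF B this] show ?thesis by simp
qed

context screening_environment begin

section \<open>Integration over types and values\<close>

definition joint_density :: "real \<times> real \<Rightarrow> real" where
  "joint_density p = f (fst p) * g (fst p) (snd p)"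

lemma joint_density_measurable [measurable]: "joint_density \<in> borel_measurable (borel \<Otimes>\<^sub>M borel)"
  unfolding joint_density_def by measurable

lemma joint_density_nonneg: "0 \<le> joint_density p"
  using g_nonneg[of "fst p" "snd p"] f_nonneg[of "fst p"] f_zero[of "fst p"]
  by (cases "fst p \<in> T") (auto simp: joint_density_def)

lemma joint_law_eq: "joint_law M = density (lborel \<Otimes>\<^sub>M lborel) (\<lambda>p. ennreal (joint_density p))"
  by (simp add: joint_law_def joint_density_def case_prod_beta')

lemma joint_integral:
  assumes [measurable]: "k \<in> borel_measurable (borel \<Otimes>\<^sub>M borel)"
  shows "integrable (joint_law M) k \<longleftrightarrow> integrable (lborel \<Otimes>\<^sub>M lborel) (\<lambda>p. joint_density p * k p)"
    and "(LINT p|joint_law M. k p) = (LINT p|(lborel \<Otimes>\<^sub>M lborel). joint_density p * k p)"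
proof -
  have nn: "AE p in (lborel \<Otimes>\<^sub>M lborel). 0 \<le> joint_density p" by (simp add: joint_density_nonneg)
  show "integrable (joint_law M) k \<longleftrightarrow> integrable (lborel \<Otimes>\<^sub>M lborel) (\<lambda>p. joint_density p * k p)"
    unfolding joint_law_eq by (subst integrable_density[OF _ _ nn]) auto
  show "(LINT p|joint_law M. k p) = (LINT p|(lborel \<Otimes>\<^sub>M lborel). joint_density p * k p)"
    unfolding joint_law_eq by (subst integral_density[OF _ _ nn]) auto
qed

lemma integrable_g: "\<theta> \<in> T \<Longrightarrow> integrable lborel (g \<theta>)"
  and integral_g: "\<theta> \<in> T \<Longrightarrow> (LINT v|lborel. g \<theta> v) = 1"
  using nn_integral_g[of \<theta>] g_nonneg[of \<theta>]
  by (auto intro!: integrableI_nonneg simp: integral_eq_nn_integral)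

lemma finite_joint_law: "integrable (joint_law M) (\<lambda>p. k :: real)"
proof -
  have "(\<integral>\<^sup>+p. ennreal (joint_density p) \<partial>(lborel \<Otimes>\<^sub>M lborel)) = (\<integral>\<^sup>+x. \<integral>\<^sup>+v. ennreal (joint_density (x, v)) \<partial>lborel \<partial>lborel)"
    by (rule lborel.nn_integral_fst[symmetric]) measurable
  also have "\<dots> = (\<integral>\<^sup>+x. ennreal (f x) \<partial>lborel)"
  proof (rule nn_integral_cong)
    fix x
    show "(\<integral>\<^sup>+v. ennreal (joint_density (x, v)) \<partial>lborel) = ennreal (f x)"
    proof (cases "x \<in> T")
      case True
      then have "(\<integral>\<^sup>+v. ennreal (joint_density (x, v)) \<partial>lborel) = (\<integral>\<^sup>+v. ennreal (f x) * ennreal (g x v) \<partial>lborel)"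
        by (intro nn_integral_cong) (auto simp: joint_density_def ennreal_mult f_nonneg g_nonneg)
      also have "\<dots> = ennreal (f x)"
        using True by (simp add: nn_integral_cmult nn_integral_g)
      finally show ?thesis .
    qed (simp add: joint_density_def f_zero)
  qed
  finally have "integrable (lborel \<Otimes>\<^sub>M lborel) joint_density"
    using nn_integral_f joint_density_nonneg by (intro integrableI_nonneg) auto
  then show ?thesis
    by (subst joint_integral) auto
qed

text \<open>Extension by zero turns measurability on the rectangle into Borel measurability on the
  plane, to which the results on product measures apply.\<close>

definition on_TV :: "(real \<Rightarrow> real \<Rightarrow> real) \<Rightarrow> real \<times> real \<Rightarrow> real" where
  "on_TV k p = indicator (T \<times> V) p * case_prod k p"

lemma on_TV_simps: "\<theta> \<in> T \<Longrightarrow> v \<in> V \<Longrightarrow> on_TV k (\<theta>, v) = k \<theta> v" "\<theta> \<notin> T \<Longrightarrow> on_TV k (\<theta>, v) = 0"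
    "v \<notin> V \<Longrightarrow> on_TV k (\<theta>, v) = 0"
  by (auto simp: on_TV_def)

lemma on_TV_measurable_iff:
  "case_prod k \<in> borel_measurable (restrict_space borel (T \<times> V)) \<longleftrightarrow> on_TV k \<in> borel_measurable (borel \<Otimes>\<^sub>M borel)"
  unfolding restrict_measurable_TV on_TV_def[abs_def] by (simp add: case_prod_beta')

lemma \<phi>_measurable [measurable]: "on_TV \<phi> \<in> borel_measurable (borel \<Otimes>\<^sub>M borel)"
  using virtual_value by (simp add: dynamic_virtual_value_def on_TV_measurable_iff[symmetric])

text \<open>Utility is linear in the value with slope \<open>q powr \<alpha>\<close>; the envelope
  formula and the rents see quantities only through this slope.\<close>

definition alloc :: "(real \<Rightarrow> real \<Rightarrow> real) \<Rightarrow> real \<Rightarrow> real \<Rightarrow> real" where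
  "alloc q x v = on_TV (\<lambda>x v. q x v powr \<alpha>) (x, v)"

lemma alloc_nonneg: "0 \<le> alloc q x v"
  by (auto simp: alloc_def on_TV_def indicator_def)

lemma alloc_eq: "x \<in> T \<Longrightarrow> v \<in> V \<Longrightarrow> alloc q x v = q x v powr \<alpha>"
  by (simp add: alloc_def on_TV_simps)

lemma alloc_zero: "v \<notin> V \<Longrightarrow> alloc q x v = 0" "x \<notin> T \<Longrightarrow> alloc q x v = 0"
  by (simp_all add: alloc_def on_TV_simps)

lemma alloc_measurable:
  assumes [measurable]: "on_TV q \<in> borel_measurable (borel \<Otimes>\<^sub>M borel)"
  shows "case_prod (alloc q) \<in> borel_measurable (borel \<Otimes>\<^sub>M borel)"
proof -
  have "case_prod (alloc q) = (\<lambda>p. indicator (T \<times> V) p * on_TV q p powr \<alpha>)"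
    by (auto simp: alloc_def on_TV_def indicator_def)
  moreover have "T \<times> V \<in> sets (borel \<Otimes>\<^sub>M borel)" by simp
  ultimately show ?thesis by (simp del: sets_pair_measure)
qed

definition virtual_surplus :: "(real \<Rightarrow> real \<Rightarrow> real) \<Rightarrow> real \<times> real \<Rightarrow> real" where
  "virtual_surplus q = on_TV (\<lambda>\<theta> v. \<phi> \<theta> v * q \<theta> v powr \<alpha> - c * q \<theta> v)"

lemma virtual_surplus_le:
  assumes "\<theta> \<in> T" "v \<in> V" "0 \<le> q \<theta> v"
  shows "virtual_surplus q (\<theta>, v) \<le> virtual_surplus (qstar M \<phi>) (\<theta>, v)"
    and "virtual_surplus q (\<theta>, v) = virtual_surplus (qstar M \<phi>) (\<theta>, v) \<Longrightarrow> q \<theta> v = qstar M \<phi> \<theta> v"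
  using virtual_surplus_maximizer[OF params assms(3), of "\<phi> \<theta> v"] assms
  by (auto simp: virtual_surplus_def qstar_def on_TV_simps)

text \<open>The virtual value is largest at the corner \<open>(hi, vhi)\<close>, and a larger
  virtual value can only raise the surplus, so a single maximum bounds it everywhere.\<close>

lemma virtual_surplus_bounded:
  obtains K where "0 \<le> K" "\<And>\<theta> v x. \<theta> \<in> T \<Longrightarrow> v \<in> V \<Longrightarrow> 0 \<le> x \<Longrightarrow> \<phi> \<theta> v * x powr \<alpha> - c * x \<le> K"
proof -
  define r where "r = max 0 (\<phi> hi vhi)"
  define y where "y = (\<alpha> / c * r * of_bool (0 \<le> r)) powr (1 / (1 - \<alpha>))"
  have max: "r * x powr \<alpha> - c * x \<le> r * y powr \<alpha> - c * y" if "0 \<le> x" for x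
    using virtual_surplus_maximizer(1)[OF params that, of r] by (simp add: y_def)
  show ?thesis
  proof (rule that[of "r * y powr \<alpha> - c * y"])
    show "0 \<le> r * y powr \<alpha> - c * y" using max[of 0] params by simp
    fix \<theta> v x :: real assume *: "\<theta> \<in> T" "v \<in> V" "0 \<le> x"
    have "\<phi> \<theta> v \<le> \<phi> \<theta> vhi" "\<phi> \<theta> vhi \<le> \<phi> hi vhi"
      using * by (auto intro!: \<phi>_mono_v \<phi>_mono_\<theta> simp: V_iff T_iff)
    then have "\<phi> \<theta> v \<le> r" by (simp add: r_def)
    then have "\<phi> \<theta> v * x powr \<alpha> \<le> r * x powr \<alpha>" by (intro mult_right_mono) auto
    then show "\<phi> \<theta> v * x powr \<alpha> - c * x \<le> r * y powr \<alpha> - c * y" using max[OF *(3)] by simp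
  qed
qed

lemma rent_rate_zero: "x < lo \<Longrightarrow> rent_rate P x = 0"
  by (simp add: rent_rate_def D_def)

text \<open>The rent rate at \<open>x\<close> is enjoyed by all types above \<open>x\<close>, of
  mass \<open>1 - F M x\<close>. Summing rates with this weight, or summing over \<theta> the rent
  accumulated up to \<theta>, evaluates the same double integral over
  \<open>x \<le> \<theta>\<close>.\<close>

lemma information_rent_total:
  assumes [measurable]: "on_TV q \<in> borel_measurable (borel \<Otimes>\<^sub>M borel)"
  shows "(\<integral>\<^sup>+p. ennreal (joint_density p * on_TV (\<lambda>\<theta> v. (v - \<phi> \<theta> v) * q \<theta> v powr \<alpha>) p) \<partial>(lborel \<Otimes>\<^sub>M lborel)) =
    (\<integral>\<^sup>+\<theta>. ennreal (f \<theta>) * rent (alloc q) \<theta> \<partial>lborel)"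
    and "on_TV (\<lambda>\<theta> v. (v - \<phi> \<theta> v) * q \<theta> v powr \<alpha>) \<in> borel_measurable (borel \<Otimes>\<^sub>M borel)"
    and "0 \<le> joint_density p * on_TV (\<lambda>\<theta> v. (v - \<phi> \<theta> v) * q \<theta> v powr \<alpha>) p"
proof -
  let ?Z = "on_TV (\<lambda>\<theta> v. (v - \<phi> \<theta> v) * q \<theta> v powr \<alpha>)"
  note [measurable] = alloc_measurable[OF assms]
  have Z_eq: "?Z = (\<lambda>p. (snd p - on_TV \<phi> p) * case_prod (alloc q) p)"
    by (auto simp: on_TV_def alloc_def indicator_def)
  show m[measurable]: "?Z \<in> borel_measurable (borel \<Otimes>\<^sub>M borel)"
    unfolding Z_eq by measurable
  \<comment> \<open>\<open>D\<close> is set to 0 at \<open>hi\<close>, a null set of types. At other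
    types the identity is pointwise, with both sides 0 off the support.\<close>
  have key: "joint_density (x, v) * ?Z (x, v) = (1 - F M x) * (alloc q x v * D x v)" if "x \<noteq> hi" for x v
  proof (cases "x \<in> T \<and> 0 < g x v")
    case True
    then have "x < hi" "v \<in> V" using that g_pos_V by (auto simp: T_iff)
    then have "joint_density (x, v) * ?Z (x, v) = f x * g x v * (v - \<phi> x v) * alloc q x v"
      using True by (simp add: joint_density_def on_TV_simps alloc_eq)
    also have "\<dots> = (1 - F M x) * D x v * alloc q x v"
      using True \<open>x < hi\<close> by (simp add: D_virtual_value)
    finally show ?thesis by simp
  next
    case False
    then have "joint_density (x, v) = 0"
      using f_zero[of x] g_nonneg[of x v] by (cases "x \<in> T") (auto simp: joint_density_def)
    moreover have "D x v = 0" using False by (auto simp: D_def T_iff)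
    ultimately show ?thesis by simp
  qed
  show "0 \<le> joint_density p * ?Z p"
  proof (cases "on_TV (\<lambda>_ _. 1) p = 0 \<or> \<not> 0 < g (fst p) (snd p)")
    case True
    then show ?thesis
      using g_nonneg[of "fst p" "snd p"] f_zero[of "fst p"]
      by (cases p; cases "fst p \<in> T") (auto simp: joint_density_def on_TV_def)
  next
    case False
    then have "fst p \<in> T" "snd p \<in> V" "0 < g (fst p) (snd p)"
      by (auto simp: on_TV_def indicator_def split: if_splits)
    then show ?thesis
      using \<phi>_le[of "fst p" "snd p"] joint_density_nonneg[of p]
      by (cases p) (auto simp: on_TV_simps intro!: mult_nonneg_nonneg)
  qed
  have "(\<integral>\<^sup>+p. ennreal (joint_density p * ?Z p) \<partial>(lborel \<Otimes>\<^sub>M lborel)) =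
      (\<integral>\<^sup>+x. \<integral>\<^sup>+v. ennreal (joint_density (x, v) * ?Z (x, v)) \<partial>lborel \<partial>lborel)"
    by (rule lborel.nn_integral_fst[symmetric]) measurable
  also have "\<dots> = (\<integral>\<^sup>+x. ennreal (1 - F M x) * rent_rate (alloc q) x \<partial>lborel)"
  proof (rule nn_integral_cong_AE, rule eventually_mono[OF AE_lborel_singleton[of hi]])
    fix x :: real assume "x \<noteq> hi"
    have "(\<integral>\<^sup>+v. ennreal (joint_density (x, v) * ?Z (x, v)) \<partial>lborel) =
        (\<integral>\<^sup>+v. ennreal (1 - F M x) * (ennreal (alloc q x v) * ennreal (D x v)) \<partial>lborel)"
      unfolding key[OF \<open>x \<noteq> hi\<close>]
      using F_le_1[of x] alloc_nonneg[of q x] D_nonneg[of x] by (simp add: ennreal_mult)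
    also have "\<dots> = ennreal (1 - F M x) * rent_rate (alloc q) x"
      unfolding rent_rate_def by (rule nn_integral_cmult) measurable
    finally show "(\<integral>\<^sup>+v. ennreal (joint_density (x, v) * ?Z (x, v)) \<partial>lborel) = ennreal (1 - F M x) * rent_rate (alloc q) x" .
  qed
  also have "\<dots> = (\<integral>\<^sup>+x. \<integral>\<^sup>+\<theta>. ennreal (f \<theta>) * indicator {x..} \<theta> * rent_rate (alloc q) x \<partial>lborel \<partial>lborel)"
    unfolding F_tail by (intro nn_integral_cong nn_integral_multc[symmetric]) measurable
  also have "\<dots> = (\<integral>\<^sup>+\<theta>. \<integral>\<^sup>+x. ennreal (f \<theta>) * indicator {x..} \<theta> * rent_rate (alloc q) x \<partial>lborel \<partial>lborel)"
  proof (rule lborel_pair.Fubini')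
    have "(\<lambda>p. ennreal (f (fst p)) * (if snd p \<le> fst p then 1 else 0) * rent_rate (alloc q) (snd p))
        \<in> borel_measurable (lborel \<Otimes>\<^sub>M lborel)"
      by measurable
    then show "(\<lambda>(\<theta>, x). ennreal (f \<theta>) * indicator {x..} \<theta> * rent_rate (alloc q) x) \<in> borel_measurable (lborel \<Otimes>\<^sub>M lborel)"
      by (simp add: case_prod_beta' indicator_def)
  qed
  also have "\<dots> = (\<integral>\<^sup>+\<theta>. ennreal (f \<theta>) * rent (alloc q) \<theta> \<partial>lborel)"
  proof (rule nn_integral_cong)
    fix \<theta>
    have "(\<integral>\<^sup>+x. ennreal (f \<theta>) * indicator {x..} \<theta> * rent_rate (alloc q) x \<partial>lborel) =
        (\<integral>\<^sup>+x. ennreal (f \<theta>) * (rent_rate (alloc q) x * indicator {lo..\<theta>} x) \<partial>lborel)"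
    proof (rule nn_integral_cong)
      fix x
      show "ennreal (f \<theta>) * indicator {x..} \<theta> * rent_rate (alloc q) x = ennreal (f \<theta>) * (rent_rate (alloc q) x * indicator {lo..\<theta>} x)"
        using rent_rate_zero[of x "alloc q"] by (cases "x < lo") (auto simp: indicator_def)
    qed
    also have "\<dots> = ennreal (f \<theta>) * rent (alloc q) \<theta>"
      unfolding rent_def by (rule nn_integral_cmult) measurable
    finally show "(\<integral>\<^sup>+x. ennreal (f \<theta>) * indicator {x..} \<theta> * rent_rate (alloc q) x \<partial>lborel) = ennreal (f \<theta>) * rent (alloc q) \<theta>" .
  qed
  finally show "(\<integral>\<^sup>+p. ennreal (joint_density p * ?Z p) \<partial>(lborel \<Otimes>\<^sub>M lborel)) =
    (\<integral>\<^sup>+\<theta>. ennreal (f \<theta>) * rent (alloc q) \<theta> \<partial>lborel)" .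
qed

abbreviation util :: "real \<Rightarrow> (real \<Rightarrow> real \<Rightarrow> real) \<Rightarrow> (real \<Rightarrow> real) \<Rightarrow> (real \<Rightarrow> real \<Rightarrow> real) \<Rightarrow> real \<Rightarrow> real \<Rightarrow> real" where
  "util \<gamma> q t0 t1 \<theta> v \<equiv> buyer_utility M \<gamma> v (q \<theta> v) (t0 \<theta>) (t1 \<theta> v)"

text \<open>Truthful reporting in period 1 says that the slope is a subgradient of ex post utility
  in the value; payments are absorbed into the utility at the reported value.\<close>

lemma feasible_envelope:
  assumes "feasible M \<gamma> q t0 t1" and \<theta>: "\<theta> \<in> T"
  shows "mono_on V (alloc q \<theta>)"
    and "\<And>v. v \<in> V \<Longrightarrow> util \<gamma> q t0 t1 \<theta> v = util \<gamma> q t0 t1 \<theta> vlo + (LINT s:{vlo..v}|lborel. alloc q \<theta> s)"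
proof -
  have sg: "util \<gamma> q t0 t1 \<theta> y + (x - y) * alloc q \<theta> y \<le> util \<gamma> q t0 t1 \<theta> x" if "x \<in> V" "y \<in> V" for x y
  proof -
    have "buyer_utility M \<gamma> x (q \<theta> y) (t0 \<theta>) (t1 \<theta> y) \<le> util \<gamma> q t0 t1 \<theta> x"
      using assms that by (simp add: feasible_def ic_period1_def)
    then show ?thesis
      using that \<theta> by (simp add: buyer_utility_def alloc_eq algebra_simps)
  qed
  then show "mono_on V (alloc q \<theta>)" by (rule subgradient_mono_on)
  show "util \<gamma> q t0 t1 \<theta> v = util \<gamma> q t0 t1 \<theta> vlo + (LINT s:{vlo..v}|lborel. alloc q \<theta> s)" if "v \<in> V" for v
    using that sg by (intro subgradient_integral[where b=vhi and U="util \<gamma> q t0 t1 \<theta>"]) (auto simp: Vals_def)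
qed

definition rent_value :: "(real \<Rightarrow> real \<Rightarrow> real) \<Rightarrow> real \<Rightarrow> real" where
  "rent_value q \<theta> = enn2real (rent (alloc q) \<theta>)"

text \<open>What the seller loses relative to the virtual surplus: utility left to the buyer in excess of the
  information rent, and the penalty on early payments.\<close>

definition slack :: "real \<Rightarrow> (real \<Rightarrow> real \<Rightarrow> real) \<Rightarrow> (real \<Rightarrow> real) \<Rightarrow> (real \<Rightarrow> real \<Rightarrow> real) \<Rightarrow> real \<Rightarrow> real" where
  "slack \<gamma> q t0 t1 \<theta> =
    interim_utility M \<gamma> q t0 t1 \<theta> \<theta> - rent_value q \<theta> + \<gamma> * (of_bool (0 \<le> t0 \<theta>) * t0 \<theta>)"

text \<open>Individual rationality of the lowest type turns the bound on the increment of utility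
  into a bound on its level. Finiteness of the rent is a by-product.\<close>

lemma feasible_rent:
  assumes feas: "feasible M \<gamma> q t0 t1" and \<theta>: "\<theta> \<in> T"
  shows "rent (alloc q) \<theta> \<le> ennreal (interim_utility M \<gamma> q t0 t1 \<theta> \<theta> - interim_utility M \<gamma> q t0 t1 lo lo)"
    and "rent (alloc q) \<theta> = ennreal (rent_value q \<theta>)" and "rent_value q \<theta> \<le> interim_utility M \<gamma> q t0 t1 \<theta> \<theta>"
    and "mono_on T (\<lambda>\<theta>. interim_utility M \<gamma> q t0 t1 \<theta> \<theta>)"
proof -
  have [measurable]: "on_TV q \<in> borel_measurable (borel \<Otimes>\<^sub>M borel)"
    using feas by (simp add: feasible_def on_TV_measurable_iff)
  have ic: "(LINT v:V|value_law M y. util \<gamma> q t0 t1 x v) \<le> (LINT v:V|value_law M y. util \<gamma> q t0 t1 y v)"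
    if "x \<in> T" "y \<in> T" for x y
    using feas that by (simp add: feasible_def ic_period0_def interim_utility_def)
  note le = rent_le[where P="alloc q" and W="util \<gamma> q t0 t1" and \<theta>=\<theta>,
      OF alloc_measurable alloc_nonneg alloc_zero(1) feasible_envelope(1)[OF feas] feasible_envelope(2)[OF feas] ic \<theta>]
  show mono: "mono_on T (\<lambda>\<theta>. interim_utility M \<gamma> q t0 t1 \<theta> \<theta>)"
    using le(1) by (simp add: interim_utility_def)
  show r: "rent (alloc q) \<theta> \<le> ennreal (interim_utility M \<gamma> q t0 t1 \<theta> \<theta> - interim_utility M \<gamma> q t0 t1 lo lo)"
    using le(2) by (simp add: interim_utility_def)
  then show eq: "rent (alloc q) \<theta> = ennreal (rent_value q \<theta>)"
    unfolding rent_value_def by (intro ennreal_enn2real[symmetric]) (auto intro: le_less_trans)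
  have "0 \<le> interim_utility M \<gamma> q t0 t1 lo lo"
    using feas by (simp add: feasible_def ind_rational_def)
  moreover have "interim_utility M \<gamma> q t0 t1 lo lo \<le> interim_utility M \<gamma> q t0 t1 \<theta> \<theta>"
    using \<theta> by (intro mono_onD[OF mono]) (auto simp: T_iff)
  moreover have "rent_value q \<theta> \<le> interim_utility M \<gamma> q t0 t1 \<theta> \<theta> - interim_utility M \<gamma> q t0 t1 lo lo"
    using r calculation(2) unfolding eq by (subst (asm) ennreal_le_iff) auto
  ultimately show "rent_value q \<theta> \<le> interim_utility M \<gamma> q t0 t1 \<theta> \<theta>" by simp
qed

lemma slack_nonneg: "feasible M \<gamma> q t0 t1 \<Longrightarrow> 0 \<le> \<gamma> \<Longrightarrow> \<theta> \<in> T \<Longrightarrow> 0 \<le> slack \<gamma> q t0 t1 \<theta>"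
  unfolding slack_def using feasible_rent(3)[of \<gamma> q t0 t1 \<theta>]
  by (intro add_nonneg_nonneg) auto

text \<open>With \<open>X\<close> the profit, \<open>Z\<close> the rent integrand and
  \<open>N\<close> the utility with the penalty added back, \<open>X + N\<close> is the full
  surplus, so the virtual surplus is \<open>Y = X - Z + N\<close>. Only \<open>X\<close> is
  integrable by assumption. Finite rents settle \<open>Z\<close>, and \<open>Y \<le> K\<close> then
  bounds \<open>N\<close> from above.\<close>

lemma feasible_profit:
  assumes feas: "feasible M \<gamma> q t0 t1" and \<gamma>: "0 \<le> \<gamma>"
  shows "integrable (joint_law M) (virtual_surplus q)"
    and "integrable lborel (\<lambda>\<theta>. f \<theta> * slack \<gamma> q t0 t1 \<theta>)"
    and "expected_profit M q t0 t1 = (LINT p|joint_law M. virtual_surplus q p) - (LINT \<theta>|lborel. f \<theta> * slack \<gamma> q t0 t1 \<theta>)"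
proof -
  define U where "U \<theta> = interim_utility M \<gamma> q t0 t1 \<theta> \<theta>" for \<theta>
  define e where "e \<theta> = \<gamma> * (of_bool (0 \<le> t0 \<theta>) * t0 \<theta>)" for \<theta>
  have e0: "0 \<le> e \<theta>" for \<theta> using \<gamma> by (simp add: e_def)
  have qm[measurable]: "on_TV q \<in> borel_measurable (borel \<Otimes>\<^sub>M borel)"
    using feas by (simp add: feasible_def on_TV_measurable_iff)
  note [measurable] = alloc_measurable[OF qm]
  define X where "X = on_TV (\<lambda>\<theta> v. t0 \<theta> + t1 \<theta> v - c * q \<theta> v)"
  define Z where "Z = on_TV (\<lambda>\<theta> v. (v - \<phi> \<theta> v) * q \<theta> v powr \<alpha>)"
  define N where "N = on_TV (\<lambda>\<theta> v. util \<gamma> q t0 t1 \<theta> v + e \<theta>)"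
  define Y where "Y = virtual_surplus q"
  have X_int: "integrable (joint_law M) X"
    using feas by (simp add: feasible_def set_integrable_def X_def on_TV_def[abs_def] case_prod_beta')
  have X_eq: "expected_profit M q t0 t1 = (LINT p|joint_law M. X p)"
    by (simp add: expected_profit_def set_lebesgue_integral_def X_def on_TV_def case_prod_beta')
  have [measurable]: "X \<in> borel_measurable (borel \<Otimes>\<^sub>M borel)"
    using borel_measurable_integrable[OF X_int] by (simp add: joint_law_eq)
  have Zm[measurable]: "Z \<in> borel_measurable (borel \<Otimes>\<^sub>M borel)"
    unfolding Z_def by (rule information_rent_total(2)[OF qm])
  have N_eq: "N p = snd p * case_prod (alloc q) p - X p - c * on_TV q p" for p
    by (cases p; cases "fst p \<in> T \<and> snd p \<in> V")
       (auto simp: N_def X_def on_TV_simps alloc_def e_def buyer_utility_def algebra_simps)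
  have Nm[measurable]: "N \<in> borel_measurable (borel \<Otimes>\<^sub>M borel)"
    unfolding N_eq[abs_def] by measurable
  have Y_eq: "Y p = X p - Z p + N p" for p
    unfolding N_eq Y_def
    by (cases p; cases "fst p \<in> T \<and> snd p \<in> V")
       (auto simp: virtual_surplus_def X_def Z_def on_TV_simps alloc_def algebra_simps)
  have U_bound: "rent (alloc q) \<theta> \<le> ennreal (U hi)" if "\<theta> \<in> T" for \<theta>
  proof -
    have "U \<theta> \<le> U hi"
      using mono_onD[OF feasible_rent(4)[OF feas that] that hi_T] that by (simp add: U_def T_iff)
    moreover have "0 \<le> U lo" using feas by (simp add: U_def feasible_def ind_rational_def)
    ultimately have "ennreal (U \<theta> - U lo) \<le> ennreal (U hi)" by (intro ennreal_leI) simp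
    then show ?thesis using feasible_rent(1)[OF feas that] unfolding U_def by (rule order_trans[rotated])
  qed
  have rent_nn: "ennreal (f \<theta>) * rent (alloc q) \<theta> = ennreal (f \<theta> * rent_value q \<theta>)" for \<theta>
    using feasible_rent(2)[OF feas, of \<theta>] f_zero[of \<theta>] f_nonneg[of \<theta>]
    by (cases "\<theta> \<in> T") (auto simp: ennreal_mult rent_value_def)
  have rent0: "0 \<le> f \<theta> * rent_value q \<theta>" for \<theta> using f_nonneg by (simp add: rent_value_def)
  have rent_fin: "(\<integral>\<^sup>+\<theta>. ennreal (f \<theta> * rent_value q \<theta>) \<partial>lborel) < \<infinity>"
  proof -
    have "(\<integral>\<^sup>+\<theta>. ennreal (f \<theta> * rent_value q \<theta>) \<partial>lborel) \<le> (\<integral>\<^sup>+\<theta>. ennreal (f \<theta>) * ennreal (U hi) \<partial>lborel)"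
      unfolding rent_nn[symmetric]
    proof (rule nn_integral_mono)
      fix \<theta> show "ennreal (f \<theta>) * rent (alloc q) \<theta> \<le> ennreal (f \<theta>) * ennreal (U hi)"
        using U_bound[of \<theta>] f_zero[of \<theta>] by (cases "\<theta> \<in> T") (auto intro: mult_left_mono)
    qed
    also have "\<dots> < \<infinity>" by (simp add: nn_integral_multc nn_integral_f)
    finally show ?thesis .
  qed
  have [measurable]: "(\<lambda>\<theta>. f \<theta> * rent_value q \<theta>) \<in> borel_measurable borel"
  proof -
    have "(\<lambda>(\<theta>, x). rent_rate (alloc q) x * (if lo \<le> x \<and> x \<le> \<theta> then 1 else 0)) \<in> borel_measurable (borel \<Otimes>\<^sub>M lborel)"
      by measurable
    then have "(\<lambda>(\<theta>, x). rent_rate (alloc q) x * indicator {lo..\<theta>} x) \<in> borel_measurable (borel \<Otimes>\<^sub>M lborel)"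
      by (simp add: indicator_def case_prod_beta')
    then have [measurable]: "rent (alloc q) \<in> borel_measurable borel"
      unfolding rent_def[abs_def] by measurable
    show ?thesis unfolding rent_value_def by measurable
  qed
  have R_int: "integrable lborel (\<lambda>\<theta>. f \<theta> * rent_value q \<theta>)"
    using rent_fin rent0 by (intro integrableI_nonneg) auto
  have Z_nn: "(\<integral>\<^sup>+p. ennreal (joint_density p * Z p) \<partial>(lborel \<Otimes>\<^sub>M lborel)) = (\<integral>\<^sup>+\<theta>. ennreal (f \<theta> * rent_value q \<theta>) \<partial>lborel)"
    unfolding Z_def information_rent_total(1)[OF qm] rent_nn ..
  have Z0: "0 \<le> joint_density p * Z p" for p
    unfolding Z_def by (rule information_rent_total(3)[OF qm])
  have Z_int: "integrable (lborel \<Otimes>\<^sub>M lborel) (\<lambda>p. joint_density p * Z p)"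
    using Z_nn rent_fin Z0 by (intro integrableI_nonneg) auto
  have Z_val: "(LINT p|(lborel \<Otimes>\<^sub>M lborel). joint_density p * Z p) = (LINT \<theta>|lborel. f \<theta> * rent_value q \<theta>)"
    using Z0 rent0 Z_nn by (simp add: integral_eq_nn_integral)
  obtain K where K: "0 \<le> K" "\<And>\<theta> v x. \<theta> \<in> T \<Longrightarrow> v \<in> V \<Longrightarrow> 0 \<le> x \<Longrightarrow> \<phi> \<theta> v * x powr \<alpha> - c * x \<le> K"
    using virtual_surplus_bounded by blast
  have YK: "Y p \<le> K" for p
    using feas K by (cases p; cases "fst p \<in> T \<and> snd p \<in> V")
      (auto simp: Y_def virtual_surplus_def on_TV_simps feasible_def)
  have X_int': "integrable (lborel \<Otimes>\<^sub>M lborel) (\<lambda>p. joint_density p * X p)"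
    using X_int by (simp add: joint_integral)
  have one_int: "integrable (lborel \<Otimes>\<^sub>M lborel) (\<lambda>p. joint_density p * K)"
    using finite_joint_law[of K] by (simp add: joint_integral)
  \<comment> \<open>The section integral is the interim utility of \<theta> plus its penalty,
    weighted by \<open>f\<close>; individual rationality makes it nonnegative.\<close>
  have sect: "integrable lborel (\<lambda>v. joint_density (\<theta>, v) * N (\<theta>, v)) \<and>
      (LINT v|lborel. joint_density (\<theta>, v) * N (\<theta>, v)) = f \<theta> * (U \<theta> + e \<theta>)" for \<theta>
  proof (cases "\<theta> \<in> T")
    case True
    note env = expected_envelope[where P="alloc q \<theta>" and W="util \<gamma> q t0 t1 \<theta>",
        OF True feasible_envelope(1)[OF feas True] alloc_nonneg feasible_envelope(2)[OF feas True]]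
    have i: "integrable lborel (\<lambda>v. g \<theta> v * (indicator V v * util \<gamma> q t0 t1 \<theta> v))"
      using env(2) value_law_integrable_iff(1)[OF True env(1)] by simp
    have l: "(LINT v|lborel. g \<theta> v * (indicator V v * util \<gamma> q t0 t1 \<theta> v)) = U \<theta>"
      using value_law_integrable_iff(2)[OF True env(1)] by (simp add: U_def interim_utility_def)
    have eq: "joint_density (\<theta>, v) * N (\<theta>, v) =
        f \<theta> * (g \<theta> v * (indicator V v * util \<gamma> q t0 t1 \<theta> v)) + f \<theta> * (e \<theta> * g \<theta> v)" for v
      using True g_zero[OF True, of v]
      by (cases "v \<in> V") (auto simp: joint_density_def N_def on_TV_simps algebra_simps)
    show ?thesis
      unfolding eq using i l integrable_g[OF True] integral_g[OF True] by (auto simp: algebra_simps)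
  qed (simp add: joint_density_def f_zero)
  have N_int: "integrable (lborel \<Otimes>\<^sub>M lborel) (\<lambda>p. joint_density p * N p)"
  proof (rule lborel_pair.integrable_dominated_sections)
    show "integrable (lborel \<Otimes>\<^sub>M lborel) (\<lambda>p. joint_density p * K - joint_density p * X p + joint_density p * Z p)"
      using one_int X_int' Z_int by auto
    show "(\<lambda>p. joint_density p * N p) \<in> borel_measurable (lborel \<Otimes>\<^sub>M lborel)" by measurable
    show "joint_density p * N p \<le> joint_density p * K - joint_density p * X p + joint_density p * Z p" for p
    proof -
      have "joint_density p * N p \<le> joint_density p * (K - X p + Z p)"
        using Y_eq[of p] YK[of p] joint_density_nonneg by (intro mult_left_mono) auto
      then show ?thesis by (simp add: algebra_simps)
    qed
    show "integrable lborel (\<lambda>v. joint_density (\<theta>, v) * N (\<theta>, v))" for \<theta> using sect by blast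
    show "0 \<le> (LINT v|lborel. joint_density (\<theta>, v) * N (\<theta>, v))" for \<theta>
    proof (cases "\<theta> \<in> T")
      case True
      then have "0 \<le> U \<theta>" using feas by (simp add: U_def feasible_def ind_rational_def)
      then show ?thesis using sect[of \<theta>] e0[of \<theta>] f_nonneg[of \<theta>] by simp
    qed (use sect[of \<theta>] f_zero in simp)
  qed
  have N_val: "(LINT p|(lborel \<Otimes>\<^sub>M lborel). joint_density p * N p) = (LINT \<theta>|lborel. f \<theta> * (U \<theta> + e \<theta>))"
    using lborel_pair.integral_fst'[OF N_int] sect by simp
  have Ue_int: "integrable lborel (\<lambda>\<theta>. f \<theta> * (U \<theta> + e \<theta>))"
    using lborel_pair.integrable_fst'[OF N_int] sect by simp
  have Ym[measurable]: "Y \<in> borel_measurable (borel \<Otimes>\<^sub>M borel)"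
    unfolding Y_eq[abs_def] by measurable
  have dY: "joint_density p * Y p = joint_density p * X p - joint_density p * Z p + joint_density p * N p" for p
    by (simp add: Y_eq algebra_simps)
  show "integrable (joint_law M) (virtual_surplus q)"
    unfolding Y_def[symmetric] joint_integral(1)[OF Ym] dY using X_int' Z_int N_int by auto
  have slack_eq: "f \<theta> * slack \<gamma> q t0 t1 \<theta> = f \<theta> * (U \<theta> + e \<theta>) - f \<theta> * rent_value q \<theta>" for \<theta>
    by (simp add: slack_def U_def e_def algebra_simps)
  show "integrable lborel (\<lambda>\<theta>. f \<theta> * slack \<gamma> q t0 t1 \<theta>)"
    unfolding slack_eq using Ue_int R_int by auto
  have "(LINT p|joint_law M. Y p) = (LINT p|joint_law M. X p) - (LINT \<theta>|lborel. f \<theta> * rent_value q \<theta>)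
      + (LINT \<theta>|lborel. f \<theta> * (U \<theta> + e \<theta>))"
    unfolding joint_integral(2)[OF Ym] dY using X_int' Z_int N_int Z_val N_val by (simp add: joint_integral)
  then show "expected_profit M q t0 t1 = (LINT p|joint_law M. virtual_surplus q p) - (LINT \<theta>|lborel. f \<theta> * slack \<gamma> q t0 t1 \<theta>)"
    unfolding slack_eq X_eq Y_def[symmetric] using Ue_int R_int by simp
qed

end

section \<open>The optimal mechanism\<close>

lemma integral_lborel_cong_countable:
  fixes k1 k2 :: "real \<Rightarrow> real"
  assumes k2: "k2 \<in> borel_measurable borel" and C: "countable C" and eq: "\<And>x. x \<notin> C \<Longrightarrow> k1 x = k2 x"
  shows "(LINT x|lborel. k1 x) = (LINT x|lborel. k2 x)"
proof (rule integral_cong_AE)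
  show "k2 \<in> borel_measurable lborel" using k2 by simp
  then show "k1 \<in> borel_measurable lborel"
    by (rule measurable_discrete_difference[where X=C]) (use C eq in auto)
  show "AE x in lborel. k1 x = k2 x"
    using AE_lborel_countable[OF C] by (rule eventually_mono) (rule eq)
qed

text \<open>Passing to a measurable null set that contains the failures of \<open>Q\<close> makes
  the criterion by sections applicable.\<close>

lemma AE_lborel_fst:
  assumes "AE x in lborel. Q (x :: real)"
  shows "AE p in (lborel \<Otimes>\<^sub>M (lborel :: real measure)). Q (fst p)"
proof -
  obtain N where N: "{x \<in> space lborel. \<not> Q x} \<subseteq> N" "emeasure lborel N = 0" "N \<in> sets lborel"
    using assms by (rule AE_E)
  have "AE p in (lborel \<Otimes>\<^sub>M (lborel :: real measure)). fst p \<notin> N"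
  proof (rule lborel_pair.AE_pair_measure)
    show "{p \<in> space (lborel \<Otimes>\<^sub>M (lborel :: real measure)). fst p \<notin> N} \<in> sets (lborel \<Otimes>\<^sub>M lborel)"
      using N(3) by measurable
    have "AE x in lborel. x \<notin> N"
      using N by (intro AE_not_in) auto
    then show "AE x in lborel. AE y in (lborel :: real measure). fst (x, y) \<notin> N"
      by (rule eventually_mono) simp
  qed
  then show ?thesis
    by (rule eventually_mono) (use N(1) in auto)
qed

context screening_environment begin

section \<open>Quantities and rents of the candidate mechanism\<close>

abbreviation "qs \<equiv> qstar M \<phi>"
abbreviation "A \<equiv> alloc qs"

lemma qstar_nonneg: "0 \<le> qs \<theta> v"
  by (simp add: qstar_def)

lemma qstar_mono: assumes "\<phi> \<theta> v \<le> \<phi> \<theta>' v'" shows "qs \<theta> v \<le> qs \<theta>' v'"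
  unfolding qstar_def
proof (rule powr_mono2)
  show "\<alpha> / c * \<phi> \<theta> v * of_bool (0 \<le> \<phi> \<theta> v) \<le> \<alpha> / c * \<phi> \<theta>' v' * of_bool (0 \<le> \<phi> \<theta>' v')"
    using assms params by (auto simp: divide_right_mono)
qed (use params in auto)

lemma qstar_powr_mono: "\<phi> \<theta> v \<le> \<phi> \<theta>' v' \<Longrightarrow> qs \<theta> v powr \<alpha> \<le> qs \<theta>' v' powr \<alpha>"
  using params by (intro powr_mono2 qstar_mono qstar_nonneg) auto

lemma qstar_zero: "\<phi> \<theta> v \<le> 0 \<Longrightarrow> qs \<theta> v = 0"
  by (auto simp: qstar_def)

lemma qstar_measurable [measurable]: "on_TV qs \<in> borel_measurable (borel \<Otimes>\<^sub>M borel)"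
proof -
  have [measurable]: "T \<times> V \<in> sets (borel \<Otimes>\<^sub>M borel)" by simp
  have "on_TV qs = (\<lambda>p. indicator (T \<times> V) p *
      (\<alpha> / c * on_TV \<phi> p * (if 0 \<le> on_TV \<phi> p then 1 else 0)) powr (1 / (1 - \<alpha>)))"
    by (auto simp: on_TV_def qstar_def indicator_def)
  then show ?thesis by (simp del: sets_pair_measure)
qed

lemma A_measurable [measurable]: "case_prod A \<in> borel_measurable (borel \<Otimes>\<^sub>M borel)"
  by (rule alloc_measurable) measurable

lemma A_mono_v: "\<theta> \<in> T \<Longrightarrow> mono_on V (A \<theta>)"
  by (rule mono_onI) (simp add: alloc_eq qstar_powr_mono \<phi>_mono_v)

lemma A_mono_\<theta>: "x \<in> T \<Longrightarrow> y \<in> T \<Longrightarrow> x \<le> y \<Longrightarrow> A x s \<le> A y s"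
  by (cases "s \<in> V") (simp_all add: alloc_eq alloc_zero qstar_powr_mono \<phi>_mono_\<theta>)

lemma A_le: "A x s \<le> A hi vhi"
proof (cases "x \<in> T \<and> s \<in> V")
  case True
  then have "\<phi> x s \<le> \<phi> x vhi" "\<phi> x vhi \<le> \<phi> hi vhi"
    by (auto intro!: \<phi>_mono_v \<phi>_mono_\<theta> simp: V_iff T_iff)
  then show ?thesis using True by (simp add: alloc_eq qstar_powr_mono)
next
  case False
  then have "A x s = 0" using alloc_zero by blast
  then show ?thesis by (simp add: alloc_nonneg)
qed

text \<open>Once quantities do not depend on the type, Tonelli integrates \<open>D\<close> over
  types first, and the result is the gain of \<open>\<theta>\<close> over \<open>\<theta>'\<close>
  from one and the same menu.\<close>

lemma rent_frozen:
  fixes B :: "real \<Rightarrow> real"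
  assumes [measurable]: "B \<in> borel_measurable borel" and \<theta>: "\<theta>' \<in> T" "\<theta> \<in> T" "\<theta>' \<le> \<theta>"
  shows "(\<integral>\<^sup>+x. (\<integral>\<^sup>+s. ennreal (B s) * ennreal (D x s) \<partial>lborel) * indicator {\<theta>'..\<theta>} x \<partial>lborel) =
    (\<integral>\<^sup>+s. ennreal (B s) * ennreal (G M \<theta>' s - G M \<theta> s) \<partial>lborel)"
proof -
  have "(\<integral>\<^sup>+x. (\<integral>\<^sup>+s. ennreal (B s) * ennreal (D x s) \<partial>lborel) * indicator {\<theta>'..\<theta>} x \<partial>lborel) =
      (\<integral>\<^sup>+x. \<integral>\<^sup>+s. ennreal (B s) * (ennreal (D x s) * indicator {\<theta>'..\<theta>} x) \<partial>lborel \<partial>lborel)"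
  proof (rule nn_integral_cong)
    fix x
    have "(\<integral>\<^sup>+s. ennreal (B s) * ennreal (D x s) * indicator {\<theta>'..\<theta>} x \<partial>lborel) =
        (\<integral>\<^sup>+s. ennreal (B s) * ennreal (D x s) \<partial>lborel) * indicator {\<theta>'..\<theta>} x"
      by (rule nn_integral_multc) measurable
    then show "(\<integral>\<^sup>+s. ennreal (B s) * ennreal (D x s) \<partial>lborel) * indicator {\<theta>'..\<theta>} x =
        (\<integral>\<^sup>+s. ennreal (B s) * (ennreal (D x s) * indicator {\<theta>'..\<theta>} x) \<partial>lborel)"
      by (simp add: mult.assoc)
  qed
  also have "\<dots> = (\<integral>\<^sup>+s. \<integral>\<^sup>+x. ennreal (B s) * (ennreal (D x s) * indicator {\<theta>'..\<theta>} x) \<partial>lborel \<partial>lborel)"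
    by (rule lborel_pair.Fubini') measurable
  also have "\<dots> = (\<integral>\<^sup>+s. ennreal (B s) * ennreal (G M \<theta>' s - G M \<theta> s) \<partial>lborel)"
  proof (rule nn_integral_cong)
    fix s
    have "(\<integral>\<^sup>+x. ennreal (B s) * (ennreal (D x s) * indicator {\<theta>'..\<theta>} x) \<partial>lborel) =
        ennreal (B s) * (\<integral>\<^sup>+x. ennreal (D x s) * indicator {\<theta>'..\<theta>} x \<partial>lborel)"
      by (rule nn_integral_cmult) measurable
    then show "(\<integral>\<^sup>+x. ennreal (B s) * (ennreal (D x s) * indicator {\<theta>'..\<theta>} x) \<partial>lborel) =
        ennreal (B s) * ennreal (G M \<theta>' s - G M \<theta> s)"
      by (simp add: D_nn_integral[OF \<theta>])
  qed
  finally show ?thesis .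
qed

lemma rent_split:
  assumes [measurable]: "case_prod P \<in> borel_measurable (borel \<Otimes>\<^sub>M borel)" and le: "lo \<le> \<theta>'" "\<theta>' \<le> \<theta>"
  shows "rent P \<theta> = rent P \<theta>' + (\<integral>\<^sup>+x. rent_rate P x * indicator {\<theta>'..\<theta>} x \<partial>lborel)"
proof -
  have "rent P \<theta> = (\<integral>\<^sup>+x. rent_rate P x * indicator {lo..\<theta>'} x + rent_rate P x * indicator {\<theta>'..\<theta>} x \<partial>lborel)"
    unfolding rent_def
  proof (rule nn_integral_cong_AE, rule eventually_mono[OF AE_lborel_singleton[of \<theta>']])
    fix x assume "x \<noteq> \<theta>'"
    then show "rent_rate P x * indicator {lo..\<theta>} x = rent_rate P x * indicator {lo..\<theta>'} x + rent_rate P x * indicator {\<theta>'..\<theta>} x"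
      using le by (auto simp: indicator_def)
  qed
  also have "\<dots> = rent P \<theta>' + (\<integral>\<^sup>+x. rent_rate P x * indicator {\<theta>'..\<theta>} x \<partial>lborel)"
    unfolding rent_def by (rule nn_integral_add) measurable
  finally show ?thesis .
qed

text \<open>Quantities increase with the type, so freezing them at either end bounds the accumulated
  rent from below or above. The two inequalities are truthful reporting in period 0, against
  understating and against overstating the type.\<close>

lemma star_rent_bounds:
  assumes \<theta>: "\<theta>' \<in> T" "\<theta> \<in> T" "\<theta>' \<le> \<theta>"
  shows "(\<integral>\<^sup>+s. ennreal (A \<theta>' s) * ennreal (G M \<theta>' s - G M \<theta> s) \<partial>lborel) \<le> (\<integral>\<^sup>+x. rent_rate A x * indicator {\<theta>'..\<theta>} x \<partial>lborel)"
    and "(\<integral>\<^sup>+x. rent_rate A x * indicator {\<theta>'..\<theta>} x \<partial>lborel) \<le> (\<integral>\<^sup>+s. ennreal (A \<theta> s) * ennreal (G M \<theta>' s - G M \<theta> s) \<partial>lborel)"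
proof -
  have m: "A x \<in> borel_measurable borel" for x by measurable
  have T: "x \<in> T" if "x \<in> {\<theta>'..\<theta>}" for x using that \<theta> by (auto simp: T_iff)
  show "(\<integral>\<^sup>+s. ennreal (A \<theta>' s) * ennreal (G M \<theta>' s - G M \<theta> s) \<partial>lborel) \<le> (\<integral>\<^sup>+x. rent_rate A x * indicator {\<theta>'..\<theta>} x \<partial>lborel)"
    unfolding rent_frozen[OF m \<theta>, symmetric] rent_rate_def
    using A_mono_\<theta>[OF \<theta>(1) T] by (intro nn_integral_mono) (auto simp: indicator_def intro!: nn_integral_mono mult_right_mono ennreal_leI)
  show "(\<integral>\<^sup>+x. rent_rate A x * indicator {\<theta>'..\<theta>} x \<partial>lborel) \<le> (\<integral>\<^sup>+s. ennreal (A \<theta> s) * ennreal (G M \<theta>' s - G M \<theta> s) \<partial>lborel)"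
    unfolding rent_frozen[OF m \<theta>, symmetric] rent_rate_def
    using A_mono_\<theta>[OF T \<theta>(2)] by (intro nn_integral_mono) (auto simp: indicator_def intro!: nn_integral_mono mult_right_mono ennreal_leI)
qed

lemma star_rent_finite: assumes "\<theta> \<in> T" shows "rent A \<theta> < \<infinity>"
proof -
  have "rent A \<theta> \<le> (\<integral>\<^sup>+s. ennreal (A \<theta> s) * ennreal (G M lo s - G M \<theta> s) \<partial>lborel)"
    using star_rent_bounds(2)[OF lo_T assms] assms by (simp add: rent_def T_iff)
  also have "\<dots> \<le> (\<integral>\<^sup>+s. ennreal (A hi vhi) * indicator V s \<partial>lborel)"
  proof (rule nn_integral_mono)
    fix s
    show "ennreal (A \<theta> s) * ennreal (G M lo s - G M \<theta> s) \<le> ennreal (A hi vhi) * indicator V s"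
    proof (cases "s \<in> V")
      case True
      have "A \<theta> s * (G M lo s - G M \<theta> s) \<le> A hi vhi * 1"
        using G_bounds[OF lo_T, of s] G_bounds[OF assms, of s] alloc_nonneg[of qs]
        by (intro mult_mono A_le) (auto simp: G_antimono[OF lo_T assms] assms[unfolded T_iff])
      then show ?thesis
        using True alloc_nonneg[of qs \<theta> s] by (simp add: ennreal_mult'[symmetric] ennreal_leI)
    qed (simp add: alloc_zero)
  qed
  also have "\<dots> < \<infinity>"
    using vlo_less_vhi by (simp add: nn_integral_cmult_indicator Vals_def ennreal_mult_less_top)
  finally show ?thesis .
qed

lemma star_rent_value: "\<theta> \<in> T \<Longrightarrow> rent A \<theta> = ennreal (rent_value qs \<theta>)"
  unfolding rent_value_def using star_rent_finite[of \<theta>] by (intro ennreal_enn2real[symmetric]) auto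

lemma star_rent_value_diff:
  assumes \<theta>: "\<theta>' \<in> T" "\<theta> \<in> T" "\<theta>' \<le> \<theta>"
  shows "rent_value qs \<theta>' \<le> rent_value qs \<theta>"
    and "ennreal (rent_value qs \<theta> - rent_value qs \<theta>') = (\<integral>\<^sup>+x. rent_rate A x * indicator {\<theta>'..\<theta>} x \<partial>lborel)"
proof -
  have eq: "ennreal (rent_value qs \<theta>) = ennreal (rent_value qs \<theta>') + (\<integral>\<^sup>+x. rent_rate A x * indicator {\<theta>'..\<theta>} x \<partial>lborel)"
    using rent_split[OF A_measurable, of \<theta>' \<theta>] \<theta> by (simp add: star_rent_value T_iff)
  have nn: "0 \<le> rent_value qs \<theta>'" "0 \<le> rent_value qs \<theta>" by (simp_all add: rent_value_def)
  have "ennreal (rent_value qs \<theta>') \<le> ennreal (rent_value qs \<theta>)" unfolding eq by simp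
  then show "rent_value qs \<theta>' \<le> rent_value qs \<theta>" using nn by simp
  show "ennreal (rent_value qs \<theta> - rent_value qs \<theta>') = (\<integral>\<^sup>+x. rent_rate A x * indicator {\<theta>'..\<theta>} x \<partial>lborel)"
    using eq nn by (simp add: ennreal_minus[symmetric])
qed

text \<open>Links the signed integral that normalizes \<open>u\<close> to the rent in
  \<open>ennreal\<close>. \<open>dG\<close> and \<open>- D\<close> differ only at countably many
  types and, at any other type, at finitely many values.\<close>

lemma rent_value_dG:
  assumes \<theta>: "\<theta> \<in> T"
  shows "- (LINT x:{lo..\<theta>}|lborel. LINT v:V|lborel. qs x v powr \<alpha> * dG M x v) = rent_value qs \<theta>"
proof (rule dG_eq)
  fix C assume C: "countable C" and fin: "\<And>x. x \<in> T \<Longrightarrow> x \<notin> C \<Longrightarrow> finite {v. dG M x v \<noteq> - D x v}"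
  have inner: "(LINT v:V|lborel. qs x v powr \<alpha> * dG M x v) = - enn2real (rent_rate A x)" if x: "x \<in> T" "x \<notin> C" for x
  proof -
    have "(LINT v:V|lborel. qs x v powr \<alpha> * dG M x v) = (LINT v|lborel. - (A x v * D x v))"
      unfolding set_lebesgue_integral_def
    proof (rule integral_lborel_cong_countable)
      show "(\<lambda>v. - (A x v * D x v)) \<in> borel_measurable borel" by measurable
      show "countable {v. dG M x v \<noteq> - D x v}" using fin[OF x] by (rule countable_finite)
      show "indicator V v *\<^sub>R (qs x v powr \<alpha> * dG M x v) = - (A x v * D x v)" if "v \<notin> {v. dG M x v \<noteq> - D x v}" for v
        using that x by (cases "v \<in> V") (auto simp: alloc_eq alloc_zero)
    qed
    also have "\<dots> = - (LINT v|lborel. A x v * D x v)" by simp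
    \<comment> \<open>At a type with infinite rate both sides are 0, the Bochner integral by default
      and \<open>enn2real\<close> by convention.\<close>
    also have "(LINT v|lborel. A x v * D x v) = enn2real (rent_rate A x)"
      unfolding rent_rate_def
      using alloc_nonneg[of qs x] D_nonneg[of x] by (subst integral_eq_nn_integral) (auto simp: ennreal_mult)
    finally show ?thesis .
  qed
  have "(LINT x:{lo..\<theta>}|lborel. LINT v:V|lborel. qs x v powr \<alpha> * dG M x v) =
      (LINT x|lborel. - (enn2real (rent_rate A x) * indicator {lo..\<theta>} x))"
    unfolding set_lebesgue_integral_def[of lborel "{lo..\<theta>}"]
  proof (rule integral_lborel_cong_countable[OF _ C])
    show "(\<lambda>x. - (enn2real (rent_rate A x) * indicator {lo..\<theta>} x)) \<in> borel_measurable borel" by measurable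
    show "indicator {lo..\<theta>} x *\<^sub>R (LINT v:V|lborel. qs x v powr \<alpha> * dG M x v) =
        - (enn2real (rent_rate A x) * indicator {lo..\<theta>} x)" if "x \<notin> C" for x
      using inner[of x] that \<theta> by (cases "x \<in> {lo..\<theta>}") (auto simp: T_iff)
  qed
  also have "\<dots> = - (LINT x|lborel. enn2real (rent_rate A x) * indicator {lo..\<theta>} x)" by simp
  also have "(LINT x|lborel. enn2real (rent_rate A x) * indicator {lo..\<theta>} x) = rent_value qs \<theta>"
  proof -
    \<comment> \<open>A finite rent forces a finite rate almost everywhere, so
      \<open>enn2real\<close> loses nothing under the integral.\<close>
    have "AE x in lborel. rent_rate A x * indicator {lo..\<theta>} x \<noteq> \<infinity>"
      using star_rent_finite[OF \<theta>] unfolding rent_def by (intro nn_integral_noteq_infinite) auto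
    then have "(\<integral>\<^sup>+x. ennreal (enn2real (rent_rate A x) * indicator {lo..\<theta>} x) \<partial>lborel) = rent A \<theta>"
      unfolding rent_def
      by (intro nn_integral_cong_AE) (auto elim!: eventually_mono simp: indicator_def top.not_eq_extremum)
    then show ?thesis
      unfolding rent_value_def by (subst integral_eq_nn_integral) auto
  qed
  finally show ?thesis by simp
qed

end

locale optimal_mechanism = screening_environment +
  fixes u :: "real \<Rightarrow> real \<Rightarrow> real" and \<gamma> :: real
  assumes ex_post: "ex_post_utility M \<phi> u" and \<gamma>: "0 < \<gamma>"
begin

section \<open>Feasibility, optimality and uniqueness of the candidate\<close>

abbreviation "ts \<equiv> tstar M \<phi> u"

lemma u_envelope:
  assumes "\<theta> \<in> T" "v \<in> V"
  shows "u \<theta> v = u \<theta> vlo + (LINT s:{vlo..v}|lborel. A \<theta> s)"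
proof -
  have "(LINT s:{vlo..v}|lborel. qs \<theta> s powr \<alpha>) = (LINT s:{vlo..v}|lborel. A \<theta> s)"
    using assms by (intro set_lebesgue_integral_cong) (auto simp: alloc_eq V_iff)
  moreover have "u \<theta> v = u \<theta> vlo + (LINT s:{vlo..v}|lborel. qs \<theta> s powr \<alpha>)"
    using ex_post assms unfolding ex_post_utility_def by blast
  ultimately show ?thesis by simp
qed

lemma util_star: "util \<gamma> qs (\<lambda>_. 0) ts \<theta> v = u \<theta> v"
  by (simp add: buyer_utility_def tstar_def)

lemma expected_u: assumes "\<theta> \<in> T" shows "(LINT v:V|value_law M \<theta>. u \<theta> v) = rent_value qs \<theta>"
proof -
  have "(LINT v:V|value_law M \<theta>. u \<theta> v) =
      - (LINT x:{lo..\<theta>}|lborel. LINT v:V|lborel. qs x v powr \<alpha> * dG M x v)"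
    using ex_post assms unfolding ex_post_utility_def by blast
  then show ?thesis by (simp add: rent_value_dG[OF assms])
qed

lemma u_kernel:
  assumes "\<theta> \<in> T" "v \<in> V"
  shows "u \<theta> v = rent_value qs \<theta> + (LINT s:V|lborel. A \<theta> s * (G M \<theta> s - indicator {v<..} s))"
  using envelope_kernel[where P="A \<theta>" and W="u \<theta>", OF assms(1) A_mono_v[OF assms(1)] alloc_nonneg u_envelope[OF assms(1)] assms(2)]
    expected_u[OF assms(1)] by simp

text \<open>The equations that define \<open>u\<close> treat each type separately and do not state
  joint measurability. The kernel formula exhibits \<open>u\<close> as the rent plus a parameter
  integral with jointly measurable integrand.\<close>

lemma u_measurable [measurable]: "on_TV u \<in> borel_measurable (borel \<Otimes>\<^sub>M borel)"
proof -
  have "(\<lambda>(\<theta>, x). rent_rate A x * (if lo \<le> x \<and> x \<le> \<theta> then 1 else 0)) \<in> borel_measurable (borel \<Otimes>\<^sub>M lborel)"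
    by measurable
  then have "(\<lambda>(\<theta>, x). rent_rate A x * indicator {lo..\<theta>} x) \<in> borel_measurable (borel \<Otimes>\<^sub>M lborel)"
    by (simp add: indicator_def case_prod_beta')
  then have [measurable]: "rent A \<in> borel_measurable borel"
    unfolding rent_def[abs_def] by measurable
  have [measurable]: "rent_value qs \<in> borel_measurable borel"
    unfolding rent_value_def[abs_def] by measurable
  have [measurable]: "T \<times> V \<in> sets (borel \<Otimes>\<^sub>M borel)" by simp
  have "on_TV u p = indicator (T \<times> V) p * (rent_value qs (fst p) +
      (LINT s|lborel. A (fst p) s * (G M (fst p) s - (if snd p < s then 1 else 0))))" for p
  proof (cases "fst p \<in> T \<and> snd p \<in> V")
    case True
    have "(LINT s:V|lborel. A (fst p) s * (G M (fst p) s - indicator {snd p<..} s)) =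
        (LINT s|lborel. A (fst p) s * (G M (fst p) s - (if snd p < s then 1 else 0)))"
      unfolding set_lebesgue_integral_def
      by (intro Bochner_Integration.integral_cong) (auto simp: indicator_def alloc_zero)
    then show ?thesis
      using True u_kernel[of "fst p" "snd p"] by (cases p) (simp add: on_TV_simps indicator_def)
  qed (cases p, auto simp: on_TV_def indicator_def)
  moreover have "(\<lambda>p. indicator (T \<times> V) p * (rent_value qs (fst p) +
      (LINT s|lborel. A (fst p) s * (G M (fst p) s - (if snd p < s then 1 else 0)))) :: real) \<in> borel_measurable (borel \<Otimes>\<^sub>M borel)"
    by measurable
  ultimately show ?thesis by presburger
qed

lemma u_bounded: obtains K where "\<And>\<theta> v. \<theta> \<in> T \<Longrightarrow> v \<in> V \<Longrightarrow> \<bar>u \<theta> v\<bar> \<le> K"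
proof (rule that)
  fix \<theta> v assume *: "\<theta> \<in> T" "v \<in> V"
  have "\<bar>LINT s:V|lborel. A \<theta> s * (G M \<theta> s - indicator {v<..} s)\<bar> \<le> (LINT s:V|lborel. A hi vhi)"
    unfolding set_lebesgue_integral_def
  proof (rule integral_abs_bound_integral)
    show "integrable lborel (\<lambda>s. indicator V s *\<^sub>R (A \<theta> s * (G M \<theta> s - indicator {v<..} s)))"
      using set_integrable_weighted[OF A_mono_v[OF *(1)], of "\<lambda>s. G M \<theta> s - indicator {v<..} s"] G_bounds[OF *(1)]
      by (auto simp: set_integrable_def indicator_def)
    show "integrable lborel (\<lambda>s. indicator V s *\<^sub>R A hi vhi)"
      unfolding Vals_def by (intro integrable_scaleR_left integrable_real_indicator) (auto simp: emeasure_lborel_Icc_eq)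
    fix s :: real
    have "\<bar>A \<theta> s * (G M \<theta> s - indicator {v<..} s)\<bar> \<le> A hi vhi * 1"
      unfolding abs_mult
      using G_bounds[OF *(1), of s] A_le[of \<theta> s] alloc_nonneg[of qs]
      by (intro mult_mono) (auto simp: indicator_def)
    then show "\<bar>indicator V s *\<^sub>R (A \<theta> s * (G M \<theta> s - indicator {v<..} s))\<bar> \<le> indicator V s *\<^sub>R A hi vhi"
      by (auto simp: indicator_def)
  qed
  moreover have "0 \<le> rent_value qs \<theta>" "rent_value qs \<theta> \<le> rent_value qs hi"
    using star_rent_value_diff(1)[OF *(1) hi_T] * by (auto simp: rent_value_def T_iff)
  ultimately show "\<bar>u \<theta> v\<bar> \<le> rent_value qs hi + (LINT s:V|lborel. A hi vhi)"
    using u_kernel[OF *] by linarith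
qed

lemma u_subgradient:
  assumes "\<theta> \<in> T" "x \<in> V" "y \<in> V"
  shows "u \<theta> y + (x - y) * A \<theta> y \<le> u \<theta> x"
  by (rule integral_subgradient[where a=vlo and b=vhi, folded Vals_def])
     (rule A_mono_v u_envelope assms | assumption)+

lemma star_feasible: "feasible M \<gamma> qs (\<lambda>_. 0) ts"
  unfolding feasible_def
proof (intro conjI ballI)
  have ts_eq: "on_TV ts = (\<lambda>p. snd p * case_prod A p - on_TV u p)"
    by (auto simp: on_TV_def tstar_def alloc_def indicator_def)
  have tm[measurable]: "on_TV ts \<in> borel_measurable (borel \<Otimes>\<^sub>M borel)"
    unfolding ts_eq by measurable
  show "case_prod qs \<in> borel_measurable (restrict_space borel (T \<times> V))"
    "case_prod ts \<in> borel_measurable (restrict_space borel (T \<times> V))"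
    unfolding on_TV_measurable_iff by measurable
  show "(\<lambda>_. 0) \<in> borel_measurable (restrict_space borel T)" by simp
  show "0 \<le> qs \<theta> v" for \<theta> v by (rule qstar_nonneg)
  obtain K where K: "\<And>\<theta> v. \<theta> \<in> T \<Longrightarrow> v \<in> V \<Longrightarrow> \<bar>u \<theta> v\<bar> \<le> K" using u_bounded by blast
  have bound: "\<bar>on_TV (\<lambda>\<theta> v. 0 + ts \<theta> v - c * qs \<theta> v) p\<bar> \<le> (\<bar>vlo\<bar> + \<bar>vhi\<bar>) * A hi vhi + \<bar>K\<bar> + c * qs hi vhi" for p
  proof (cases "fst p \<in> T \<and> snd p \<in> V")
    case True
    obtain \<theta> v where p: "p = (\<theta>, v)" by (cases p)
    with True have *: "\<theta> \<in> T" "v \<in> V" by auto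
    have "\<bar>v * A \<theta> v\<bar> \<le> (\<bar>vlo\<bar> + \<bar>vhi\<bar>) * A hi vhi"
      unfolding abs_mult using *(2) A_le[of \<theta> v] alloc_nonneg[of qs] by (intro mult_mono) (auto simp: V_iff)
    moreover have "\<phi> \<theta> v \<le> \<phi> \<theta> vhi" "\<phi> \<theta> vhi \<le> \<phi> hi vhi"
      using * by (auto intro!: \<phi>_mono_v \<phi>_mono_\<theta> simp: V_iff T_iff)
    then have "c * qs \<theta> v \<le> c * qs hi vhi" using params by (intro mult_left_mono qstar_mono) auto
    moreover have "0 \<le> c * qs \<theta> v" using params qstar_nonneg by simp
    moreover have "on_TV (\<lambda>\<theta> v. 0 + ts \<theta> v - c * qs \<theta> v) p = v * A \<theta> v - u \<theta> v - c * qs \<theta> v"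
      using * by (simp add: p on_TV_simps tstar_def alloc_eq)
    ultimately show ?thesis using K[OF *] by linarith
  next
    case False
    have "0 \<le> (\<bar>vlo\<bar> + \<bar>vhi\<bar>) * A hi vhi" "0 \<le> c * qs hi vhi"
      using alloc_nonneg params qstar_nonneg by auto
    with False show ?thesis by (cases p) (auto simp: on_TV_def)
  qed
  have [measurable]: "on_TV (\<lambda>\<theta> v. 0 + ts \<theta> v - c * qs \<theta> v) \<in> borel_measurable (joint_law M)"
  proof -
    have "on_TV (\<lambda>\<theta> v. 0 + ts \<theta> v - c * qs \<theta> v) = (\<lambda>p. on_TV ts p - c * on_TV qs p)"
      by (auto simp: on_TV_def indicator_def)
    then show ?thesis by (simp add: joint_law_eq)
  qed
  have "integrable (joint_law M) (on_TV (\<lambda>\<theta> v. 0 + ts \<theta> v - c * qs \<theta> v))"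
  proof (rule Bochner_Integration.integrable_bound[OF finite_joint_law])
    show "AE p in joint_law M. norm (on_TV (\<lambda>\<theta> v. 0 + ts \<theta> v - c * qs \<theta> v) p) \<le>
        norm ((\<bar>vlo\<bar> + \<bar>vhi\<bar>) * A hi vhi + \<bar>K\<bar> + c * qs hi vhi)"
      using order_trans[OF bound abs_ge_self] by (intro AE_I2) (simp only: real_norm_def)
  qed measurable
  then show "set_integrable (joint_law M) (T \<times> V) (\<lambda>(\<theta>, v). 0 + ts \<theta> v - c * qs \<theta> v)"
    by (simp add: set_integrable_def on_TV_def[abs_def] case_prod_beta')
  show "ic_period1 M \<gamma> qs (\<lambda>_. 0) ts"
    unfolding ic_period1_def
  proof (intro ballI)
    fix \<theta> v v' assume *: "\<theta> \<in> T" "v \<in> V" "v' \<in> V"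
    show "buyer_utility M \<gamma> v (qs \<theta> v') 0 (ts \<theta> v') \<le> util \<gamma> qs (\<lambda>_. 0) ts \<theta> v"
      unfolding util_star using u_subgradient[OF *] *
      by (simp add: buyer_utility_def tstar_def alloc_eq algebra_simps)
  qed
  have int: "interim_utility M \<gamma> qs (\<lambda>_. 0) ts \<theta> r = (LINT v:V|value_law M \<theta>. u r v)" for \<theta> r
    unfolding interim_utility_def util_star ..
  show "ic_period0 M \<gamma> qs (\<lambda>_. 0) ts"
    unfolding ic_period0_def int
  proof (intro ballI)
    fix \<theta> r assume \<theta>: "\<theta> \<in> T" and r: "r \<in> T"
    have ind: "indicator V s * A r s = A r s" for s by (cases "s \<in> V") (simp_all add: alloc_zero)
    have diff1: "(LINT v:V|value_law M x. u r v) - (LINT v:V|value_law M y. u r v) =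
        (LINT s:V|lborel. A r s * (G M y s - G M x s))" if "x \<in> T" "y \<in> T" for x y
      by (rule expected_envelope_diff(1)[OF that A_mono_v[OF r] alloc_nonneg]) (rule u_envelope[OF r])
    have diff2: "ennreal ((LINT v:V|value_law M x. u r v) - (LINT v:V|value_law M y. u r v)) =
        (\<integral>\<^sup>+s. ennreal (A r s) * ennreal (G M y s - G M x s) \<partial>lborel)" if "x \<in> T" "y \<in> T" "y \<le> x" for x y
      using expected_envelope_diff(2)[where P="A r" and W="u r", OF that(1,2) A_mono_v[OF r] alloc_nonneg _ that(3)] u_envelope[OF r]
      by (simp only: ind)
    show "(LINT v:V|value_law M \<theta>. u r v) \<le> (LINT v:V|value_law M \<theta>. u \<theta> v)"
    proof (cases "r \<le> \<theta>")
      \<comment> \<open>Understating the type: the gain from imitation is the rent frozen at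
        \<open>r\<close>, at most the actual increment of rents.\<close>
      case True
      have "ennreal ((LINT v:V|value_law M \<theta>. u r v) - rent_value qs r) \<le> ennreal (rent_value qs \<theta> - rent_value qs r)"
        using diff2[OF \<theta> r True] star_rent_bounds(1)[OF r \<theta> True] star_rent_value_diff(2)[OF r \<theta> True] expected_u[OF r]
        by simp
      then show ?thesis
        using star_rent_value_diff(1)[OF r \<theta> True] expected_u[OF \<theta>] by (simp add: ennreal_le_iff)
    next
      \<comment> \<open>Overstating the type: the loss is the rent frozen at \<open>r\<close>, at
        least the actual increment of rents.\<close>
      case False
      then have le: "\<theta> \<le> r" by simp
      have "ennreal (rent_value qs r - rent_value qs \<theta>) \<le> ennreal (rent_value qs r - (LINT v:V|value_law M \<theta>. u r v))"
        using diff2[OF r \<theta> le] star_rent_bounds(2)[OF \<theta> r le] star_rent_value_diff(2)[OF \<theta> r le] expected_u[OF r]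
        by simp
      \<comment> \<open>\<open>ennreal\<close> truncates negative numbers, so returning to the reals
        needs a nonnegative right-hand side.\<close>
      moreover have "0 \<le> rent_value qs r - (LINT v:V|value_law M \<theta>. u r v)"
        unfolding expected_u[OF r, symmetric] diff1[OF r \<theta>]
        using alloc_nonneg G_antimono[OF \<theta> r le] by (intro set_lebesgue_integral_nonneg) auto
      ultimately show ?thesis
        using expected_u[OF \<theta>] by (simp add: ennreal_le_iff)
    qed
  qed
  show "ind_rational M \<gamma> qs (\<lambda>_. 0) ts"
    unfolding ind_rational_def int by (simp add: expected_u rent_value_def)
qed

lemma star_profit: "expected_profit M qs (\<lambda>_. 0) ts = (LINT p|joint_law M. virtual_surplus qs p)"
proof -
  have "f \<theta> * slack \<gamma> qs (\<lambda>_. 0) ts \<theta> = 0" for \<theta>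
    using f_zero[of \<theta>] expected_u[of \<theta>]
    by (cases "\<theta> \<in> T") (simp_all add: slack_def interim_utility_def util_star)
  then have "(LINT \<theta>|lborel. f \<theta> * slack \<gamma> qs (\<lambda>_. 0) ts \<theta>) = 0"
    by (intro integral_eq_zero_AE AE_I2)
  then show ?thesis
    using feasible_profit(3)[OF star_feasible] \<gamma> by simp
qed

lemma virtual_surplus_le_star:
  assumes "feasible M \<gamma> q t0 t1" shows "virtual_surplus q p \<le> virtual_surplus qs p"
proof (cases "fst p \<in> T \<and> snd p \<in> V")
  case True
  then show ?thesis
    using virtual_surplus_le(1)[of "fst p" "snd p" q] assms by (simp add: feasible_def)
qed (cases p, auto simp: virtual_surplus_def on_TV_def)

lemma star_optimal: "optimal M \<gamma> qs (\<lambda>_. 0) ts"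
  unfolding optimal_def
proof (intro conjI allI impI star_feasible)
  fix q t0 t1 assume feas: "feasible M \<gamma> q t0 t1"
  have "0 \<le> (LINT \<theta>|lborel. f \<theta> * slack \<gamma> q t0 t1 \<theta>)"
  proof (rule integral_nonneg_AE, rule AE_I2)
    fix \<theta> show "0 \<le> f \<theta> * slack \<gamma> q t0 t1 \<theta>"
      using slack_nonneg[OF feas, of \<theta>] \<gamma> f_nonneg[of \<theta>] f_zero[of \<theta>] by (cases "\<theta> \<in> T") auto
  qed
  moreover have "(LINT p|joint_law M. virtual_surplus q p) \<le> (LINT p|joint_law M. virtual_surplus qs p)"
    using \<gamma> by (intro integral_mono feasible_profit(1)[OF feas] feasible_profit(1)[OF star_feasible]
        virtual_surplus_le_star[OF feas]) auto
  ultimately show "expected_profit M q t0 t1 \<le> expected_profit M qs (\<lambda>_. 0) ts"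
    using feasible_profit(3)[OF feas] \<gamma> by (simp add: star_profit)
qed

text \<open>The profit shortfall is the sum of a nonnegative surplus gap and a nonnegative expected
  slack, so both vanish. The sign of \<open>t0\<close> matters: a payment to the buyer in period 0
  carries no penalty and could be taken back in period 1.\<close>

lemma optimal_unique:
  assumes opt: "optimal M \<gamma> q t0 t1" and t0: "\<And>\<theta>. \<theta> \<in> T \<Longrightarrow> 0 \<le> t0 \<theta>"
  shows "AE (\<theta>, v) in joint_law M. q \<theta> v = qs \<theta> v \<and> t0 \<theta> = 0 \<and> t1 \<theta> v = ts \<theta> v"
proof -
  have feas: "feasible M \<gamma> q t0 t1" using opt by (simp add: optimal_def)
  have \<gamma>0: "0 \<le> \<gamma>" using \<gamma> by simp
  have qm[measurable]: "on_TV q \<in> borel_measurable (borel \<Otimes>\<^sub>M borel)"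
    using feas by (simp add: feasible_def on_TV_measurable_iff)
  have fs0: "0 \<le> f \<theta> * slack \<gamma> q t0 t1 \<theta>" for \<theta>
    using slack_nonneg[OF feas \<gamma>0, of \<theta>] f_nonneg[of \<theta>] f_zero[of \<theta>] by (cases "\<theta> \<in> T") auto
  note VS_int = feasible_profit(1)[OF feas \<gamma>0] feasible_profit(1)[OF star_feasible \<gamma>0]
  have le: "(LINT p|joint_law M. virtual_surplus q p) \<le> (LINT p|joint_law M. virtual_surplus qs p)"
    by (intro integral_mono VS_int virtual_surplus_le_star[OF feas])
  have nn: "0 \<le> (LINT \<theta>|lborel. f \<theta> * slack \<gamma> q t0 t1 \<theta>)"
    using fs0 by (intro integral_nonneg_AE AE_I2)
  have "expected_profit M qs (\<lambda>_. 0) ts \<le> expected_profit M q t0 t1"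
    using opt star_feasible by (simp add: optimal_def)
  with le nn have eq: "(LINT p|joint_law M. virtual_surplus qs p - virtual_surplus q p) = 0"
    and z: "(LINT \<theta>|lborel. f \<theta> * slack \<gamma> q t0 t1 \<theta>) = 0"
    using feasible_profit(3)[OF feas \<gamma>0] VS_int by (simp_all add: star_profit)
  have "AE p in joint_law M. virtual_surplus qs p - virtual_surplus q p = 0"
    using eq VS_int virtual_surplus_le_star[OF feas] by (subst (asm) integral_nonneg_eq_0_iff_AE) auto
  then have "AE p in (lborel \<Otimes>\<^sub>M lborel). 0 < ennreal (joint_density p) \<longrightarrow> virtual_surplus qs p - virtual_surplus q p = 0"
    unfolding joint_law_eq by (subst (asm) AE_density) auto
  then have q_eq: "AE p in (lborel \<Otimes>\<^sub>M lborel). 0 < joint_density p \<longrightarrow> q (fst p) (snd p) = qs (fst p) (snd p)"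
  proof (rule eventually_mono, intro impI)
    fix p assume *: "0 < ennreal (joint_density p) \<longrightarrow> virtual_surplus qs p - virtual_surplus q p = 0"
      and pos: "0 < joint_density p"
    have T: "fst p \<in> T" using pos f_zero[of "fst p"] by (cases "fst p \<in> T") (auto simp: joint_density_def)
    moreover have "snd p \<in> V"
      using pos g_zero[OF T, of "snd p"] by (cases "snd p \<in> V") (auto simp: joint_density_def)
    ultimately show "q (fst p) (snd p) = qs (fst p) (snd p)"
      using virtual_surplus_le(2)[of "fst p" "snd p" q] * pos feas by (simp add: feasible_def)
  qed
  have q_sec: "AE x in lborel. AE v in lborel. 0 < joint_density (x, v) \<longrightarrow> q x v = qs x v"
    using lborel_pair.AE_pair[OF q_eq] by simp
  have "AE \<theta> in lborel. f \<theta> * slack \<gamma> q t0 t1 \<theta> = 0"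
    using z fs0 feasible_profit(2)[OF feas \<gamma>0] by (subst (asm) integral_nonneg_eq_0_iff_AE) auto
  then have s_sec: "AE \<theta> in lborel. \<theta> \<in> T \<longrightarrow> slack \<gamma> q t0 t1 \<theta> = 0"
  proof (rule eventually_mono, intro impI)
    fix \<theta> assume "f \<theta> * slack \<gamma> q t0 t1 \<theta> = 0" "\<theta> \<in> T"
    then show "slack \<gamma> q t0 t1 \<theta> = 0" using f_pos[of \<theta>] by simp
  qed
  have pos_density: "0 < joint_density (x, v)" if "x \<in> T" "0 < g x v" for x v
    using that f_pos by (simp add: joint_density_def)
  \<comment> \<open>\<open>D\<close> vanishes off the support, so quantities that agree almost
    everywhere on path generate the same rents.\<close>
  have rent_eq: "rent_value q \<theta> = rent_value qs \<theta>" for \<theta>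
  proof -
    have "AE x in lborel. rent_rate (alloc q) x = rent_rate A x"
    proof (rule eventually_mono[OF q_sec])
      fix x assume sec: "AE v in lborel. 0 < joint_density (x, v) \<longrightarrow> q x v = qs x v"
      show "rent_rate (alloc q) x = rent_rate A x"
        unfolding rent_rate_def
      proof (rule nn_integral_cong_AE, rule eventually_mono[OF sec])
        fix v assume *: "0 < joint_density (x, v) \<longrightarrow> q x v = qs x v"
        show "ennreal (alloc q x v) * ennreal (D x v) = ennreal (A x v) * ennreal (D x v)"
        proof (cases "x \<in> T \<and> 0 < g x v")
          case True
          then have "q x v = qs x v" using * pos_density by simp
          then show ?thesis by (simp add: alloc_def on_TV_def)
        qed (auto simp: D_def T_iff)
      qed
    qed
    then have "rent (alloc q) \<theta> = rent A \<theta>"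
      unfolding rent_def by (intro nn_integral_cong_AE) (auto elim: eventually_mono)
    then show ?thesis by (simp add: rent_value_def)
  qed
  have good: "AE \<theta> in lborel. \<theta> \<in> T \<longrightarrow> t0 \<theta> = 0 \<and> (\<forall>v. 0 < g \<theta> v \<longrightarrow> util \<gamma> q t0 t1 \<theta> v = u \<theta> v)"
  proof (rule eventually_rev_mp[OF q_sec], rule eventually_mono[OF s_sec], intro impI)
    fix \<theta> assume slack: "\<theta> \<in> T \<longrightarrow> slack \<gamma> q t0 t1 \<theta> = 0" and \<theta>: "\<theta> \<in> T"
      and sec: "AE v in lborel. 0 < joint_density (\<theta>, v) \<longrightarrow> q \<theta> v = qs \<theta> v"
    \<comment> \<open>Slack is the sum of excess utility and penalty, both nonnegative, hence each
      is 0.\<close>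
    have nn: "0 \<le> \<gamma> * (of_bool (0 \<le> t0 \<theta>) * t0 \<theta>)" using \<gamma>0 by simp
    with slack \<theta> feasible_rent(3)[OF feas \<theta>]
    have U: "interim_utility M \<gamma> q t0 t1 \<theta> \<theta> = rent_value qs \<theta>" and "\<gamma> * (of_bool (0 \<le> t0 \<theta>) * t0 \<theta>) = 0"
      unfolding slack_def rent_eq[of \<theta>] by linarith+
    then have t00: "t0 \<theta> = 0" using \<gamma> t0[OF \<theta>] by simp
    \<comment> \<open>For such a type the utilities agree at every on-path value: both are a mean
      plus a kernel integral, which ignores null sets of values and the complement of the
      support.\<close>
    have "util \<gamma> q t0 t1 \<theta> v = u \<theta> v" if v: "0 < g \<theta> v" for v
    proof -
      have vV: "v \<in> V" using g_pos_V[OF \<theta> v] .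
      have [measurable]: "case_prod (alloc q) \<in> borel_measurable (borel \<Otimes>\<^sub>M borel)"
        by (rule alloc_measurable[OF qm])
      have "(LINT s:V|lborel. alloc q \<theta> s * (G M \<theta> s - indicator {v<..} s)) =
          (LINT s:V|lborel. A \<theta> s * (G M \<theta> s - indicator {v<..} s))"
        unfolding set_lebesgue_integral_def
      proof (rule integral_cong_AE)
        show "AE s in lborel. indicator V s *\<^sub>R (alloc q \<theta> s * (G M \<theta> s - indicator {v<..} s)) =
            indicator V s *\<^sub>R (A \<theta> s * (G M \<theta> s - indicator {v<..} s))"
        proof (rule eventually_mono[OF sec])
          fix s assume *: "0 < joint_density (\<theta>, s) \<longrightarrow> q \<theta> s = qs \<theta> s"
          show "indicator V s *\<^sub>R (alloc q \<theta> s * (G M \<theta> s - indicator {v<..} s)) =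
            indicator V s *\<^sub>R (A \<theta> s * (G M \<theta> s - indicator {v<..} s))"
          proof (cases "0 < g \<theta> s")
            case True
            then have "q \<theta> s = qs \<theta> s" using * pos_density \<theta> by simp
            then show ?thesis by (simp add: alloc_def on_TV_def)
          next
            case False
            then show ?thesis using kernel_off_support[OF \<theta> False, of v] v by simp
          qed
        qed
      qed measurable
      then show ?thesis
        using envelope_kernel[where P="alloc q \<theta>" and W="util \<gamma> q t0 t1 \<theta>",
            OF \<theta> feasible_envelope(1)[OF feas \<theta>] alloc_nonneg feasible_envelope(2)[OF feas \<theta>] vV]
          u_kernel[OF \<theta> vV] U
        by (simp add: interim_utility_def)
    qed
    with t00 show "t0 \<theta> = 0 \<and> (\<forall>v. 0 < g \<theta> v \<longrightarrow> util \<gamma> q t0 t1 \<theta> v = u \<theta> v)" by blast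
  qed
  have "AE p in (lborel \<Otimes>\<^sub>M lborel). 0 < joint_density p \<longrightarrow>
      (case p of (\<theta>, v) \<Rightarrow> q \<theta> v = qs \<theta> v \<and> t0 \<theta> = 0 \<and> t1 \<theta> v = ts \<theta> v)"
  proof (rule eventually_rev_mp[OF q_eq], rule eventually_mono[OF AE_lborel_fst[OF good]], intro impI)
    fix p
    assume good: "fst p \<in> T \<longrightarrow> t0 (fst p) = 0 \<and> (\<forall>v. 0 < g (fst p) v \<longrightarrow> util \<gamma> q t0 t1 (fst p) v = u (fst p) v)"
      and q: "0 < joint_density p \<longrightarrow> q (fst p) (snd p) = qs (fst p) (snd p)" and pos: "0 < joint_density p"
    have T: "fst p \<in> T" using pos f_zero[of "fst p"] by (cases "fst p \<in> T") (auto simp: joint_density_def)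
    have g: "0 < g (fst p) (snd p)"
      using pos f_pos[OF T] by (simp add: joint_density_def zero_less_mult_iff)
    have "util \<gamma> q t0 t1 (fst p) (snd p) = u (fst p) (snd p)" "t0 (fst p) = 0" using good T g by auto
    then show "case p of (\<theta>, v) \<Rightarrow> q \<theta> v = qs \<theta> v \<and> t0 \<theta> = 0 \<and> t1 \<theta> v = ts \<theta> v"
      using q pos by (cases p) (auto simp: buyer_utility_def tstar_def)
  qed
  then show ?thesis
    unfolding joint_law_eq by (subst AE_density) auto
qed

end

section \<open>Pricing schedules\<close>

context screening_environment begin

text \<open>The infimum may lie outside the support, where the formula for the virtual value is
  silent. Monotonicity in the value carries the bound down from the support points.\<close>

lemma \<phi>_v_inf: assumes "\<theta> \<in> T" shows "\<phi> \<theta> (v_inf M \<theta>) \<le> v_inf M \<theta>"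
proof (rule v_inf_ge[OF assms])
  fix v assume v: "0 < g \<theta> v"
  have "\<phi> \<theta> (v_inf M \<theta>) \<le> \<phi> \<theta> v"
    using assms v by (intro \<phi>_mono_v v_inf_V v_inf_le g_pos_V)
  then show "\<phi> \<theta> (v_inf M \<theta>) \<le> v"
    using \<phi>_le[OF assms v] by simp
qed

text \<open>Needed for the modified virtual value, whose mechanism requires its own utility.
  Subtracting the mean of the envelope integral makes the expectation equal to the rent.\<close>

lemma ex_post_utility_exists: obtains u where "ex_post_utility M \<phi> u"
proof
  define u where "u \<theta> v = rent_value qs \<theta> - (LINT s:V|lborel. A \<theta> s * (1 - G M \<theta> s)) + (LINT s:{vlo..v}|lborel. A \<theta> s)" for \<theta> v
  have A_eq: "(LINT s:{vlo..v}|lborel. A \<theta> s) = (LINT s:{vlo..v}|lborel. qs \<theta> s powr \<alpha>)" if "\<theta> \<in> T" "v \<in> V" for \<theta> v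
    using that by (intro set_lebesgue_integral_cong) (auto simp: alloc_eq V_iff)
  have vlo0: "(LINT s:{vlo..vlo}|lborel. A \<theta> s) = 0" for \<theta>
    using mono_on_integral_bounds[of vlo vlo "A \<theta>"] by (simp add: mono_on_def)
  have env: "u \<theta> v = u \<theta> vlo + (LINT s:{vlo..v}|lborel. A \<theta> s)" for \<theta> v
    unfolding u_def vlo0 by simp
  have E: "(LINT v:V|value_law M \<theta>. u \<theta> v) = rent_value qs \<theta>" if \<theta>: "\<theta> \<in> T" for \<theta>
  proof -
    have "(LINT v:V|value_law M \<theta>. u \<theta> v) = u \<theta> vlo + (LINT s:V|lborel. A \<theta> s * (1 - G M \<theta> s))"
      by (rule expected_envelope(3)[OF \<theta> A_mono_v[OF \<theta>] alloc_nonneg]) (rule env)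
    then show ?thesis unfolding u_def vlo0 by simp
  qed
  show "ex_post_utility M \<phi> u"
    unfolding ex_post_utility_def
  proof (intro ballI conjI)
    fix \<theta> v assume \<theta>: "\<theta> \<in> T"
    show "(LINT v:V|value_law M \<theta>. u \<theta> v) =
        - (LINT x:{lo..\<theta>}|lborel. LINT v:V|lborel. qs x v powr \<alpha> * dG M x v)"
      unfolding E[OF \<theta>] rent_value_dG[OF \<theta>] ..
    assume v: "v \<in> V"
    show "u \<theta> v = u \<theta> vlo + (LINT s:{vlo..v}|lborel. qs \<theta> s powr \<alpha>)"
      unfolding A_eq[OF \<theta> v, symmetric] by (rule env)
  qed
qed

end

context optimal_mechanism begin

text \<open>The quantities of lower types are replaced by those of \<theta>, which are at least as
  large. Values \<open>s \<le> 0\<close> drop out because on the support the virtual value is at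
  most \<open>s\<close>, so nothing is sold there; the model admits negative values.\<close>

lemma rent_value_le:
  assumes \<theta>: "\<theta> \<in> T"
  shows "rent_value qs \<theta> \<le> (LINT s:V|lborel. indicator {0<..} s * A \<theta> s * (G M lo s - G M \<theta> s))"
proof -
  define B where "B s = indicator {0<..} s * A \<theta> s" for s :: real
  have [measurable]: "B \<in> borel_measurable borel" unfolding B_def by measurable
  have B0: "0 \<le> B s" for s using alloc_nonneg by (simp add: B_def)
  have anti: "G M \<theta> s \<le> G M lo s" for s using \<theta> by (intro G_antimono) (auto simp: T_iff)
  have AB: "A x s * D x s \<le> B s * D x s" if x: "x \<in> {lo..\<theta>}" for x s
  proof (cases "0 < g x s \<and> s \<le> 0")
    case True
    have xT: "x \<in> T" using x \<theta> by (auto simp: T_iff)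
    then have "\<phi> x s \<le> 0" using \<phi>_le[OF xT, of s] True by auto
    then have "A x s = 0" by (simp add: alloc_def on_TV_def qstar_zero)
    then show ?thesis using D_nonneg B0 by simp
  next
    case False
    then consider "D x s = 0" | "0 < s" by (auto simp: D_def)
    then show ?thesis
    proof cases
      case 2
      have "A x s \<le> A \<theta> s" using x \<theta> by (intro A_mono_\<theta>) (auto simp: T_iff)
      then show ?thesis using 2 D_nonneg by (simp add: B_def mult_right_mono)
    qed simp
  qed
  have "ennreal (rent_value qs \<theta>) = rent A \<theta>" by (rule star_rent_value[OF \<theta>, symmetric])
  also have "\<dots> \<le> (\<integral>\<^sup>+x. (\<integral>\<^sup>+s. ennreal (B s) * ennreal (D x s) \<partial>lborel) * indicator {lo..\<theta>} x \<partial>lborel)"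
    unfolding rent_def rent_rate_def
  proof (rule nn_integral_mono)
    fix x
    show "(\<integral>\<^sup>+s. ennreal (A x s) * ennreal (D x s) \<partial>lborel) * indicator {lo..\<theta>} x \<le>
        (\<integral>\<^sup>+s. ennreal (B s) * ennreal (D x s) \<partial>lborel) * indicator {lo..\<theta>} x"
    proof (cases "x \<in> {lo..\<theta>}")
      case True
      have "ennreal (A x s) * ennreal (D x s) \<le> ennreal (B s) * ennreal (D x s)" for s
        using AB[OF True, of s] alloc_nonneg[of qs x s] B0[of s] D_nonneg[of x s]
        by (simp add: ennreal_mult[symmetric] ennreal_leI)
      then show ?thesis using True by (simp add: nn_integral_mono)
    qed simp
  qed
  also have "\<dots> = (\<integral>\<^sup>+s. ennreal (B s) * ennreal (G M lo s - G M \<theta> s) \<partial>lborel)"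
    using \<theta> by (intro rent_frozen) (auto simp: T_iff)
  also have "\<dots> = (\<integral>\<^sup>+s. ennreal (indicator V s *\<^sub>R (indicator {0<..} s * A \<theta> s * (G M lo s - G M \<theta> s))) \<partial>lborel)"
  proof (rule nn_integral_cong)
    fix s
    show "ennreal (B s) * ennreal (G M lo s - G M \<theta> s) =
        ennreal (indicator V s *\<^sub>R (indicator {0<..} s * A \<theta> s * (G M lo s - G M \<theta> s)))"
      using B0[of s] anti[of s] by (cases "s \<in> V") (simp_all add: B_def alloc_zero ennreal_mult[symmetric])
  qed
  also have "\<dots> = ennreal (LINT s:V|lborel. indicator {0<..} s * A \<theta> s * (G M lo s - G M \<theta> s))"
    unfolding set_lebesgue_integral_def
  proof (rule nn_integral_eq_integral)
    have "set_integrable lborel V (\<lambda>s. A \<theta> s * (indicator {0<..} s * (G M lo s - G M \<theta> s)))"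
    proof (intro set_integrable_weighted A_mono_v \<theta>)
      show "\<bar>indicator {0<..} s * (G M lo s - G M \<theta> s)\<bar> \<le> 1" for s :: real
        using G_bounds[OF lo_T, of s] G_bounds[OF \<theta>, of s] anti[of s] by (simp add: indicator_def)
    qed measurable
    then show "integrable lborel (\<lambda>s. indicator V s *\<^sub>R (indicator {0<..} s * A \<theta> s * (G M lo s - G M \<theta> s)))"
      by (simp add: set_integrable_def mult_ac)
    show "AE s in lborel. 0 \<le> indicator V s *\<^sub>R (indicator {0<..} s * A \<theta> s * (G M lo s - G M \<theta> s))"
      using alloc_nonneg[of qs \<theta>] anti by (intro AE_I2) (auto simp: indicator_def)
  qed
  finally have "ennreal (rent_value qs \<theta>) \<le> ennreal (LINT s:V|lborel. indicator {0<..} s * A \<theta> s * (G M lo s - G M \<theta> s))" .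
  moreover have "0 \<le> (LINT s:V|lborel. indicator {0<..} s * A \<theta> s * (G M lo s - G M \<theta> s))"
    using alloc_nonneg[of qs \<theta>] anti by (intro set_lebesgue_integral_nonneg) (auto simp: indicator_def)
  ultimately show ?thesis by (simp add: ennreal_le_iff)
qed

text \<open>The bound is the rent that the lowest type would expect, above the bottom of the support of type
  \<open>\<theta>\<close>, from the quantities of type \<open>\<theta>\<close>.\<close>

lemma tstar_v_inf_ge:
  assumes \<theta>: "\<theta> \<in> T"
  shows "(LINT s:V|lborel. indicator {max 0 (v_inf M \<theta>)<..} s * A \<theta> s * (1 - G M lo s)) \<le> ts \<theta> (v_inf M \<theta>)"
proof -
  define b where "b = v_inf M \<theta>"
  have b: "b \<in> V" unfolding b_def by (rule v_inf_V[OF \<theta>])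
  have G_b: "G M \<theta> s = 0" if "s \<le> b" for s
    using v_inf_le[OF \<theta>] that by (intro G_zero \<theta>) (force simp: b_def)
  have anti: "G M \<theta> s \<le> G M lo s" for s using \<theta> by (intro G_antimono) (auto simp: T_iff)
  have int: "set_integrable lborel V (\<lambda>s. A \<theta> s * k s)"
    if "k \<in> borel_measurable borel" "\<And>s. \<bar>k s\<bar> \<le> 1" for k
    using that by (intro set_integrable_weighted A_mono_v \<theta>) auto
  define k1 where "k1 s = indicator {0<..} s * (G M lo s - G M \<theta> s)" for s :: real
  define k2 where "k2 s = G M \<theta> s - indicator {b<..} s" for s :: real
  define k3 where "k3 s = indicator {max 0 b<..} s * (1 - G M lo s)" for s :: real
  have [measurable]: "k1 \<in> borel_measurable borel" "k2 \<in> borel_measurable borel" "k3 \<in> borel_measurable borel"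
    unfolding k1_def k2_def k3_def by measurable
  have kb: "\<bar>k1 s\<bar> \<le> 1" "\<bar>k2 s\<bar> \<le> 1" "\<bar>k3 s\<bar> \<le> 1" for s
    using G_bounds[OF lo_T, of s] G_bounds[OF \<theta>, of s] anti[of s]
    by (simp_all add: k1_def k2_def k3_def indicator_def abs_le_iff)
  note i = int[of k1] int[of k2] int[of k3]
  \<comment> \<open>At a negative \<open>b\<close> nothing is sold, so \<open>b\<close> may be
    replaced by its positive part, the length of \<open>{0..b}\<close>.\<close>
  have Ab: "b * A \<theta> b = max 0 b * A \<theta> b"
  proof (cases "b < 0")
    case True
    then have "\<phi> \<theta> b \<le> 0" using \<phi>_v_inf[OF \<theta>] by (simp add: b_def)
    then show ?thesis by (simp add: alloc_def on_TV_def qstar_zero)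
  qed simp
  have ib: "set_integrable lborel V (\<lambda>s. indicator {0..b} s * A \<theta> b)"
  proof (rule set_integrable_bound)
    show "set_integrable lborel V (\<lambda>s. A \<theta> b)"
      unfolding set_integrable_def Vals_def
      by (intro integrable_scaleR_left integrable_real_indicator) (auto simp: emeasure_lborel_Icc_eq)
    show "AE s in lborel. s \<in> V \<longrightarrow> norm (indicator {0..b} s * A \<theta> b) \<le> norm (A \<theta> b)"
      by (intro AE_I2) (simp add: indicator_def)
  qed (simp add: set_borel_measurable_def)
  have "u \<theta> b \<le> (LINT s:V|lborel. A \<theta> s * k1 s) + (LINT s:V|lborel. A \<theta> s * k2 s)"
    using u_kernel[OF \<theta> b] rent_value_le[OF \<theta>] by (simp add: k1_def k2_def mult_ac)
  also have "\<dots> = (LINT s:V|lborel. A \<theta> s * k1 s + A \<theta> s * k2 s)"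
    using kb by (intro set_integral_add(2)[symmetric] i) auto
  also have "\<dots> \<le> (LINT s:V|lborel. indicator {0..b} s * A \<theta> b - A \<theta> s * k3 s)"
  proof (rule set_integral_mono)
    show "set_integrable lborel V (\<lambda>s. A \<theta> s * k1 s + A \<theta> s * k2 s)"
      using kb by (intro set_integral_add(1) i) auto
    show "set_integrable lborel V (\<lambda>s. indicator {0..b} s * A \<theta> b - A \<theta> s * k3 s)"
      using kb by (intro set_integral_diff(1) i ib) auto
    fix s assume s: "s \<in> V"
    \<comment> \<open>For \<open>0 < s \<le> b\<close> only the rent weight
      \<open>G M lo s \<le> 1\<close> remains, and the slope at \<open>s\<close> is at most that at
      \<open>b\<close>. This range produces the term \<open>b * A \<theta> b\<close>, the gross
      utility at the bottom of the support.\<close>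
    consider "s \<le> b" "s \<le> 0" | "s \<le> b" "0 < s" | "b < s" "s \<le> 0" | "b < s" "0 < s" by linarith
    then show "A \<theta> s * k1 s + A \<theta> s * k2 s \<le> indicator {0..b} s * A \<theta> b - A \<theta> s * k3 s"
    proof cases
      case 1
      then show ?thesis using G_b[of s] alloc_nonneg[of qs \<theta> b] by (simp add: k1_def k2_def k3_def)
    next
      case 2
      have "A \<theta> s * G M lo s \<le> A \<theta> b * 1"
        using 2 s b G_bounds[OF lo_T, of s] alloc_nonneg[of qs \<theta>]
        by (intro mult_mono mono_onD[OF A_mono_v[OF \<theta>]]) auto
      then show ?thesis using 2 G_b[of s] by (simp add: k1_def k2_def k3_def)
    next
      case 3
      have "A \<theta> s * (G M \<theta> s - 1) \<le> 0"
        using G_bounds[OF \<theta>, of s] alloc_nonneg[of qs \<theta> s] by (intro mult_nonneg_nonpos) auto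
      then show ?thesis using 3 by (simp add: k1_def k2_def k3_def)
    next
      case 4
      then show ?thesis by (simp add: k1_def k2_def k3_def algebra_simps)
    qed
  qed
  also have "\<dots> = (LINT s:V|lborel. indicator {0..b} s * A \<theta> b) - (LINT s:V|lborel. A \<theta> s * k3 s)"
    using kb by (intro set_integral_diff(2) i ib) auto
  also have "(LINT s:V|lborel. indicator {0..b} s * A \<theta> b) \<le> (LINT s|lborel. indicator {0..b} s * A \<theta> b)"
    unfolding set_lebesgue_integral_def
  proof (rule integral_mono)
    show "integrable lborel (\<lambda>s. indicator V s *\<^sub>R (indicator {0..b} s * A \<theta> b))"
      using ib by (simp add: set_integrable_def)
    show "integrable lborel (\<lambda>s. indicator {0..b} s * A \<theta> b)"
      by (intro integrable_mult_left integrable_real_indicator) (auto simp: emeasure_lborel_Icc_eq)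
  qed (auto simp: indicator_def alloc_nonneg)
  also have "(LINT s|lborel. indicator {0..b} s * A \<theta> b) = b * A \<theta> b"
    unfolding Ab by (simp add: max_def)
  finally have "u \<theta> b \<le> b * A \<theta> b - (LINT s:V|lborel. A \<theta> s * k3 s)" by simp
  then show ?thesis
    using b \<theta> by (simp add: tstar_def alloc_eq b_def[symmetric] k3_def mult_ac)
qed

lemma tstar_v_inf_nonneg: "\<theta> \<in> T \<Longrightarrow> 0 \<le> ts \<theta> (v_inf M \<theta>)"
proof (rule order_trans[OF _ tstar_v_inf_ge])
  show "0 \<le> (LINT s:V|lborel. indicator {max 0 (v_inf M \<theta>)<..} s * A \<theta> s * (1 - G M lo s))"
    using alloc_nonneg[of qs \<theta>] G_bounds(2)[OF lo_T] by (intro set_lebesgue_integral_nonneg) auto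
qed

text \<open>To the right of the value that witnesses \<open>served\<close>, the integrand of the
  lower bound stays away from 0 on an interval, since \<open>A \<theta>\<close> is monotone and
  \<open>G M lo\<close> is right-continuous.\<close>

lemma tstar_v_inf_pos:
  assumes \<theta>: "\<theta> \<in> T" and served: "served M \<phi> \<theta>"
  shows "0 < ts \<theta> (v_inf M \<theta>)"
proof -
  obtain v where v: "0 < g \<theta> v" "G M lo v < 1" "0 < qs \<theta> v"
    using served by (auto simp: served_def)
  have vV: "v \<in> V" by (rule g_pos_V[OF \<theta> v(1)])
  have "0 < \<phi> \<theta> v" using v(3) qstar_zero[of \<theta> v] by (cases "\<phi> \<theta> v \<le> 0") auto
  then have v0: "max 0 (v_inf M \<theta>) \<le> v" using \<phi>_le[OF \<theta> v(1)] v_inf_le[OF \<theta> v(1)] by simp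
  interpret real_distribution "value_law M lo" by (rule real_distribution_value_law) simp
  have "(G M lo \<longlongrightarrow> G M lo v) (at_right v)"
    using cdf_is_right_cont[of v] by (simp add: G_def[abs_def] continuous_within)
  then have "\<forall>\<^sub>F x in at_right v. G M lo x < 1"
    using v(2) by (rule order_tendstoD(2))
  moreover have "\<forall>\<^sub>F x in at_right v. v < x"
    by (simp add: eventually_at_right_less)
  ultimately have "\<forall>\<^sub>F x in at_right v. v < x \<and> G M lo x < 1"
    by (rule eventually_conj[rotated])
  then obtain y where y: "v < y" "G M lo y < 1"
    using eventually_happens'[OF trivial_limit_at_right_real] by blast
  have y_V: "y < vhi" using y(2) G_vhi[OF lo_T, of y] by (cases "y < vhi") auto
  \<comment> \<open>Product of lower bounds for the slope and for the tail probability on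
    \<open>{v<..y}\<close>.\<close>
  define e where "e = A \<theta> v * (1 - G M lo y)"
  have "0 < e" using v(3) y(2) vV \<theta> by (simp add: e_def alloc_eq)
  then have "0 < (y - v) * e" using y(1) by simp
  also have "\<dots> = (LINT s|lborel. indicator {v<..y} s * e)"
    using y(1) by simp
  also have "\<dots> \<le> (LINT s:V|lborel. indicator {max 0 (v_inf M \<theta>)<..} s * A \<theta> s * (1 - G M lo s))"
    unfolding set_lebesgue_integral_def
  proof (rule integral_mono)
    show "integrable lborel (\<lambda>s. indicator {v<..y} s * e)"
      using y(1) by (intro integrable_mult_left integrable_real_indicator) auto
    have "set_integrable lborel V (\<lambda>s. A \<theta> s * (indicator {max 0 (v_inf M \<theta>)<..} s * (1 - G M lo s)))"
      using G_bounds[OF lo_T] by (intro set_integrable_weighted A_mono_v \<theta>) (auto simp: indicator_def)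
    then show "integrable lborel (\<lambda>s. indicator V s *\<^sub>R (indicator {max 0 (v_inf M \<theta>)<..} s * A \<theta> s * (1 - G M lo s)))"
      by (simp add: set_integrable_def mult_ac)
    fix s :: real
    show "indicator {v<..y} s * e \<le> indicator V s *\<^sub>R (indicator {max 0 (v_inf M \<theta>)<..} s * A \<theta> s * (1 - G M lo s))"
    proof (cases "s \<in> {v<..y}")
      case True
      then have s: "s \<in> V" "max 0 (v_inf M \<theta>) < s" using vV y_V v0 by (auto simp: V_iff)
      have "e \<le> A \<theta> s * (1 - G M lo s)"
        unfolding e_def using True s vV y(2) G_mono[OF lo_T, of s y] alloc_nonneg[of qs]
        by (intro mult_mono mono_onD[OF A_mono_v[OF \<theta>]]) auto
      then show ?thesis using True s by simp
    next
      case False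
      have "0 \<le> indicator V s * (indicator {max 0 (v_inf M \<theta>)<..} s * A \<theta> s * (1 - G M lo s))"
        using alloc_nonneg[of qs \<theta> s] G_bounds(2)[OF lo_T, of s] by (intro mult_nonneg_nonneg) auto
      then show ?thesis using False by simp
    qed
  qed
  also have "\<dots> \<le> ts \<theta> (v_inf M \<theta>)" by (rule tstar_v_inf_ge[OF \<theta>])
  finally show ?thesis .
qed

text \<open>Two values buying the same quantity would each choose the smaller payment, so payments
  are a function of the quantity. This is what turns a menu into a schedule.\<close>

lemma tstar_pooling:
  assumes "\<theta> \<in> T" "x \<in> V" "y \<in> V" "qs \<theta> x = qs \<theta> y" shows "ts \<theta> x = ts \<theta> y"
proof -
  have "A \<theta> x = A \<theta> y" using assms by (simp add: alloc_eq)
  then have "u \<theta> x - u \<theta> y = (x - y) * A \<theta> y"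
    using u_subgradient[OF assms(1,2,3)] u_subgradient[OF assms(1,3,2)] by (simp add: algebra_simps)
  then show ?thesis using assms by (simp add: tstar_def alloc_eq algebra_simps)
qed

text \<open>A nonnegative value does not lose from a larger quantity, so it would imitate a higher
  value that paid less. The sign of \<open>x\<close> enters through
  \<open>x * A \<theta> x \<le> x * A \<theta> y\<close>.\<close>

lemma tstar_mono:
  assumes "\<theta> \<in> T" "x \<in> V" "y \<in> V" "0 \<le> x" "x \<le> y" shows "ts \<theta> x \<le> ts \<theta> y"
proof -
  have "x * A \<theta> x \<le> x * A \<theta> y"
    using assms by (intro mult_left_mono mono_onD[OF A_mono_v]) auto
  then show ?thesis
    using u_subgradient[OF assms(1,2,3)] assms by (simp add: tstar_def alloc_eq algebra_simps)
qed

end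

text \<open>A normal extension of the virtual value bounds \<open>\<phi>\<close> by \<open>v\<close> also above the support and is
  constant below it, so that everything the mechanism offers off path costs at least as much as
  what the lowest value buys.\<close>

locale normal_mechanism = optimal_mechanism +
  assumes normal_le: "\<theta> \<in> Types M \<Longrightarrow> v \<in> Vals M \<Longrightarrow> \<phi> \<theta> v \<le> max v (v_inf M \<theta>)"
    and normal_const: "\<theta> \<in> Types M \<Longrightarrow> v \<in> Vals M \<Longrightarrow> v \<le> v_inf M \<theta> \<Longrightarrow> \<phi> \<theta> v = \<phi> \<theta> (v_inf M \<theta>)"
begin

text \<open>Values below the support are pooled with its bottom. Above the bottom, values up to 0
  buy nothing and are pooled as well, and payments increase along nonnegative values.\<close>

lemma tstar_minimum:
  assumes \<theta>: "\<theta> \<in> T" and v: "v \<in> V" shows "ts \<theta> (v_inf M \<theta>) \<le> ts \<theta> v"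
proof -
  have b: "v_inf M \<theta> \<in> V" by (rule v_inf_V[OF \<theta>])
  have zero: "qs \<theta> x = 0" if "x \<in> V" "v_inf M \<theta> \<le> x" "x \<le> 0" for x
    using normal_le[OF \<theta> that(1)] that by (intro qstar_zero) auto
  consider "v \<le> v_inf M \<theta>" | "v_inf M \<theta> \<le> v" "0 \<le> v_inf M \<theta>" | "v_inf M \<theta> \<le> v" "v \<le> 0"
    | "v_inf M \<theta> \<le> 0" "0 \<le> v" by linarith
  then show ?thesis
  proof cases
    case 1
    have "qs \<theta> v = qs \<theta> (v_inf M \<theta>)" using normal_const[OF \<theta> v 1] by (simp add: qstar_def)
    then show ?thesis using tstar_pooling[OF \<theta> v b] by simp
  next
    case 2
    then show ?thesis using \<theta> v b by (intro tstar_mono) auto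
  next
    case 3
    then show ?thesis using tstar_pooling[OF \<theta> b v] zero[OF b] zero[OF v] by simp
  next
    case 4
    then have z: "0 \<in> V" using v b by (auto simp: V_iff)
    have "ts \<theta> (v_inf M \<theta>) = ts \<theta> 0" using tstar_pooling[OF \<theta> b z] zero[OF b] zero[OF z] 4 by simp
    also have "\<dots> \<le> ts \<theta> v" using 4 by (intro tstar_mono[OF \<theta> z v]) auto
    finally show ?thesis .
  qed
qed

text \<open>Quantities outside the menu are priced so that every value is better off with the quantity
  sold at the bottom of the support.\<close>

definition schedule :: "real \<Rightarrow> real \<Rightarrow> real" where
  "schedule \<theta> x = (if \<exists>v\<in>V. x = qs \<theta> v then ts \<theta> (SOME v. v \<in> V \<and> x = qs \<theta> v)
     else (\<bar>vlo\<bar> + \<bar>vhi\<bar>) * (x powr \<alpha> + A \<theta> (v_inf M \<theta>)) + ts \<theta> (v_inf M \<theta>))"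

text \<open>Pooled values pay the same, so the value picked by \<open>SOME\<close> is
  immaterial.\<close>

lemma schedule_qstar:
  assumes "\<theta> \<in> T" "v \<in> V" shows "schedule \<theta> (qs \<theta> v) = ts \<theta> v"
proof -
  let ?w = "SOME w. w \<in> V \<and> qs \<theta> v = qs \<theta> w"
  have "?w \<in> V \<and> qs \<theta> v = qs \<theta> ?w" by (rule someI[of _ v]) (use assms in simp)
  then have "ts \<theta> v = ts \<theta> ?w" using assms by (intro tstar_pooling) auto
  then show ?thesis using assms by (auto simp: schedule_def)
qed

lemma schedule_cases:
  assumes "\<theta> \<in> T"
  obtains w where "w \<in> V" "x = qs \<theta> w" "schedule \<theta> x = ts \<theta> w"
  | "schedule \<theta> x = (\<bar>vlo\<bar> + \<bar>vhi\<bar>) * (x powr \<alpha> + A \<theta> (v_inf M \<theta>)) + ts \<theta> (v_inf M \<theta>)"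
  using schedule_qstar[OF assms] by (cases "\<exists>v\<in>V. x = qs \<theta> v") (auto simp: schedule_def)

lemma schedule_minimum_spend:
  assumes \<theta>: "\<theta> \<in> T" shows "minimum_spend (schedule \<theta>) (ts \<theta> (v_inf M \<theta>))"
  unfolding minimum_spend_def
proof (intro conjI allI impI)
  show "\<exists>x\<ge>0. schedule \<theta> x = ts \<theta> (v_inf M \<theta>)"
    using schedule_qstar[OF \<theta> v_inf_V[OF \<theta>]] qstar_nonneg by blast
  fix x :: real
  show "ts \<theta> (v_inf M \<theta>) \<le> schedule \<theta> x"
  proof (cases rule: schedule_cases[OF \<theta>, of x, case_names 1 2])
    case 2
    have "0 \<le> (\<bar>vlo\<bar> + \<bar>vhi\<bar>) * (x powr \<alpha> + A \<theta> (v_inf M \<theta>))"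
      using alloc_nonneg by (intro mult_nonneg_nonneg add_nonneg_nonneg) auto
    then show ?thesis using 2 by simp
  qed (use tstar_minimum[OF \<theta>] in simp)
qed

lemma schedule_nonneg: "\<theta> \<in> T \<Longrightarrow> pricing_schedule (schedule \<theta>)"
  using schedule_minimum_spend[of \<theta>] tstar_v_inf_nonneg[of \<theta>]
  unfolding pricing_schedule_def minimum_spend_def by (meson order_trans)

lemma schedule_chosen: "chosen_from M schedule qs ts"
  unfolding chosen_from_def
proof (intro ballI conjI allI impI)
  fix \<theta> v assume \<theta>: "\<theta> \<in> T" and v: "v \<in> V"
  show "0 \<le> qs \<theta> v" by (rule qstar_nonneg)
  show eq: "ts \<theta> v = schedule \<theta> (qs \<theta> v)" by (rule schedule_qstar[OF \<theta> v, symmetric])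
  have u: "v * qs \<theta> v powr \<alpha> - schedule \<theta> (qs \<theta> v) = u \<theta> v"
    unfolding eq[symmetric] by (simp add: tstar_def)
  have best: "v * A \<theta> w - ts \<theta> w \<le> u \<theta> v" if "w \<in> V" for w
    using u_subgradient[OF \<theta> v that] that \<theta> by (simp add: tstar_def alloc_eq algebra_simps)
  fix x :: real assume "0 \<le> x"
  have "v * x powr \<alpha> - schedule \<theta> x \<le> u \<theta> v"
  proof (cases rule: schedule_cases[OF \<theta>, of x, case_names 1 2])
    case (1 w)
    then show ?thesis using best[of w] \<theta> by (simp add: alloc_eq)
  next
    case 2
    \<comment> \<open>The factor in the off-menu price dominates every \<open>\<bar>v\<bar>\<close>,
      so it covers both the benefit from \<open>x\<close> and a possible disutility from the
      quantity sold at the bottom of the support.\<close>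
    have W: "\<bar>v\<bar> \<le> \<bar>vlo\<bar> + \<bar>vhi\<bar>" using v by (auto simp: V_iff)
    have "v * x powr \<alpha> \<le> (\<bar>vlo\<bar> + \<bar>vhi\<bar>) * x powr \<alpha>" using W by (intro mult_right_mono) auto
    moreover have "- v * A \<theta> (v_inf M \<theta>) \<le> (\<bar>vlo\<bar> + \<bar>vhi\<bar>) * A \<theta> (v_inf M \<theta>)"
      using W alloc_nonneg by (intro mult_right_mono) auto
    ultimately show ?thesis using best[OF v_inf_V[OF \<theta>]] 2 by (simp add: algebra_simps)
  qed
  then show "v * x powr \<alpha> - schedule \<theta> x \<le> v * qs \<theta> v powr \<alpha> - schedule \<theta> (qs \<theta> v)"
    unfolding u .
qed

end

context optimal_mechanism begin

text \<open>Clamping the value at \<open>v_inf\<close> gives constancy below the support, and the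
  outer minimum enforces the bound by the value above it. On the support neither changes anything,
  since the virtual value is at most \<open>v\<close> there.\<close>

definition \<phi>n :: "real \<Rightarrow> real \<Rightarrow> real" where
  "\<phi>n \<theta> v = min (\<phi> \<theta> (max v (v_inf M \<theta>))) (max v (v_inf M \<theta>))"

lemma \<phi>n_eq: "\<theta> \<in> T \<Longrightarrow> 0 < g \<theta> v \<or> v = v_inf M \<theta> \<Longrightarrow> \<phi>n \<theta> v = \<phi> \<theta> v"
  using v_inf_le[of \<theta> v] \<phi>_le[of \<theta> v] \<phi>_v_inf[of \<theta>] by (auto simp: \<phi>n_def)

lemma max_v_inf_V: "\<theta> \<in> T \<Longrightarrow> v \<in> V \<Longrightarrow> max v (v_inf M \<theta>) \<in> V"
  using v_inf_V[of \<theta>] by (simp add: max_def)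

text \<open>Monotonicity in the type is the delicate point, because the clamp moves with the type.
  It moves up, by monotonicity of \<open>v_inf\<close>.\<close>

lemma normal_environment: "screening_environment M \<phi>n"
proof
  show "screening M" "fosd_ordered M" by (rule screening fosd)+
  show "weakly_increasing2 M \<phi>n"
    unfolding weakly_increasing2_def
  proof (intro conjI ballI mono_onI)
    fix \<theta> x y assume *: "\<theta> \<in> T" "x \<in> V" "y \<in> V" "x \<le> y"
    then have "\<phi> \<theta> (max x (v_inf M \<theta>)) \<le> \<phi> \<theta> (max y (v_inf M \<theta>))"
      by (intro \<phi>_mono_v max_v_inf_V) auto
    then show "\<phi>n \<theta> x \<le> \<phi>n \<theta> y" unfolding \<phi>n_def using *(4) by (intro min.mono) auto
  next
    fix v \<theta>' \<theta> assume *: "v \<in> V" "\<theta>' \<in> T" "\<theta> \<in> T" "\<theta>' \<le> \<theta>"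
    have le: "max v (v_inf M \<theta>') \<le> max v (v_inf M \<theta>)"
      using v_inf_mono[OF *(2,3,4)] by auto
    have "\<phi> \<theta>' (max v (v_inf M \<theta>')) \<le> \<phi> \<theta> (max v (v_inf M \<theta>'))"
      using * by (intro \<phi>_mono_\<theta> max_v_inf_V)
    also have "\<dots> \<le> \<phi> \<theta> (max v (v_inf M \<theta>))"
      using * le by (intro \<phi>_mono_v max_v_inf_V)
    finally show "\<phi>n \<theta>' v \<le> \<phi>n \<theta> v" unfolding \<phi>n_def using le by (intro min.mono)
  qed
  show "dynamic_virtual_value M \<phi>n"
    unfolding dynamic_virtual_value_def on_TV_measurable_iff
  proof (intro conjI ballI impI)
    \<comment> \<open>Extended to all reals by clamping the type, \<open>v_inf\<close> becomes
      monotone on the line, hence Borel.\<close>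
    define b where "b \<theta> = v_inf M (max lo (min \<theta> hi))" for \<theta>
    have "mono b"
      unfolding b_def using lo_less_hi by (intro monoI v_inf_mono) (auto simp: T_iff)
    then have [measurable]: "b \<in> borel_measurable borel" by (rule borel_measurable_mono)
    have [measurable]: "T \<times> V \<in> sets (borel \<Otimes>\<^sub>M borel)" by simp
    have "on_TV \<phi>n p = indicator (T \<times> V) p * min (on_TV \<phi> (fst p, max (snd p) (b (fst p)))) (max (snd p) (b (fst p)))" for p
    proof (cases "fst p \<in> T \<and> snd p \<in> V")
      case True
      moreover have "b (fst p) = v_inf M (fst p)" using True by (simp add: b_def T_iff)
      ultimately show ?thesis
        using max_v_inf_V[of "fst p" "snd p"] by (cases p) (simp add: on_TV_simps \<phi>n_def)
    qed (cases p, auto simp: on_TV_def)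
    moreover have "(\<lambda>p. indicator (T \<times> V) p * min (on_TV \<phi> (fst p, max (snd p) (b (fst p)))) (max (snd p) (b (fst p))))
        \<in> borel_measurable (borel \<Otimes>\<^sub>M borel)"
      by measurable
    ultimately show "on_TV \<phi>n \<in> borel_measurable (borel \<Otimes>\<^sub>M borel)" by presburger
    fix \<theta> v assume "\<theta> \<in> T" "0 < g \<theta> v"
    then show "\<phi>n \<theta> v = v + (1 - F M \<theta>) / f \<theta> * (dG M \<theta> v / g \<theta> v)"
      using \<phi>_eq \<phi>n_eq by simp
  qed
qed

end

text \<open>The mechanism for the modified virtual value comes with a nonnegative schedule. It
  agrees with the original one on path and at the bottom of the support, because rents and utilities
  anchored at their mean involve only on-path quantities; hence prices and minimum spends are those
  of \<open>tstar\<close>.\<close>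

lemma committed_spend_schedule:
  assumes "optimal_mechanism M \<phi> u \<gamma>"
  obtains p q t1 where
    "\<And>\<theta>. \<theta> \<in> Types M \<Longrightarrow> pricing_schedule (p \<theta>)"
    "\<And>\<theta>. \<theta> \<in> Types M \<Longrightarrow> minimum_spend (p \<theta>) (tstar M \<phi> u \<theta> (v_inf M \<theta>))"
    "\<And>\<theta> v. \<theta> \<in> Types M \<Longrightarrow> 0 < dens_g M \<theta> v \<Longrightarrow> p \<theta> (qstar M \<phi> \<theta> v) = tstar M \<phi> u \<theta> v"
    "\<And>\<theta> v. \<theta> \<in> Types M \<Longrightarrow> 0 < dens_g M \<theta> v \<Longrightarrow> q \<theta> v = qstar M \<phi> \<theta> v"
    "chosen_from M p q t1" "optimal M \<gamma> q (\<lambda>_. 0) t1"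
proof -
  interpret optimal_mechanism M \<phi> u \<gamma> by fact
  interpret N: screening_environment M \<phi>n by (rule normal_environment)
  obtain un where un: "ex_post_utility M \<phi>n un" using N.ex_post_utility_exists .
  interpret N: normal_mechanism M \<phi>n un \<gamma>
  proof
    show "ex_post_utility M \<phi>n un" "0 < \<gamma>" by (rule un \<gamma>)+
    show "\<phi>n \<theta> v \<le> max v (v_inf M \<theta>)" for \<theta> v by (simp add: \<phi>n_def)
    show "v \<le> v_inf M \<theta> \<Longrightarrow> \<phi>n \<theta> v = \<phi>n \<theta> (v_inf M \<theta>)" for \<theta> v by (simp add: \<phi>n_def)
  qed
  have q_eq: "N.qs \<theta> v = qs \<theta> v" if "\<theta> \<in> T" "0 < g \<theta> v \<or> v = v_inf M \<theta>" for \<theta> v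
    using \<phi>n_eq[OF that] by (simp add: qstar_def)
  have A_eq: "N.A \<theta> v = A \<theta> v" if "\<theta> \<in> T" "0 < g \<theta> v \<or> v = v_inf M \<theta>" for \<theta> v
    using q_eq[OF that] by (simp add: alloc_def on_TV_def)
  have rate_eq: "rent_rate N.A x = rent_rate A x" for x
    unfolding rent_rate_def
  proof (rule nn_integral_cong)
    fix s show "ennreal (N.A x s) * ennreal (D x s) = ennreal (A x s) * ennreal (D x s)"
      using A_eq[of x s] by (cases "D x s = 0") (auto simp: D_def T_iff split: if_splits)
  qed
  have "rent_value N.qs \<theta> = rent_value qs \<theta>" for \<theta>
    by (simp add: rent_value_def rent_def rate_eq)
  then have u_eq: "un \<theta> v = u \<theta> v" if "\<theta> \<in> T" "0 < g \<theta> v \<or> v = v_inf M \<theta>" for \<theta> v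
  proof -
    have v: "v \<in> V" using that g_pos_V v_inf_V by blast
    have "(LINT s:V|lborel. N.A \<theta> s * (G M \<theta> s - indicator {v<..} s)) = (LINT s:V|lborel. A \<theta> s * (G M \<theta> s - indicator {v<..} s))"
    proof (intro set_lebesgue_integral_cong allI impI)
      fix s
      show "N.A \<theta> s * (G M \<theta> s - indicator {v<..} s) = A \<theta> s * (G M \<theta> s - indicator {v<..} s)"
        using A_eq[OF that(1), of s] kernel_off_support[OF that(1) _ that(2), of s]
        by (cases "0 < g \<theta> s") auto
    qed simp
    then show ?thesis
      using N.u_kernel[OF that(1) v] u_kernel[OF that(1) v] \<open>rent_value N.qs \<theta> = rent_value qs \<theta>\<close> by simp
  qed
  have t_eq: "N.ts \<theta> v = ts \<theta> v" if "\<theta> \<in> T" "0 < g \<theta> v \<or> v = v_inf M \<theta>" for \<theta> v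
    by (simp add: tstar_def q_eq[OF that] u_eq[OF that])
  show ?thesis
  proof (rule that[of N.schedule N.qs N.ts])
    fix \<theta> assume \<theta>: "\<theta> \<in> T"
    show "pricing_schedule (N.schedule \<theta>)" by (rule N.schedule_nonneg[OF \<theta>])
    show "minimum_spend (N.schedule \<theta>) (ts \<theta> (v_inf M \<theta>))"
      using N.schedule_minimum_spend[OF \<theta>] t_eq[OF \<theta>] by simp
    fix v assume v: "0 < g \<theta> v"
    show "N.schedule \<theta> (qs \<theta> v) = ts \<theta> v"
      using N.schedule_qstar[OF \<theta> g_pos_V[OF \<theta> v]] q_eq[OF \<theta>] t_eq[OF \<theta>] v by simp
    show "N.qs \<theta> v = qs \<theta> v" using q_eq[OF \<theta>] v by simp
  next
    show "chosen_from M N.schedule N.qs N.ts" by (rule N.schedule_chosen)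
    show "optimal M \<gamma> N.qs (\<lambda>_. 0) N.ts" by (rule N.star_optimal)
  qed
qed

text \<open>\<open>q\<close> and \<open>t1\<close> come from the modified virtual value and may
  differ from \<open>qstar\<close> and \<open>tstar\<close> off path. On path,
  \<open>chosen_from\<close> together with the prices of \<open>p\<close> identifies
  \<open>t1\<close> with \<open>tstar\<close>.\<close>

theorem proposition2:
  fixes M :: screening_model
    and \<phi> u :: "real \<Rightarrow> real \<Rightarrow> real"
    and \<gamma> :: real
  assumes "screening M"
    and "fosd_ordered M"
    and "dynamic_virtual_value M \<phi>"
    and "weakly_increasing2 M \<phi>"
    and "ex_post_utility M \<phi> u"
    and "0 < \<gamma>"
  shows "(\<exists>p q t1.
            (\<forall>\<theta>\<in>Types M. pricing_schedule (p \<theta>) \<and>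
               minimum_spend (p \<theta>) (tstar M \<phi> u \<theta> (v_inf M \<theta>)) \<and>
               (th_lo M < \<theta> \<and> served M \<phi> \<theta> \<longrightarrow> 0 < tstar M \<phi> u \<theta> (v_inf M \<theta>))) \<and>
            ((\<forall>\<theta>\<in>Types M. th_lo M < \<theta> \<longrightarrow> served M \<phi> \<theta>) \<longrightarrow> committed_spend M p) \<and>
            (\<forall>(\<theta>, v)\<in>on_path M. p \<theta> (qstar M \<phi> \<theta> v) = tstar M \<phi> u \<theta> v) \<and>
            chosen_from M p q t1 \<and>
            (\<forall>(\<theta>, v)\<in>on_path M. q \<theta> v = qstar M \<phi> \<theta> v) \<and>
            optimal M \<gamma> q (\<lambda>_. 0) t1) \<and>
         optimal M \<gamma> (qstar M \<phi>) (\<lambda>_. 0) (tstar M \<phi> u) \<and>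
         positive_transfers M (\<lambda>_. 0) (tstar M \<phi> u) \<and>
         (\<forall>q t0 t1. optimal M \<gamma> q t0 t1 \<and> positive_transfers M t0 t1 \<longrightarrow>
            (AE (\<theta>, v) in joint_law M.
               q \<theta> v = qstar M \<phi> \<theta> v \<and> t0 \<theta> = 0 \<and> t1 \<theta> v = tstar M \<phi> u \<theta> v))"
proof -
  interpret optimal_mechanism M \<phi> u \<gamma>
    by unfold_locales (fact assms)+
  have "optimal_mechanism M \<phi> u \<gamma>" by unfold_locales
  then obtain p q t1 where
    p: "\<And>\<theta>. \<theta> \<in> T \<Longrightarrow> pricing_schedule (p \<theta>)" "\<And>\<theta>. \<theta> \<in> T \<Longrightarrow> minimum_spend (p \<theta>) (ts \<theta> (v_inf M \<theta>))"
      "\<And>\<theta> v. \<theta> \<in> T \<Longrightarrow> 0 < g \<theta> v \<Longrightarrow> p \<theta> (qs \<theta> v) = ts \<theta> v"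
    and q: "\<And>\<theta> v. \<theta> \<in> T \<Longrightarrow> 0 < g \<theta> v \<Longrightarrow> q \<theta> v = qs \<theta> v"
      "chosen_from M p q t1" "optimal M \<gamma> q (\<lambda>_. 0) t1"
    using committed_spend_schedule by blast
  have "committed_spend M p" if "\<forall>\<theta>\<in>T. lo < \<theta> \<longrightarrow> served M \<phi> \<theta>"
    unfolding committed_spend_def using that p(1,2) tstar_v_inf_pos by blast
  moreover have "positive_transfers M (\<lambda>_. 0) ts"
    unfolding positive_transfers_def on_path_def
  proof (intro conjI ballI; clarify?)
    fix \<theta> v assume *: "\<theta> \<in> T" "0 < g \<theta> v"
    \<comment> \<open>On-path payments are prices of a nonnegative schedule.\<close>
    have "0 \<le> p \<theta> (qs \<theta> v)"
      using p(1)[OF *(1)] qstar_nonneg by (simp add: pricing_schedule_def)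
    then show "0 \<le> ts \<theta> v" using p(3)[OF *] by simp
  qed
  moreover have "AE (\<theta>, v) in joint_law M. q \<theta> v = qs \<theta> v \<and> t0 \<theta> = 0 \<and> t1 \<theta> v = ts \<theta> v"
    if "optimal M \<gamma> q t0 t1 \<and> positive_transfers M t0 t1" for q t0 t1
    using that by (intro optimal_unique) (auto simp: positive_transfers_def)
  ultimately show ?thesis
    using p q star_optimal tstar_v_inf_pos unfolding on_path_def
    by (intro conjI exI[of _ p] exI[of _ q] exI[of _ t1]) auto
qed

end
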